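(* Let $L>m>0$. Let $\mathcal{A}_{\mathrm{GHB},m,L}$ denote the set of all pairs $(\alpha,\beta)$ for which the heavy ball algorithm $$x_{t+1}=x_t-\alpha\nabla f(x_t)+\beta(x_t-x_{t-1}),\qquad t=0,1,\ldots,$$ converges globally (globally asymptotically to $x^*$) for all $f\in\mathcal{F}_{m,L}^2$, and let $r_{\mathrm{GHB}}$ denote the $R$-factor of this iterative process at $x^*$. Then $$\inf_{\mathcal{A}_{\mathrm{GHB},m,L}}\ \sup_{\mathcal{F}_{m,L}^2} r_{\mathrm{GHB}}\le r^*,$$ where the constant $r^*$ is defined by $$r^*=\min\Big\{\sup_{\Delta}\rho(A(\Delta)):\ \alpha\in(0,\bar\alpha(\beta)),\ \beta\in[0,1)\Big\},$$ the supremum being over the set of (symmetric $n\times n$) matrices $\Delta$ which satisfy $mI\le\Delta\le LI$. The constant $r^*$ has the value $$r^*=\begin{cases} \dfrac{\sqrt L-\sqrt m}{\sqrt L+\sqrt m}, & 1<\frac Lm\le\kappa_0,\\[2mm] \nu(L/m), & \kappa_0\le\frac Lm<\bar\kappa,\\[1mm] \eta(\beta_0(L/m)), & \frac Lm\ge\bar\kappa . \end{cases}$$ The minimum in the definition of $r^*$ is achieved when $\alpha=\alpha^*$ and $\beta=\beta^*$, where $$\alpha^*=\begin{cases} \dfrac{4}{(\sqrt L+\sqrt m)^2}, & 1<\frac Lm\le\kappa_0,\\[2mm] \bar\alpha\left(\nu^2(L/m)\right), & \kappa_0\le\frac Lm<\bar\kappa,\\[1mm] \bar\alpha(\beta_0(L/m)),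 & \frac Lm\ge\bar\kappa, \end{cases} \qquad \beta^*=\begin{cases} \left(\dfrac{\sqrt L-\sqrt m}{\sqrt L+\sqrt m}\right)^2, & 1<\frac Lm\le\kappa_0,\\[2mm] \nu^2(L/m), & \kappa_0\le\frac Lm<\bar\kappa,\\[1mm] \beta_0(L/m), & \frac Lm\ge\bar\kappa. \end{cases}$$
   Context: **Function classes.** For $L\ge m>0$, $\mathcal{F}_{m,L}^1$ is the class of differentiable (possibly non-convex) functions $f:\mathbf{R}^n\to\mathbf{R}$ for which there is a point $x^*\in\mathbf{R}^n$ at which the minimum of $f$ is attained and such that for every $x\in\mathbf{R}^n$ $$\left(m(x-x^* )-\nabla f(x)\right)^T\left(L(x-x^* )-\nabla f(x)\right)\le 0 .$$ $\mathcal{F}_{m,L}^2$ is the class of such functions that are two times differentiable; for these the Hessian $\Delta=\nabla^2f(x^* )$ satisfies $mI\le\Delta\le LI$. **Global asymptotic convergence.** Let $x_t$ denote the vector of iterates of the algorithm at step $t$, initiated at time $0$ with $x_0,x_{-1}$. The algorithm is said to converge globally asymptotically to $x^*$ if its iterates have the following properties: (a) for every $\epsilon>0$ there exists $\delta=\delta(\epsilon)>0$ such that $\|x_{-1}-x^*\|<\delta$, $\|x_0-x^*\|<\delta$ imply that $\|x_t-x^*\|<\epsilon$ for all $t\ge0$; and (b) $\lim_{t\to\infty}\|x_t-x^*\|=0$ uniformly in $x_0,x_{-1}$ for all $x_0,x_{-1}\in\mathbf{R}^n$. **$R$-factor.** For a sequence $\{x_t\}$ converging to $x^*$, its $R$-factor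 is $r_{\{x_t\}}=\limsup_{t\to\infty}\|x_t-x^*\|^{1/t}$. For an iterative process $\mathcal{I}$ with limit point $x^*$, its $R$-factor at $x^*$ is $r_{\mathcal{I}}=\sup r_{\{x_t\}}$, the supremum being over all sequences generated by $\mathcal{I}$ which converge to $x^*$. **Notation.** $\rho(A(\Delta))$ denotes the spectral radius of the matrix $$A(\Delta)=\begin{bmatrix}0 & I\\ -\beta I & (1+\beta)I-\alpha\Delta\end{bmatrix}$$ (depending on $\alpha,\beta$). Write $\kappa=L/m$. The function $\bar\alpha$ is $$\bar\alpha(\beta)=\begin{cases}\dfrac{2(1+\beta)}{L}, & \beta\le\left(\sqrt{\kappa}-\sqrt{\kappa-1}\right)^2,\\[2mm] \dfrac{2(1-\beta)^2}{(1+\beta)(L+m)-4\sqrt{\beta Lm}}, & \beta>\left(\sqrt{\kappa}-\sqrt{\kappa-1}\right)^2.\end{cases}$$ With $\gamma_m(\alpha,\beta)=m\alpha-1-\beta$, set $$\eta(\beta)=\frac{-\gamma_m(\bar\alpha(\beta),\beta)+\sqrt{\gamma_m(\bar\alpha(\beta),\beta)^2-4\beta}}{2}.$$ For every $\kappa=L/m>8$ the function $\eta$ has a unique local minimum in the interval $\left((\sqrt\kappa-\sqrt{\kappa-1})^2,1\right)$, attained at $\beta=\beta_0(\kappa)$, where, with $s=\sqrt{\frac{\kappa-8}{\kappa}}$, $$\beta_0(\kappa)=\frac{\kappa\left(\kappa\left(-\sqrt2\sqrt{\frac{(\kappa-1)\left((s+1)\kappa^2+(7s-5)\kappa+12\right)}{\kappa^3}}+s+1\right)-s+7\right)^2}{16(\kappa+1)^2}.$$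 Further, $\kappa_0=3+2\sqrt2$, $$\nu(\kappa)=\frac{2-\sqrt{2\sqrt\kappa+3-\kappa}}{\sqrt\kappa-1},\qquad \kappa\in[\kappa_0,9],$$ and $\bar\kappa\approx8.2975$ is the unique solution in the interval $[8,9]$ of the equation $\eta(\beta_0(\kappa))=\nu(\kappa)$ (with $\eta$ taken for the same value $\kappa=L/m$).
   Formalization: r* is the infimum over the open range of α; for L/m ≥ κ0 it is achieved at (α*,β* ) only once the endpoint α=ᾱ(β) is admitted. Convergence in (b) is uniform on bounded sets of initial pairs, not on all of R^n. *)

theory Defs
  imports "HOL-Analysis.Analysis" "Jordan_Normal_Form.Spectral_Radius"
begin

section \<open>Function classes\<close>

definition gradient :: "(real^'n \<Rightarrow> real) \<Rightarrow> real^'n \<Rightarrow> real^'n" where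
  "gradient f x = (THE D. GDERIV f x :> D)"

definition F1_at :: "real \<Rightarrow> real \<Rightarrow> (real^'n \<Rightarrow> real) \<Rightarrow> real^'n \<Rightarrow> bool" where
  "F1_at m L f xs \<longleftrightarrow>
     (\<forall>x. f differentiable (at x)) \<and>
     (\<forall>x. f xs \<le> f x) \<and>
     (\<forall>x. inner (m *\<^sub>R (x - xs) - gradient f x) (L *\<^sub>R (x - xs) - gradient f x) \<le> 0)"

definition F1 :: "real \<Rightarrow> real \<Rightarrow> (real^'n \<Rightarrow> real) set" where
  "F1 m L = {f. \<exists>xs. F1_at m L f xs}"

text \<open>The bounds \<open>m I \<le> \<nabla>\<^sup>2 f(x\<^sup>*) \<le> L I\<close> are a consequence of the sector inequality near
  \<open>x\<^sup>*\<close>, so they are not part of the definition of \<open>F2\<close>.\<close>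

definition F2 :: "real \<Rightarrow> real \<Rightarrow> (real^'n \<Rightarrow> real) set" where
  "F2 m L = {f \<in> F1 m L. \<forall>x. gradient f differentiable (at x)}"

text \<open>For \<open>0 < m \<le> L\<close> the minimizer of a function in \<open>F1 m L\<close> is unique, because the sector
  inequality excludes critical points other than \<open>x\<^sup>*\<close>.\<close>

definition minimizer :: "(real^'n \<Rightarrow> real) \<Rightarrow> real^'n" where
  "minimizer f = arg_min f (\<lambda>_. True)"

lemma F1_at_minimizer:
  fixes f :: "real^'n \<Rightarrow> real"
  assumes "0 < m" "0 < L" "F1_at m L f xs"
  shows "minimizer f = xs"
proof -
  have min: "is_arg_min f (\<lambda>_. True) xs"
    using assms(3) by (auto simp: F1_at_def is_arg_min_def not_less)
  have uniq: "y = xs" if y: "is_arg_min f (\<lambda>_. True) y" for y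
  proof -
    have fy: "f y \<le> f x" for x
      using y by (auto simp: is_arg_min_def not_less)
    from assms(3) obtain f' where f': "(f has_derivative f') (at y)"
      unfolding F1_at_def differentiable_def by blast
    have "f' = (\<lambda>h. 0)"
      by (rule differential_zero_maxmin[OF _ open_UNIV f']) (use fy in auto)
    with f' have g0: "GDERIV f y :> 0"
      by (simp add: gderiv_def)
    have "gradient f y = 0"
      unfolding gradient_def
    proof (rule the_equality)
      show "GDERIV f y :> 0" by (fact g0)
    next
      fix D assume "GDERIV f y :> D"
      then have "(\<lambda>h. inner h D) = (\<lambda>h. inner h 0)"
        using g0 unfolding gderiv_def by (rule has_derivative_unique)
      then have "inner D D = inner D 0" by metis
      then show "D = 0" by simp
    qed
    then have "m * L * inner (y - xs) (y - xs) \<le> 0"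
      using assms(3) unfolding F1_at_def by (auto simp: mult_ac dest!: spec[of _ y])
    then have "inner (y - xs) (y - xs) \<le> 0"
      using assms(1,2) by (simp add: mult_le_0_iff)
    then have "y - xs = 0" by (metis inner_eq_zero_iff inner_ge_zero order_antisym)
    then show "y = xs" by simp
  qed
  show ?thesis
    unfolding minimizer_def arg_min_def using someI[of "is_arg_min f (\<lambda>_. True)", OF min] uniq
    by blast
qed

section \<open>The heavy ball algorithm\<close>

text \<open>The argument \<open>xm\<close> is the initial point \<open>x\<^sub>-\<^sub>1\<close>.\<close>

fun hb :: "real \<Rightarrow> real \<Rightarrow> (real^'n \<Rightarrow> real) \<Rightarrow> real^'n \<Rightarrow> real^'n \<Rightarrow> nat \<Rightarrow> real^'n" where
  "hb \<alpha> \<beta> f xm x0 0 = x0"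
| "hb \<alpha> \<beta> f xm x0 (Suc 0) = x0 - \<alpha> *\<^sub>R gradient f x0 + \<beta> *\<^sub>R (x0 - xm)"
| "hb \<alpha> \<beta> f xm x0 (Suc (Suc t)) =
     hb \<alpha> \<beta> f xm x0 (Suc t) - \<alpha> *\<^sub>R gradient f (hb \<alpha> \<beta> f xm x0 (Suc t))
       + \<beta> *\<^sub>R (hb \<alpha> \<beta> f xm x0 (Suc t) - hb \<alpha> \<beta> f xm x0 t)"

text \<open>The limit is required to be uniform on every bounded set of initial pairs
  \<open>(x\<^sub>-\<^sub>1, x\<^sub>0)\<close>, as is usual for global asymptotic stability. Uniformity over the whole space
  at once already fails for quadratic \<open>f\<close>, for which \<open>x\<^sub>t - x\<^sup>*\<close> is linear in
  \<open>(x\<^sub>-\<^sub>1 - x\<^sup>*, x\<^sub>0 - x\<^sup>*)\<close>.\<close>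

definition gas :: "real \<Rightarrow> real \<Rightarrow> (real^'n \<Rightarrow> real) \<Rightarrow> real^'n \<Rightarrow> bool" where
  "gas \<alpha> \<beta> f xs \<longleftrightarrow>
     (\<forall>\<epsilon>>0. \<exists>\<delta>>0. \<forall>xm x0. norm (xm - xs) < \<delta> \<longrightarrow> norm (x0 - xs) < \<delta> \<longrightarrow>
        (\<forall>t. norm (hb \<alpha> \<beta> f xm x0 t - xs) < \<epsilon>)) \<and>
     (\<forall>B. bounded B \<longrightarrow>
        uniform_limit B (\<lambda>t (xm, x0). norm (hb \<alpha> \<beta> f xm x0 t - xs)) (\<lambda>_. 0) sequentially)"

definition GHB_set :: "(real^'n \<Rightarrow> real) set \<Rightarrow> (real \<times> real) set" where
  "GHB_set F = {(\<alpha>, \<beta>). \<forall>f\<in>F. gas \<alpha> \<beta> f (minimizer f)}"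

definition seq_R_factor :: "(nat \<Rightarrow> real^'n) \<Rightarrow> real^'n \<Rightarrow> ereal" where
  "seq_R_factor x xs = limsup (\<lambda>t. ereal (root t (norm (x t - xs))))"

definition r_GHB :: "real \<Rightarrow> real \<Rightarrow> (real^'n \<Rightarrow> real) \<Rightarrow> ereal" where
  "r_GHB \<alpha> \<beta> f =
     (SUP (xm, x0)\<in>{(xm, x0). hb \<alpha> \<beta> f xm x0 \<longlonglongrightarrow> minimizer f}.
        seq_R_factor (hb \<alpha> \<beta> f xm x0) (minimizer f))"

section \<open>The spectral problem\<close>

definition A_mat :: "nat \<Rightarrow> real \<Rightarrow> real \<Rightarrow> real mat \<Rightarrow> real mat" where
  "A_mat n \<alpha> \<beta> \<Delta> =
     four_block_mat (0\<^sub>m n n) (1\<^sub>m n)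
       ((- \<beta>) \<cdot>\<^sub>m 1\<^sub>m n) ((1 + \<beta>) \<cdot>\<^sub>m 1\<^sub>m n - \<alpha> \<cdot>\<^sub>m \<Delta>)"

definition rho :: "real mat \<Rightarrow> real" where
  "rho M = spectral_radius (map_mat complex_of_real M)"

definition loewner_le :: "nat \<Rightarrow> real mat \<Rightarrow> real mat \<Rightarrow> bool" where
  "loewner_le n M N \<longleftrightarrow> (\<forall>v\<in>carrier_vec n. 0 \<le> scalar_prod v ((N - M) *\<^sub>v v))"

definition Hessians :: "nat \<Rightarrow> real \<Rightarrow> real \<Rightarrow> real mat set" where
  "Hessians n m L = {\<Delta> \<in> carrier_mat n n. transpose_mat \<Delta> = \<Delta> \<and>
     loewner_le n (m \<cdot>\<^sub>m 1\<^sub>m n) \<Delta> \<and> loewner_le n \<Delta> (L \<cdot>\<^sub>m 1\<^sub>m n)}"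

definition sup_rho :: "nat \<Rightarrow> real \<Rightarrow> real \<Rightarrow> real \<Rightarrow> real \<Rightarrow> real" where
  "sup_rho n m L \<alpha> \<beta> = (SUP \<Delta>\<in>Hessians n m L. rho (A_mat n \<alpha> \<beta> \<Delta>))"

definition alpha_bar :: "real \<Rightarrow> real \<Rightarrow> real \<Rightarrow> real" where
  "alpha_bar m L \<beta> =
     (if \<beta> \<le> (sqrt (L/m) - sqrt (L/m - 1))^2 then 2 * (1 + \<beta>) / L
      else 2 * (1 - \<beta>)^2 / ((1 + \<beta>) * (L + m) - 4 * sqrt (\<beta> * L * m)))"

text \<open>The minimum over \<open>\<alpha> \<in> {0<..<alpha_bar m L \<beta>}\<close> is rendered as an infimum: for
  \<open>L / m \<ge> kappa0\<close> the optimal \<open>\<alpha>\<close> is the excluded endpoint \<open>alpha_bar m L \<beta>\<close>.\<close>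

definition r_star :: "nat \<Rightarrow> real \<Rightarrow> real \<Rightarrow> real" where
  "r_star n m L =
     (INF (\<alpha>, \<beta>)\<in>{(\<alpha>, \<beta>). \<alpha> \<in> {0<..<alpha_bar m L \<beta>} \<and> \<beta> \<in> {0..<1}}. sup_rho n m L \<alpha> \<beta>)"

text \<open>The pair \<open>(\<alpha>, \<beta>)\<close> attains the value \<open>r_star\<close>, and is a minimizer once the endpoint
  \<open>alpha_bar m L \<beta>\<close> is admitted.\<close>

definition r_star_achieved_at :: "nat \<Rightarrow> real \<Rightarrow> real \<Rightarrow> real \<Rightarrow> real \<Rightarrow> bool" where
  "r_star_achieved_at n m L \<alpha> \<beta> \<longleftrightarrow>
     sup_rho n m L \<alpha> \<beta> = r_star n m L \<and>
     is_arg_min (\<lambda>(a, b). sup_rho n m L a b)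
       (\<lambda>(a, b). a \<in> {0<..alpha_bar m L b} \<and> b \<in> {0..<1}) (\<alpha>, \<beta>)"

section \<open>The constants in the closed form of the optimum\<close>

definition gamma_m :: "real \<Rightarrow> real \<Rightarrow> real \<Rightarrow> real" where
  "gamma_m m \<alpha> \<beta> = m * \<alpha> - 1 - \<beta>"

definition eta :: "real \<Rightarrow> real \<Rightarrow> real \<Rightarrow> real" where
  "eta m L \<beta> =
     (- gamma_m m (alpha_bar m L \<beta>) \<beta> + sqrt ((gamma_m m (alpha_bar m L \<beta>) \<beta>)^2 - 4 * \<beta>)) / 2"

definition beta0 :: "real \<Rightarrow> real" where
  "beta0 \<kappa> = (let s = sqrt ((\<kappa> - 8) / \<kappa>) in
     \<kappa> * (\<kappa> * (- sqrt 2 * sqrt ((\<kappa> - 1) * ((s + 1) * \<kappa>^2 + (7 * s - 5) * \<kappa> + 12) / \<kappa>^3) + s + 1)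
            - s + 7)^2
     / (16 * (\<kappa> + 1)^2))"

definition kappa0 :: real where
  "kappa0 = 3 + 2 * sqrt 2"

definition nu :: "real \<Rightarrow> real" where
  "nu \<kappa> = (2 - sqrt (2 * sqrt \<kappa> + 3 - \<kappa>)) / (sqrt \<kappa> - 1)"

text \<open>The value \<open>eta m L \<beta>\<close> depends on \<open>m\<close> and \<open>L\<close> only through \<open>L / m\<close>, so the
  equation for \<open>kappa_bar\<close> is stated with \<open>m = 1\<close> and \<open>L = \<kappa>\<close>. Its solution is
  approximately 8.2975.\<close>

definition kappa_bar :: real where
  "kappa_bar = (THE \<kappa>. \<kappa> \<in> {8..9} \<and> eta 1 \<kappa> (beta0 \<kappa>) = nu \<kappa>)"

end

theory Submission
  imports Defs
begin

text \<open>On an eigenvector of \<open>\<Delta>\<close> with eigenvalue \<open>\<mu> \<in> [m, L]\<close> the matrix \<open>A(\<Delta>)\<close> acts as the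
companion matrix of \<open>\<zeta>^2 + (\<alpha> \<mu> - 1 - \<beta>) \<zeta> + \<beta>\<close>. Both roots lie in the disc of radius \<open>r\<close> iff
\<open>\<beta> < r^2\<close> and \<open>|\<alpha> \<mu> - 1 - \<beta>| < r + \<beta> / r\<close>, and since the left side is convex in \<open>\<mu>\<close> it suffices
to ask this at \<open>\<mu> = m\<close> and \<open>\<mu> = L\<close> (\<open>rate_lt\<close>; \<open>rate_lt_of_sup_rho\<close>, \<open>sup_rho_le\<close>). The
spectral problem thus becomes a problem about two real inequalities.

Dynamics. Write \<open>q = 1 + \<beta> - \<alpha> (L + m) / 2\<close>. The form \<open>|a|^2 - q a \<bullet> c + \<beta> |c|^2\<close> in
\<open>a = x\<^sub>t - x\<^sup>*\<close> and \<open>c = x\<^sub>t\<^sub>-\<^sub>1 - x\<^sup>*\<close> decreases by a fixed factor along the iteration, for every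
gradient in the sector, as soon as
\<open>|(1 - \<beta>)^2 / \<alpha> - (1 + \<beta>) (L + m) / 2| < 2 sqrt (\<beta> L m)\<close>; this gives global convergence
(\<open>globally_convergent\<close>). A trajectory that converges to \<open>x\<^sup>*\<close> obeys the recursion linearized
with the Hessian at \<open>x\<^sup>*\<close> up to an error \<open>o(|a|)\<close>. A second quadratic form, adapted to a rate
\<open>r\<close> and using that the Hessian is symmetric, grows at most by the factor \<open>r^2 + o(1)\<close> per step
(\<open>perturbed_linear_rate\<close>), so the R-factor is at most \<open>r\<close> whenever \<open>rate_lt\<close> holds for \<open>r\<close>. The
optimal pair satisfies the inequality for global convergence in a non-strict form, and lowering
\<open>\<alpha>\<close> a little makes it strict while \<open>rate_lt\<close> is kept for a given \<open>r > r\<^sup>*\<close> (\<open>optimal_tuning\<close>).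

Optimization. Let \<open>k = sqrt (L / m)\<close> and \<open>s = sqrt \<beta>\<close>. For \<open>k \<le> 1 + sqrt 2\<close> the inequalities at
\<open>m\<close> and \<open>L\<close> alone bound the rate from below, and the classical tuning meets the constraint
\<open>\<alpha> \<le> alpha_bar\<close>. For larger \<open>k\<close> a rate below \<open>v\<close> is excluded once every \<open>s \<in> [0, v]\<close>, used with
the largest \<open>\<alpha>\<close> on the second branch of \<open>alpha_bar\<close>, leaves a root of modulus at least \<open>v\<close> at \<open>m\<close>
(\<open>boundary_tuning\<close>). With \<open>s = tanh (u / 2)\<close>, \<open>C = cosh u\<close>, \<open>S = sinh u\<close> and
\<open>T = (1 + v) / (1 - v)\<close> this condition reads
\<open>T^2 - 1 \<le> (T - C) ((k^2 + 1) C - 2 k S)\<close>, and the best \<open>v\<close> is where equality first occurs. There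
are two ways. Either the two sides touch at an interior \<open>s\<close>: eliminating \<open>T\<close> from the
condition for a double zero leaves a quadratic in \<open>tanh u\<close> with discriminant
\<open>(k^2 - 1)^2 (k^2 - 8)\<close>, which becomes a square for \<open>k = z + 2 / z\<close>. In the parameter \<open>z\<close> the
point of tangency is explicit (it is \<open>beta0\<close>), and the difference of the two sides factors into
\<open>cosh (u - u\<^sub>0) - 1\<close> times a decreasing function (\<open>gap_factorization\<close>). Or equality occurs at the
end \<open>s = v\<close>, which gives \<open>v = nu\<close>. Comparing the two values of \<open>T\<close> leaves the sign of
\<open>(z^2 + 1) (z - 1)^2 - 2\<close>, an increasing function of \<open>z\<close> whose zero belongs to \<open>kappa_bar\<close>
(\<open>kappa_bar_le_iff\<close>). Below \<open>kappa_bar\<close> an interior minimum with a value smaller than \<open>nu\<close> would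
be a critical point, hence a tangency, hence have \<open>z\<close> beyond that zero
(\<open>critical_point\<close>, \<open>gap_root_ge_cayley_nu\<close>).\<close>

section \<open>The spectral radius of the iteration matrix\<close>

text \<open>For \<open>r > 0\<close>, \<open>0 \<le> \<alpha>\<close> and \<open>0 \<le> \<beta>\<close> these are the Jury conditions for
\<open>\<zeta>^2 + (\<alpha> \<mu> - 1 - \<beta>) \<zeta> + \<beta>\<close> to have its roots inside the disc of radius \<open>r\<close>, at the two
extreme eigenvalues \<open>\<mu> = m\<close> and \<open>\<mu> = L\<close>.\<close>

definition rate_lt :: "real \<Rightarrow> real \<Rightarrow> real \<Rightarrow> real \<Rightarrow> real \<Rightarrow> bool" where
  "rate_lt r m L \<alpha> \<beta> \<longleftrightarrow> \<beta> < r^2 \<and> \<bar>\<alpha> * m - 1 - \<beta>\<bar> < r + \<beta> / r \<and> \<bar>\<alpha> * L - 1 - \<beta>\<bar> < r + \<beta> / r"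

definition rate_le :: "real \<Rightarrow> real \<Rightarrow> real \<Rightarrow> real \<Rightarrow> real \<Rightarrow> bool" where
  "rate_le r m L \<alpha> \<beta> \<longleftrightarrow> \<beta> \<le> r^2 \<and> \<bar>\<alpha> * m - 1 - \<beta>\<bar> \<le> r + \<beta> / r \<and> \<bar>\<alpha> * L - 1 - \<beta>\<bar> \<le> r + \<beta> / r"

lemma rate_lt_imp_le: "rate_lt r m L \<alpha> \<beta> \<Longrightarrow> rate_le r m L \<alpha> \<beta>"
  unfolding rate_lt_def rate_le_def by simp

lemma A_mat_mult_append:
  fixes u w :: "complex vec"
  assumes \<Delta>: "\<Delta> \<in> carrier_mat n n" and u: "u \<in> carrier_vec n" and w: "w \<in> carrier_vec n"
  shows "map_mat complex_of_real (A_mat n \<alpha> \<beta> \<Delta>) *\<^sub>v (u @\<^sub>v w) =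
    w @\<^sub>v vec n (\<lambda>i. - of_real \<beta> * u $ i + of_real (1 + \<beta>) * w $ i - of_real \<alpha> * (\<Sum>j<n. of_real (\<Delta> $$ (i, j)) * w $ j))"
    (is "_ = w @\<^sub>v ?row")
proof -
  have blk: "map_mat complex_of_real (A_mat n \<alpha> \<beta> \<Delta>) =
    four_block_mat (0\<^sub>m n n) (1\<^sub>m n) (of_real (- \<beta>) \<cdot>\<^sub>m 1\<^sub>m n)
      (of_real (1 + \<beta>) \<cdot>\<^sub>m 1\<^sub>m n - of_real \<alpha> \<cdot>\<^sub>m map_mat complex_of_real \<Delta>)"
    using \<Delta> unfolding A_mat_def by (intro eq_matI) (auto simp: four_block_mat_def Let_def)
  have D: "map_mat complex_of_real \<Delta> \<in> carrier_mat n n" using \<Delta> by simp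
  have "(of_real (- \<beta>) \<cdot>\<^sub>m 1\<^sub>m n) *\<^sub>v u
      + (of_real (1 + \<beta>) \<cdot>\<^sub>m 1\<^sub>m n - of_real \<alpha> \<cdot>\<^sub>m map_mat complex_of_real \<Delta>) *\<^sub>v w
     = ?row"
  proof (rule eq_vecI)
    fix i assume "i < dim_vec (?row)"
    then have i: "i < n" by simp
    have "(\<Sum>j = 0..<n. (- complex_of_real \<beta> * (if j = i then 1 else 0)) * u $ j) = - of_real \<beta> * u $ i"
      using i by (simp add: if_distrib if_distribR sum.delta cong: if_cong)
    moreover have "(\<Sum>j = 0..<n. (complex_of_real (1 + \<beta>) * (if i = j then 1 else 0) - of_real \<alpha> * of_real (\<Delta> $$ (i, j))) * w $ j)
       = of_real (1 + \<beta>) * w $ i - of_real \<alpha> * (\<Sum>j<n. of_real (\<Delta> $$ (i, j)) * w $ j)"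
    proof -
      have "(\<Sum>j = 0..<n. (complex_of_real (1 + \<beta>) * (if i = j then 1 else 0) - of_real \<alpha> * of_real (\<Delta> $$ (i, j))) * w $ j)
        = (\<Sum>j = 0..<n. (if i = j then complex_of_real (1 + \<beta>) * w $ j else 0)) - (\<Sum>j = 0..<n. of_real \<alpha> * (of_real (\<Delta> $$ (i, j)) * w $ j))"
        unfolding sum_subtractf[symmetric] by (rule sum.cong) (auto simp: algebra_simps)
      then show ?thesis using i by (simp add: sum_distrib_left atLeast0LessThan)
    qed
    ultimately show "((of_real (- \<beta>) \<cdot>\<^sub>m 1\<^sub>m n) *\<^sub>v u
      + (of_real (1 + \<beta>) \<cdot>\<^sub>m 1\<^sub>m n - of_real \<alpha> \<cdot>\<^sub>m map_mat complex_of_real \<Delta>) *\<^sub>v w) $ i =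
      ?row $ i"
      using i u w \<Delta> by (simp add: scalar_prod_def)
  qed (use u w \<Delta> in auto)
  moreover have "0\<^sub>m n n *\<^sub>v u + 1\<^sub>m n *\<^sub>v w = w"
    using u w by (intro eq_vecI) (auto simp: scalar_prod_def)
  moreover have "of_real (1 + \<beta>) \<cdot>\<^sub>m 1\<^sub>m n - of_real \<alpha> \<cdot>\<^sub>m map_mat complex_of_real \<Delta> \<in> carrier_mat n n"
    using D by (intro minus_carrier_mat) simp
  ultimately show ?thesis unfolding blk
    by (subst four_block_mat_mult_vec[of _ n n _ n _ n]) (use u w in auto)
qed

lemma A_mat_carrier: "\<Delta> \<in> carrier_mat n n \<Longrightarrow> map_mat complex_of_real (A_mat n \<alpha> \<beta> \<Delta>) \<in> carrier_mat (n + n) (n + n)"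
  unfolding A_mat_def by auto

text \<open>For a multiple of the identity every eigenvector \<open>u\<close> of \<open>\<Delta>\<close> lifts to the eigenvector
\<open>(u, \<zeta> u)\<close>; the two extreme multiples are what makes the supremum large.\<close>

lemma scalar_quadratic_eigenvalue:
  assumes n: "0 < n" and l: "\<zeta>^2 + of_real (\<alpha> * \<mu> - 1 - \<beta>) * \<zeta> + of_real \<beta> = 0"
  shows "eigenvalue (map_mat complex_of_real (A_mat n \<alpha> \<beta> (\<mu> \<cdot>\<^sub>m 1\<^sub>m n))) \<zeta>"
proof -
  let ?M = "map_mat complex_of_real (A_mat n \<alpha> \<beta> (\<mu> \<cdot>\<^sub>m 1\<^sub>m n))"
  let ?u = "unit_vec n 0 :: complex vec"
  let ?v = "?u @\<^sub>v (\<zeta> \<cdot>\<^sub>v ?u)"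
  have D: "\<mu> \<cdot>\<^sub>m 1\<^sub>m n \<in> carrier_mat n n" by simp
  have "?M *\<^sub>v ?v = \<zeta> \<cdot>\<^sub>v ?v"
  proof -
    have "vec n (\<lambda>i. - of_real \<beta> * ?u $ i + of_real (1 + \<beta>) * (\<zeta> \<cdot>\<^sub>v ?u) $ i
       - of_real \<alpha> * (\<Sum>j<n. of_real ((\<mu> \<cdot>\<^sub>m 1\<^sub>m n) $$ (i, j)) * (\<zeta> \<cdot>\<^sub>v ?u) $ j)) = \<zeta> \<cdot>\<^sub>v (\<zeta> \<cdot>\<^sub>v ?u)"
    proof (rule eq_vecI)
      fix i assume "i < dim_vec (\<zeta> \<cdot>\<^sub>v (\<zeta> \<cdot>\<^sub>v ?u))"
      then have i: "i < n" by simp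
      have "(\<Sum>j<n. of_real ((\<mu> \<cdot>\<^sub>m 1\<^sub>m n) $$ (i, j)) * (\<zeta> \<cdot>\<^sub>v ?u) $ j) = (\<Sum>j<n. if j = i then of_real \<mu> * (\<zeta> * ?u $ i) else 0)"
        by (rule sum.cong) (use i in auto)
      also have "\<dots> = of_real \<mu> * (\<zeta> * ?u $ i)" using i by simp
      finally show "vec n (\<lambda>i. - of_real \<beta> * ?u $ i + of_real (1 + \<beta>) * (\<zeta> \<cdot>\<^sub>v ?u) $ i
       - of_real \<alpha> * (\<Sum>j<n. of_real ((\<mu> \<cdot>\<^sub>m 1\<^sub>m n) $$ (i, j)) * (\<zeta> \<cdot>\<^sub>v ?u) $ j)) $ i = (\<zeta> \<cdot>\<^sub>v (\<zeta> \<cdot>\<^sub>v ?u)) $ i"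
        using i l by (auto simp: unit_vec_def power2_eq_square algebra_simps)
    qed simp
    then show ?thesis using A_mat_mult_append[OF D, of ?u "\<zeta> \<cdot>\<^sub>v ?u" \<alpha> \<beta>] by (intro eq_vecI) auto
  qed
  moreover have "?v \<noteq> 0\<^sub>v (n + n)"
  proof
    assume "?v = 0\<^sub>v (n + n)"
    then have "?v $ 0 = 0\<^sub>v (n + n) $ 0" by simp
    then show False using n by simp
  qed
  moreover have "dim_row ?M = n + n" unfolding A_mat_def by simp
  ultimately have "eigenvector ?M ?v \<zeta>" unfolding eigenvector_def by simp
  then show ?thesis unfolding eigenvalue_def by blast
qed

lemma rho_ge_eigenvalue:
  assumes "\<Delta> \<in> carrier_mat n n" "0 < n" "eigenvalue (map_mat complex_of_real (A_mat n \<alpha> \<beta> \<Delta>)) \<zeta>"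
  shows "norm \<zeta> \<le> rho (A_mat n \<alpha> \<beta> \<Delta>)"
  unfolding rho_def using spectral_radius_mem_max(2)[OF A_mat_carrier[OF assms(1)]] assms(2,3)
  unfolding spectrum_def by auto

lemma rho_attained:
  assumes "\<Delta> \<in> carrier_mat n n" "0 < n"
  obtains \<zeta> where "eigenvalue (map_mat complex_of_real (A_mat n \<alpha> \<beta> \<Delta>)) \<zeta>" "rho (A_mat n \<alpha> \<beta> \<Delta>) = norm \<zeta>"
  using spectral_radius_mem_max(1)[OF A_mat_carrier[OF assms(1)]] assms(2)
  unfolding rho_def spectrum_def by auto

lemma scalar_prod_diff_sum:
  fixes v :: "real Matrix.vec"
  assumes \<Delta>: "\<Delta> \<in> carrier_mat n n" and N: "N \<in> carrier_mat n n" and v: "v \<in> carrier_vec n"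
  shows "scalar_prod v ((N - \<Delta>) *\<^sub>v v) =
    (\<Sum>i<n. \<Sum>j<n. v $ i * (N $$ (i, j) * v $ j)) - (\<Sum>i<n. \<Sum>j<n. v $ i * (\<Delta> $$ (i, j) * v $ j))"
proof -
  have "scalar_prod v ((N - \<Delta>) *\<^sub>v v) = (\<Sum>i<n. v $ i * (\<Sum>j<n. (N $$ (i, j) - \<Delta> $$ (i, j)) * v $ j))"
    using \<Delta> N v by (simp add: scalar_prod_def atLeast0LessThan)
  then show ?thesis by (simp add: sum_distrib_left sum_subtractf[symmetric] algebra_simps)
qed

lemma loewner_sum:
  assumes \<Delta>: "\<Delta> \<in> carrier_mat n n" and N: "N \<in> carrier_mat n n" and le: "loewner_le n \<Delta> N"
  shows "(\<Sum>i<n. \<Sum>j<n. x i * (\<Delta> $$ (i, j) * x j)) \<le> (\<Sum>i<n. \<Sum>j<n. x i * (N $$ (i, j) * x j))"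
proof -
  have "0 \<le> scalar_prod (vec n x) ((N - \<Delta>) *\<^sub>v vec n x)"
    using le unfolding loewner_le_def by simp
  then show ?thesis unfolding scalar_prod_diff_sum[OF \<Delta> N vec_carrier] by simp
qed

lemma scaled_one_sum:
  "(\<Sum>i<n. \<Sum>j<n. x i * ((c \<cdot>\<^sub>m 1\<^sub>m n) $$ (i, j) * x j)) = c * (\<Sum>i<n. (x i)^2)" for c :: real
proof -
  have "(\<Sum>j<n. x i * ((c \<cdot>\<^sub>m 1\<^sub>m n) $$ (i, j) * x j)) = c * (x i)^2" if "i < n" for i
  proof -
    have "(\<Sum>j<n. x i * ((c \<cdot>\<^sub>m 1\<^sub>m n) $$ (i, j) * x j)) = (\<Sum>j<n. if j = i then c * (x i)^2 else 0)"
      by (rule sum.cong) (use that in \<open>auto simp: power2_eq_square\<close>)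
    then show ?thesis using that by simp
  qed
  then show ?thesis by (simp add: sum_distrib_left)
qed

text \<open>An eigenvector of \<open>A(\<Delta>)\<close> has the form \<open>(a, \<zeta> a)\<close>. Pairing its second block row with the conjugate
of \<open>a\<close> gives the quadratic equation, with \<open>\<mu>\<close> the Rayleigh quotient of \<open>\<Delta>\<close> at \<open>a\<close>; symmetry of
\<open>\<Delta>\<close> makes \<open>\<mu>\<close> real and the Loewner bounds put it into \<open>[m, L]\<close>.\<close>

lemma eigenvalue_quadratic:
  assumes \<Delta>: "\<Delta> \<in> Hessians n m L" and ev: "eigenvalue (map_mat complex_of_real (A_mat n \<alpha> \<beta> \<Delta>)) \<zeta>"
  obtains \<mu> where "m \<le> \<mu>" "\<mu> \<le> L" "\<zeta>^2 + of_real (\<alpha> * \<mu> - 1 - \<beta>) * \<zeta> + of_real \<beta> = 0"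
proof -
  let ?M = "map_mat complex_of_real (A_mat n \<alpha> \<beta> \<Delta>)"
  have C: "\<Delta> \<in> carrier_mat n n" and sym: "transpose_mat \<Delta> = \<Delta>"
    and lm: "loewner_le n (m \<cdot>\<^sub>m 1\<^sub>m n) \<Delta>" and lL: "loewner_le n \<Delta> (L \<cdot>\<^sub>m 1\<^sub>m n)"
    using \<Delta> unfolding Hessians_def by auto
  have dr: "dim_row ?M = n + n" using C unfolding A_mat_def by simp
  obtain v where v: "v \<in> carrier_vec (n + n)" "v \<noteq> 0\<^sub>v (n + n)" "?M *\<^sub>v v = \<zeta> \<cdot>\<^sub>v v"
    using ev unfolding eigenvalue_def eigenvector_def dr by blast
  define u where "u = vec n (\<lambda>i. v $ i)"
  define w where "w = vec n (\<lambda>i. v $ (n + i))"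
  have uw: "u \<in> carrier_vec n" "w \<in> carrier_vec n" unfolding u_def w_def by auto
  have vuw: "v = u @\<^sub>v w" using v(1) unfolding u_def w_def by (intro eq_vecI) auto
  define z where "z = vec n (\<lambda>i. - of_real \<beta> * u $ i + of_real (1 + \<beta>) * w $ i - of_real \<alpha> * (\<Sum>j<n. of_real (\<Delta> $$ (i, j)) * w $ j))"
  have "w @\<^sub>v z = \<zeta> \<cdot>\<^sub>v (u @\<^sub>v w)"
    using v(3) A_mat_mult_append[OF C uw, of \<alpha> \<beta>] unfolding vuw z_def by simp
  then have e: "(w @\<^sub>v z) $ i = (\<zeta> \<cdot>\<^sub>v (u @\<^sub>v w)) $ i" for i by simp
  have w_eq: "w $ i = \<zeta> * u $ i" if "i < n" for i
    using e[of i] that uw by simp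
  have z_eq: "z $ i = \<zeta> * w $ i" if "i < n" for i
    using e[of "n + i"] that uw by (simp add: z_def)
  define a where "a = (\<lambda>i. u $ i)"
  have comp: "\<zeta>^2 * a i = - of_real \<beta> * a i + of_real (1 + \<beta>) * (\<zeta> * a i) - of_real \<alpha> * \<zeta> * (\<Sum>j<n. of_real (\<Delta> $$ (i, j)) * a j)"
    if i: "i < n" for i
  proof -
    have "\<zeta>^2 * a i = z $ i" using z_eq[OF i] w_eq[OF i] unfolding a_def by (simp add: power2_eq_square)
    also have "\<dots> = - of_real \<beta> * a i + of_real (1 + \<beta>) * (\<zeta> * a i) - of_real \<alpha> * (\<Sum>j<n. of_real (\<Delta> $$ (i, j)) * (\<zeta> * a j))"
      unfolding z_def a_def using i w_eq by simp
    also have "(\<Sum>j<n. of_real (\<Delta> $$ (i, j)) * (\<zeta> * a j)) = \<zeta> * (\<Sum>j<n. of_real (\<Delta> $$ (i, j)) * a j)"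
      by (simp add: sum_distrib_left mult_ac)
    finally show ?thesis by (simp add: mult.assoc)
  qed
  define x where "x = (\<lambda>i. Re (a i))"
  define y where "y = (\<lambda>i. Im (a i))"
  define N where "N = (\<Sum>i<n. (x i)^2) + (\<Sum>i<n. (y i)^2)"
  define q where "q = (\<Sum>i<n. \<Sum>j<n. x i * (\<Delta> $$ (i, j) * x j)) + (\<Sum>i<n. \<Sum>j<n. y i * (\<Delta> $$ (i, j) * y j))"
  have bounds: "m * N \<le> q" "q \<le> L * N"
    unfolding N_def q_def distrib_left scaled_one_sum[symmetric]
    using loewner_sum[OF _ C lm] loewner_sum[OF C _ lL] by (auto intro!: add_mono)
  have symm: "\<Delta> $$ (j, i) = \<Delta> $$ (i, j)" if "i < n" "j < n" for i j
    using arg_cong[OF sym, of "\<lambda>M. M $$ (i, j)"] that C by simp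
  \<comment> \<open>The imaginary part of the Hermitian form vanishes by symmetry.\<close>
  have cross: "(\<Sum>i<n. \<Sum>j<n. y i * (\<Delta> $$ (i, j) * x j)) = (\<Sum>i<n. \<Sum>j<n. x i * (\<Delta> $$ (i, j) * y j))"
    by (subst sum.swap) (intro sum.cong refl, simp add: symm mult_ac)
  have Q: "(\<Sum>i<n. cnj (a i) * (\<Sum>j<n. of_real (\<Delta> $$ (i, j)) * a j)) = of_real q"
  proof (rule complex_eqI)
    have t: "cnj (a i) * (of_real (\<Delta> $$ (i, j)) * a j) =
       Complex (x i * (\<Delta> $$ (i, j) * x j) + y i * (\<Delta> $$ (i, j) * y j)) (x i * (\<Delta> $$ (i, j) * y j) - y i * (\<Delta> $$ (i, j) * x j))" for i j
      unfolding x_def y_def by (simp add: complex_eq_iff)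
    show "Re (\<Sum>i<n. cnj (a i) * (\<Sum>j<n. of_real (\<Delta> $$ (i, j)) * a j)) = Re (of_real q)"
      unfolding sum_distrib_left t q_def by (simp add: sum.distrib)
    show "Im (\<Sum>i<n. cnj (a i) * (\<Sum>j<n. of_real (\<Delta> $$ (i, j)) * a j)) = Im (of_real q)"
      unfolding sum_distrib_left t using cross by (simp add: sum_subtractf)
  qed
  have NN: "(\<Sum>i<n. cnj (a i) * a i) = of_real N"
  proof -
    have "cnj (a i) * a i = of_real ((x i)^2 + (y i)^2)" for i
      unfolding x_def y_def by (rule complex_eqI) (simp_all add: power2_eq_square)
    then show ?thesis unfolding N_def by (simp add: sum.distrib)
  qed
  have "0 < N"
  proof (rule ccontr)
    assume "\<not> 0 < N"
    moreover have "0 \<le> N" unfolding N_def by (intro add_nonneg_nonneg sum_nonneg) auto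
    ultimately have "N = 0" by simp
    moreover have "0 \<le> (\<Sum>i<n. (x i)^2)" "0 \<le> (\<Sum>i<n. (y i)^2)" by (auto intro!: sum_nonneg)
    ultimately have "(\<Sum>i<n. (x i)^2) = 0" "(\<Sum>i<n. (y i)^2) = 0" unfolding N_def by auto
    then have "x i = 0" "y i = 0" if "i < n" for i using that by (auto simp: sum_nonneg_eq_0_iff)
    then have u0: "u $ i = 0" if "i < n" for i using that unfolding x_def y_def a_def by (simp add: complex_eq_iff)
    have "v = 0\<^sub>v (n + n)"
    proof (rule eq_vecI)
      fix i assume "i < dim_vec (0\<^sub>v (n + n) :: complex vec)"
      then have i: "i < n + n" by simp
      show "v $ i = 0\<^sub>v (n + n) $ i"
      proof (cases "i < n")
        case True then show ?thesis unfolding vuw using u0[OF True] uw by simp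
      next
        case False
        then have "i - n < n" using i by simp
        then show ?thesis unfolding vuw using False i uw w_eq[of "i - n"] u0[of "i - n"] by simp
      qed
    qed (use v in simp)
    then show False using v(2) by simp
  qed
  have "\<zeta>^2 * of_real N = - of_real \<beta> * of_real N + of_real (1 + \<beta>) * (\<zeta> * of_real N) - of_real \<alpha> * (\<zeta> * of_real q)"
  proof -
    have "\<zeta>^2 * (\<Sum>i<n. cnj (a i) * a i) = (\<Sum>i<n. cnj (a i) * (\<zeta>^2 * a i))"
      by (simp add: sum_distrib_left mult_ac)
    also have "\<dots> = (\<Sum>i<n. cnj (a i) * (- of_real \<beta> * a i + of_real (1 + \<beta>) * (\<zeta> * a i) - of_real \<alpha> * \<zeta> * (\<Sum>j<n. of_real (\<Delta> $$ (i, j)) * a j)))"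
      using comp by (intro sum.cong) auto
    also have "\<dots> = - of_real \<beta> * (\<Sum>i<n. cnj (a i) * a i) + (of_real (1 + \<beta>) * \<zeta>) * (\<Sum>i<n. cnj (a i) * a i)
       - of_real \<alpha> * \<zeta> * (\<Sum>i<n. cnj (a i) * (\<Sum>j<n. of_real (\<Delta> $$ (i, j)) * a j))"
      unfolding sum_distrib_left[of _ "\<lambda>i. cnj (a i) * a i"] sum_distrib_left[of _ "\<lambda>i. cnj (a i) * (\<Sum>j<n. of_real (\<Delta> $$ (i, j)) * a j)"]
        sum.distrib[symmetric] sum_subtractf[symmetric]
      by (intro sum.cong refl) (simp add: algebra_simps)
    finally show ?thesis unfolding NN Q mult.assoc .
  qed
  then have "\<zeta>^2 + of_real (\<alpha> * (q / N) - 1 - \<beta>) * \<zeta> + of_real \<beta> = 0"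
    using \<open>0 < N\<close> by (simp add: field_simps)
  moreover have "m \<le> q / N" "q / N \<le> L" using bounds \<open>0 < N\<close> by (simp_all add: field_simps)
  ultimately show ?thesis using that by blast
qed

text \<open>A non-real root has modulus \<open>sqrt b\<close>. A real root beyond \<open>r\<close> would make
\<open>(|x| - r) (|x| - b / r)\<close> positive, against the bound on \<open>g\<close>.\<close>

lemma quadratic_root_le:
  fixes \<zeta> :: complex
  assumes r: "0 < r" and b: "0 \<le> b" "b \<le> r^2" and g: "\<bar>g\<bar> \<le> r + b / r"
    and root: "\<zeta>^2 + of_real g * \<zeta> + of_real b = 0"
  shows "norm \<zeta> \<le> r"
proof -
  define x where "x = Re \<zeta>"
  define y where "y = Im \<zeta>"
  have re: "x^2 - y^2 + g * x + b = 0" and im: "y * (2 * x + g) = 0"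
    using arg_cong[OF root, of Re] arg_cong[OF root, of Im]
    unfolding x_def y_def by (simp_all add: power2_eq_square algebra_simps)
  have n2: "(norm \<zeta>)^2 = x^2 + y^2" unfolding x_def y_def by (simp add: cmod_power2)
  show ?thesis
  proof (cases "y = 0")
    case False
    then have "g = - 2 * x" using im by auto
    then have "x^2 + y^2 = b" using re by (simp add: power2_eq_square)
    then have "(norm \<zeta>)^2 \<le> r^2" using n2 b by simp
    then show ?thesis by (rule power2_le_imp_le) (use r in simp)
  next
    case True
    then have nx: "norm \<zeta> = \<bar>x\<bar>" using n2 by (metis add.right_neutral norm_ge_zero power2_abs power2_eq_iff_nonneg abs_ge_zero zero_power2)
    show ?thesis
    proof (rule ccontr)
      assume "\<not> norm \<zeta> \<le> r"
      then have xr: "r < \<bar>x\<bar>" using nx by simp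
      have "x^2 + b = - (g * x)" using re True by simp
      also have "\<dots> \<le> \<bar>g\<bar> * \<bar>x\<bar>" by (metis abs_ge_minus_self abs_mult)
      also have "\<dots> \<le> (r + b / r) * \<bar>x\<bar>" using g by (intro mult_right_mono) auto
      finally have "\<bar>x\<bar> * \<bar>x\<bar> + b \<le> (r + b / r) * \<bar>x\<bar>" by (simp add: power2_eq_square)
      then have "(\<bar>x\<bar> - r) * (\<bar>x\<bar> - b / r) \<le> 0" using r by (simp add: algebra_simps)
      moreover have "b / r \<le> r" using b r by (simp add: divide_le_eq power2_eq_square)
      ultimately show False using xr by (simp add: mult_le_0_iff)
    qed
  qed
qed

text \<open>The product of the roots is \<open>b\<close>. If \<open>|g|\<close> reached \<open>r + b / r\<close>, the polynomial
\<open>x^2 - |g| x + b\<close> would be nonpositive at \<open>r\<close>, so its larger root would be real and at least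
\<open>r\<close>.\<close>

lemma quadratic_roots_less:
  assumes r: "0 < r" and b: "0 \<le> b"
    and roots: "\<And>\<zeta> :: complex. \<zeta>^2 + of_real g * \<zeta> + of_real b = 0 \<Longrightarrow> norm \<zeta> < r"
  shows "b < r^2" "\<bar>g\<bar> < r + b / r"
proof -
  define d where "d = csqrt (of_real (g^2 - 4 * b))"
  have d: "d^2 = of_real (g^2 - 4 * b)" unfolding d_def by simp
  define p where "p = (- of_real g + d) / 2"
  define q where "q = (- of_real g - d) / 2"
  have "p^2 + of_real g * p + of_real b = (d^2 - (of_real g)^2 + 4 * of_real b) / 4"
    "q^2 + of_real g * q + of_real b = (d^2 - (of_real g)^2 + 4 * of_real b) / 4"
    unfolding p_def q_def by (simp_all add: power2_eq_square field_simps)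
  then have "p^2 + of_real g * p + of_real b = 0" "q^2 + of_real g * q + of_real b = 0"
    unfolding d by simp_all
  then have "norm p < r" "norm q < r" using roots by blast+
  then have "norm p * norm q < r * r" by (intro mult_strict_mono') auto
  moreover have "p * q = ((of_real g)^2 - d^2) / 4"
    unfolding p_def q_def by (simp add: power2_eq_square algebra_simps)
  then have "p * q = of_real b" unfolding d by simp
  then have "norm p * norm q = b" using b by (simp add: norm_mult[symmetric])
  ultimately show "b < r^2" by (simp add: power2_eq_square)
  show "\<bar>g\<bar> < r + b / r"
  proof (rule ccontr)
    assume "\<not> \<bar>g\<bar> < r + b / r"
    then have "r * (r + b / r) \<le> r * \<bar>g\<bar>" using r by simp
    then have rg: "r^2 + b \<le> r * \<bar>g\<bar>" using r by (simp add: distrib_left power2_eq_square)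
    have sq: "(2 * r - \<bar>g\<bar>)^2 \<le> g^2 - 4 * b"
    proof -
      have "(2 * r - \<bar>g\<bar>)^2 = 4 * r^2 - 4 * (r * \<bar>g\<bar>) + \<bar>g\<bar>^2" by (simp add: power2_eq_square algebra_simps)
      then show ?thesis using rg by simp
    qed
    define h where "h = sqrt (g^2 - 4 * b)"
    have "0 \<le> g^2 - 4 * b" using sq by (meson order_trans zero_le_power2)
    then have h: "0 \<le> h" "h^2 = g^2 - 4 * b" unfolding h_def by simp_all
    have "2 * r - \<bar>g\<bar> \<le> h" using sq h by (metis power2_le_imp_le)
    define x where "x = (\<bar>g\<bar> + h) / 2"
    have xr: "r \<le> x" using \<open>2 * r - \<bar>g\<bar> \<le> h\<close> unfolding x_def by simp
    have "4 * (x^2 - \<bar>g\<bar> * x + b) = h^2 - \<bar>g\<bar>^2 + 4 * b"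
      unfolding x_def by (simp add: power2_eq_square field_simps)
    then have root: "x^2 - \<bar>g\<bar> * x + b = 0" using h by simp
    define y where "y = (if 0 \<le> g then - x else x)"
    have "y^2 + g * y + b = 0" using root unfolding y_def by auto
    then have "(of_real y)^2 + of_real g * of_real y + of_real b = (0 :: complex)"
      by (simp only: of_real_power[symmetric] of_real_mult[symmetric] of_real_add[symmetric] of_real_eq_0_iff)
    then have "norm (of_real y :: complex) < r" by (rule roots)
    then show False using xr r unfolding y_def by (simp split: if_splits)
  qed
qed

lemma abs_affine_le:
  assumes "m \<le> \<mu>" "\<mu> \<le> L" "\<bar>\<alpha> * m - c\<bar> \<le> B" "\<bar>\<alpha> * L - c\<bar> \<le> B" "0 \<le> \<alpha>"
  shows "\<bar>\<alpha> * \<mu> - c\<bar> \<le> (B :: real)"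
  using mult_left_mono[OF assms(1,5)] mult_left_mono[OF assms(2,5)] assms(3,4) by (simp add: abs_le_iff)

lemma rho_le:
  assumes n: "0 < n" and \<alpha>: "0 \<le> \<alpha>" and \<beta>: "0 \<le> \<beta>" and r: "0 < r" and le: "rate_le r m L \<alpha> \<beta>"
    and \<Delta>: "\<Delta> \<in> Hessians n m L"
  shows "rho (A_mat n \<alpha> \<beta> \<Delta>) \<le> r"
proof -
  have C: "\<Delta> \<in> carrier_mat n n" using \<Delta> unfolding Hessians_def by simp
  obtain \<zeta> where z: "eigenvalue (map_mat complex_of_real (A_mat n \<alpha> \<beta> \<Delta>)) \<zeta>" "rho (A_mat n \<alpha> \<beta> \<Delta>) = norm \<zeta>"
    by (rule rho_attained[OF C n])
  obtain \<mu> where \<mu>: "m \<le> \<mu>" "\<mu> \<le> L" and q: "\<zeta>^2 + of_real (\<alpha> * \<mu> - 1 - \<beta>) * \<zeta> + of_real \<beta> = 0"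
    by (rule eigenvalue_quadratic[OF \<Delta> z(1)])
  have "\<bar>\<alpha> * \<mu> - (1 + \<beta>)\<bar> \<le> r + \<beta> / r"
    by (rule abs_affine_le[OF \<mu> _ _ \<alpha>]) (use le in \<open>simp_all add: rate_le_def algebra_simps\<close>)
  then have "\<bar>\<alpha> * \<mu> - 1 - \<beta>\<bar> \<le> r + \<beta> / r" by (simp add: algebra_simps)
  then show ?thesis unfolding z(2) using quadratic_root_le[OF r \<beta> _ _ q] le unfolding rate_le_def by simp
qed

lemma scalar_in_Hessians:
  assumes "m \<le> \<mu>" "\<mu> \<le> L"
  shows "\<mu> \<cdot>\<^sub>m 1\<^sub>m n \<in> Hessians n m L"
proof -
  have le: "loewner_le n (a \<cdot>\<^sub>m 1\<^sub>m n) (b \<cdot>\<^sub>m 1\<^sub>m n)" if "a \<le> b" for a b :: real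
    unfolding loewner_le_def
  proof
    fix v :: "real Matrix.vec" assume v: "v \<in> carrier_vec n"
    have "a * (\<Sum>i<n. (v $ i)^2) \<le> b * (\<Sum>i<n. (v $ i)^2)"
      using that by (intro mult_right_mono sum_nonneg) auto
    then show "0 \<le> scalar_prod v ((b \<cdot>\<^sub>m 1\<^sub>m n - a \<cdot>\<^sub>m 1\<^sub>m n) *\<^sub>v v)"
      unfolding scalar_prod_diff_sum[OF smult_carrier_mat[OF one_carrier_mat] smult_carrier_mat[OF one_carrier_mat] v]
        scaled_one_sum by simp
  qed
  have "transpose_mat (\<mu> \<cdot>\<^sub>m 1\<^sub>m n) = \<mu> \<cdot>\<^sub>m 1\<^sub>m n" by (intro eq_matI) auto
  then show ?thesis unfolding Hessians_def using le[OF assms(1)] le[OF assms(2)] by simp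
qed

lemma sup_rho_le:
  assumes "0 < n" "0 \<le> \<alpha>" "0 \<le> \<beta>" "0 < r" "m \<le> L" "rate_le r m L \<alpha> \<beta>"
  shows "sup_rho n m L \<alpha> \<beta> \<le> r"
  unfolding sup_rho_def
proof (rule cSUP_least)
  show "Hessians n m L \<noteq> {}" using scalar_in_Hessians[of m m L n] assms(5) by auto
qed (use rho_le assms in blast)

lemma sup_rho_upper:
  assumes n: "0 < n" and \<alpha>: "0 \<le> \<alpha>" and \<beta>: "0 \<le> \<beta>" and \<Delta>: "\<Delta> \<in> Hessians n m L"
  shows "rho (A_mat n \<alpha> \<beta> \<Delta>) \<le> sup_rho n m L \<alpha> \<beta>"
proof -
  \<comment> \<open>Any crude radius serves to see that the supremum is over a bounded set.\<close>
  define r where "r = 1 + \<beta> + \<bar>\<alpha> * m - 1 - \<beta>\<bar> + \<bar>\<alpha> * L - 1 - \<beta>\<bar>"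
  have r: "1 + \<beta> \<le> r" "0 < r" "\<bar>\<alpha> * m - 1 - \<beta>\<bar> \<le> r" "\<bar>\<alpha> * L - 1 - \<beta>\<bar> \<le> r" unfolding r_def using \<beta> by auto
  have "\<beta> \<le> r^2"
  proof -
    have "r * 1 \<le> r * r" using r \<beta> by (intro mult_left_mono) auto
    then show ?thesis using r(1) unfolding power2_eq_square by linarith
  qed
  moreover have "0 \<le> \<beta> / r" using \<beta> r by simp
  ultimately have "rate_le r m L \<alpha> \<beta>" unfolding rate_le_def using r by linarith
  then have "bdd_above ((\<lambda>\<Delta>. rho (A_mat n \<alpha> \<beta> \<Delta>)) ` Hessians n m L)"
    by (intro bdd_aboveI[of _ r]) (use rho_le[OF n \<alpha> \<beta> r(2)] in auto)
  then show ?thesis unfolding sup_rho_def by (rule cSUP_upper[OF \<Delta>])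
qed

lemma rate_lt_of_sup_rho:
  assumes n: "0 < n" and \<alpha>: "0 \<le> \<alpha>" and \<beta>: "0 \<le> \<beta>" and r: "0 < r" and mL: "m \<le> L"
    and less: "sup_rho n m L \<alpha> \<beta> < r"
  shows "rate_lt r m L \<alpha> \<beta>"
proof -
  have "norm \<zeta> < r" if "\<zeta>^2 + of_real (\<alpha> * \<mu> - 1 - \<beta>) * \<zeta> + of_real \<beta> = 0" "m \<le> \<mu>" "\<mu> \<le> L"
    for \<zeta> :: complex and \<mu>
  proof -
    have "norm \<zeta> \<le> rho (A_mat n \<alpha> \<beta> (\<mu> \<cdot>\<^sub>m 1\<^sub>m n))"
      by (rule rho_ge_eigenvalue[OF _ n scalar_quadratic_eigenvalue[OF n that(1)]]) simp
    also have "\<dots> \<le> sup_rho n m L \<alpha> \<beta>" by (rule sup_rho_upper[OF n \<alpha> \<beta> scalar_in_Hessians[OF that(2,3)]])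
    finally show ?thesis using less by simp
  qed
  then show ?thesis unfolding rate_lt_def
    using quadratic_roots_less[OF r \<beta>, of "\<alpha> * m - 1 - \<beta>"] quadratic_roots_less[OF r \<beta>, of "\<alpha> * L - 1 - \<beta>"] mL by simp
qed

section \<open>Global convergence\<close>

text \<open>The iterate before step \<open>t\<close>, so that the recursion has one form for all \<open>t\<close>.\<close>

definition hb_prev :: "real \<Rightarrow> real \<Rightarrow> (real^'n \<Rightarrow> real) \<Rightarrow> real^'n \<Rightarrow> real^'n \<Rightarrow> nat \<Rightarrow> real^'n" where
  "hb_prev \<alpha> \<beta> f xm x0 t = (case t of 0 \<Rightarrow> xm | Suc s \<Rightarrow> hb \<alpha> \<beta> f xm x0 s)"

lemma hb_Suc:
  "hb \<alpha> \<beta> f xm x0 (Suc t) = hb \<alpha> \<beta> f xm x0 t - \<alpha> *\<^sub>R gradient f (hb \<alpha> \<beta> f xm x0 t)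
     + \<beta> *\<^sub>R (hb \<alpha> \<beta> f xm x0 t - hb_prev \<alpha> \<beta> f xm x0 t)"
  by (cases t) (simp_all add: hb_prev_def)

text \<open>For the gradient \<open>x \<mapsto> ((L + m) / 2) x\<close> in the middle of the sector the iteration is
\<open>a' = q a - \<beta> c\<close>, and then \<open>energy q \<beta> a' a = \<beta> energy q \<beta> a c\<close>. The deviation from the middle
gradient enters as a perturbation \<open>v\<close>.\<close>

definition energy :: "real \<Rightarrow> real \<Rightarrow> 'a::real_inner \<Rightarrow> 'a \<Rightarrow> real" where
  "energy q \<beta> a c = inner a a - q * inner a c + \<beta> * inner c c"

lemma energy_complete_square:
  "4 * \<beta> * energy q \<beta> a c = inner (q *\<^sub>R a - (2 * \<beta>) *\<^sub>R c) (q *\<^sub>R a - (2 * \<beta>) *\<^sub>R c) + (4 * \<beta> - q^2) * inner a a"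
  unfolding energy_def by (simp add: inner_diff_left inner_diff_right inner_commute power2_eq_square algebra_simps)

lemma energy_step:
  "energy q \<beta> (q *\<^sub>R a - \<beta> *\<^sub>R c + v) a = \<beta> * energy q \<beta> a c + inner v v + inner v (q *\<^sub>R a - (2 * \<beta>) *\<^sub>R c)"
  unfolding energy_def
  by (simp add: inner_diff_left inner_diff_right inner_add_left inner_add_right inner_commute power2_eq_square algebra_simps)

lemma sector_residual:
  fixes a g :: "'a::real_inner"
  assumes "inner (m *\<^sub>R a - g) (L *\<^sub>R a - g) \<le> 0"
  shows "inner (g - ((L + m) / 2) *\<^sub>R a) (g - ((L + m) / 2) *\<^sub>R a) \<le> ((L - m) / 2)^2 * inner a a"
proof -
  have "inner (g - ((L + m) / 2) *\<^sub>R a) (g - ((L + m) / 2) *\<^sub>R a) - ((L - m) / 2)^2 * inner a a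
     = inner (m *\<^sub>R a - g) (L *\<^sub>R a - g)"
    by (simp add: inner_diff_left inner_diff_right inner_commute power2_eq_square field_simps)
  then show ?thesis using assms by simp
qed

text \<open>For \<open>0 < \<beta> < 1\<close> the inequality \<open>|circle_offset m L \<alpha> \<beta>| < 2 sqrt (\<beta> L m)\<close> says that \<open>\<alpha>\<close> lies
strictly between two critical step sizes, the larger of which is the second branch of
\<open>alpha_bar\<close>. Below it is shown to imply global convergence; in this form \<open>\<alpha>\<close> occurs only once.\<close>

definition circle_offset :: "real \<Rightarrow> real \<Rightarrow> real \<Rightarrow> real \<Rightarrow> real" where
  "circle_offset m L \<alpha> \<beta> = (1 - \<beta>)^2 / \<alpha> - (1 + \<beta>) * (L + m) / 2"

text \<open>Squaring and multiplying by \<open>\<alpha>^2\<close> brings the circle inequality into the form in which it enters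
the energy estimate.\<close>

lemma circle_condition:
  fixes \<alpha> \<beta> m L :: real
  assumes \<alpha>: "0 < \<alpha>" and \<beta>: "0 < \<beta>" and mL: "0 < m" "0 < L"
    and c: "\<bar>circle_offset m L \<alpha> \<beta>\<bar> < 2 * sqrt (\<beta> * L * m)"
  shows "4 * \<beta> * (\<alpha> * (L - m) / 2)^2 < (1 - \<beta>)^2 * (4 * \<beta> - (1 + \<beta> - \<alpha> * (L + m) / 2)^2)"
proof -
  have "\<bar>(1 - \<beta>)^2 / \<alpha> - (1 + \<beta>) * (L + m) / 2\<bar>^2 < (2 * sqrt (\<beta> * L * m))^2"
    using c unfolding circle_offset_def by (intro power_strict_mono) auto
  then have "((1 - \<beta>)^2 / \<alpha> - (1 + \<beta>) * (L + m) / 2)^2 < 4 * (\<beta> * L * m)"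
    using \<beta> mL by (simp add: power_mult_distrib)
  then have "\<alpha>^2 * ((1 - \<beta>)^2 / \<alpha> - (1 + \<beta>) * (L + m) / 2)^2 < \<alpha>^2 * (4 * (\<beta> * L * m))"
    using \<alpha> by (intro mult_strict_left_mono) auto
  moreover have "\<alpha>^2 * ((1 - \<beta>)^2 / \<alpha> - (1 + \<beta>) * (L + m) / 2)^2 = ((1 - \<beta>)^2 - \<alpha> * ((1 + \<beta>) * (L + m) / 2))^2"
  proof -
    have "\<alpha> * ((1 - \<beta>)^2 / \<alpha> - (1 + \<beta>) * (L + m) / 2) = (1 - \<beta>)^2 - \<alpha> * ((1 + \<beta>) * (L + m) / 2)"
      using \<alpha> by (simp add: right_diff_distrib)
    then show ?thesis by (metis power_mult_distrib)
  qed
  moreover have "(1 - \<beta>)^2 * (4 * \<beta> - (1 + \<beta> - \<alpha> * (L + m) / 2)^2) - 4 * \<beta> * (\<alpha> * (L - m) / 2)^2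
     = \<alpha>^2 * (4 * (\<beta> * L * m)) - ((1 - \<beta>)^2 - \<alpha> * ((1 + \<beta>) * (L + m) / 2))^2"
    by (simp add: power2_eq_square field_simps)
  ultimately show ?thesis by linarith
qed

lemma young_inequality: fixes v x :: "'a::real_inner" assumes p: "0 < p"
  shows "inner v x \<le> p * inner x x + inner v v / (4 * p)"
proof -
  have "0 \<le> inner (v - (2 * p) *\<^sub>R x) (v - (2 * p) *\<^sub>R x) / (4 * p)" using p by simp
  also have "\<dots> = inner v v / (4 * p) - inner v x + p * inner x x"
    using p by (simp add: inner_diff_left inner_diff_right inner_commute field_simps power2_eq_square)
  finally show ?thesis by simp
qed

text \<open>In \<open>energy_step\<close> the cross term \<open>v \<bullet> x\<close> with \<open>x = q a - 2 \<beta> c\<close> is absorbed by the part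
\<open>|x|^2 / (4 \<beta>)\<close> of the energy; what remains is a multiple of \<open>|a|^2\<close>, whose sign is decided by the
circle inequality.\<close>

lemma energy_contraction:
  fixes \<beta> \<theta> q :: real
  assumes \<beta>: "0 < \<beta>" "\<beta> < 1" and circle: "4 * \<beta> * \<theta>^2 < (1 - \<beta>)^2 * (4 * \<beta> - q^2)"
  obtains \<tau> where "0 < \<tau>" "\<tau> < 1"
    "\<And>a c v :: 'a::real_inner. inner v v \<le> \<theta>^2 * inner a a \<Longrightarrow>
       energy q \<beta> (q *\<^sub>R a - \<beta> *\<^sub>R c + v) a \<le> \<tau> * energy q \<beta> a c"
proof -
  \<comment> \<open>The condition on the contraction factor left by this estimate. At 1 it is the
    circle inequality, so by continuity it holds for some smaller factor.\<close>
  define F where "F = (\<lambda>\<tau>. (\<tau> - \<beta>)^2 * (4 * \<beta> - q^2) - 4 * \<beta> * \<theta>^2 * \<tau>)"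
  have "0 < F 1" using circle unfolding F_def by simp
  moreover have "(F \<longlongrightarrow> F 1) (at_left 1)" unfolding F_def by (intro tendsto_intros)
  ultimately have "\<forall>\<^sub>F \<tau> in at_left 1. 0 < F \<tau>" by (rule order_tendstoD(1)[rotated])
  moreover have "\<forall>\<^sub>F \<tau> in at_left 1. \<tau> \<in> {\<beta><..<1}" using \<beta> by (intro eventually_at_left_real)
  ultimately have "\<forall>\<^sub>F \<tau> in at_left (1::real). 0 < F \<tau> \<and> \<tau> \<in> {\<beta><..<1}" by (rule eventually_conj)
  then obtain \<tau> where \<tau>: "0 < F \<tau>" "\<beta> < \<tau>" "\<tau> < 1"
    using eventually_happens'[OF trivial_limit_at_left_real] by fastforce
  have "energy q \<beta> (q *\<^sub>R a - \<beta> *\<^sub>R c + v) a \<le> \<tau> * energy q \<beta> a c"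
    if v: "inner v v \<le> \<theta>^2 * inner a a" for a c v :: 'a
  proof -
    define x where "x = q *\<^sub>R a - (2 * \<beta>) *\<^sub>R c"
    define p where "p = (\<tau> - \<beta>) / (4 * \<beta>)"
    have p: "0 < p" unfolding p_def using \<tau> \<beta> by simp
    have E: "energy q \<beta> a c = (inner x x + (4 * \<beta> - q^2) * inner a a) / (4 * \<beta>)"
      using energy_complete_square[of \<beta> q a c] \<beta> unfolding x_def by (simp add: eq_divide_eq mult.commute)
    have eqs: "p * (4 * \<beta>) = \<tau> - \<beta>" "1 + 1 / (4 * p) = \<tau> / (\<tau> - \<beta>)"
      unfolding p_def using \<tau> \<beta> by (simp_all add: field_simps)
    have "inner v v * (1 + 1 / (4 * p)) \<le> (\<theta>^2 * inner a a) * (1 + 1 / (4 * p))"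
      using v p by (intro mult_right_mono) auto
    also have "\<dots> \<le> p * (4 * \<beta> - q^2) * inner a a"
    proof -
      have "\<theta>^2 * (1 + 1 / (4 * p)) \<le> p * (4 * \<beta> - q^2)"
      proof -
        have "4 * \<beta> * \<theta>^2 * \<tau> \<le> (\<tau> - \<beta>)^2 * (4 * \<beta> - q^2)" using \<tau>(1) unfolding F_def by simp
        then have "\<theta>^2 * \<tau> / (\<tau> - \<beta>) \<le> (\<tau> - \<beta>) * (4 * \<beta> - q^2) / (4 * \<beta>)"
          using \<tau> \<beta> by (simp add: divide_le_eq le_divide_eq power2_eq_square mult_ac)
        then show ?thesis unfolding eqs(2) unfolding p_def by simp
      qed
      then have "(\<theta>^2 * (1 + 1 / (4 * p))) * inner a a \<le> (p * (4 * \<beta> - q^2)) * inner a a"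
        by (rule mult_right_mono) simp
      then show ?thesis by (simp add: mult_ac)
    qed
    finally have 1: "inner v v + inner v v / (4 * p) \<le> p * (4 * \<beta> - q^2) * inner a a"
      by (simp add: distrib_left)
    have "\<tau> * energy q \<beta> a c = \<beta> * energy q \<beta> a c + (\<tau> - \<beta>) * energy q \<beta> a c" by (simp add: algebra_simps)
    also have "(\<tau> - \<beta>) * energy q \<beta> a c = p * (inner x x + (4 * \<beta> - q^2) * inner a a)"
      unfolding E p_def by simp
    finally have 2: "\<tau> * energy q \<beta> a c = \<beta> * energy q \<beta> a c + p * inner x x + p * (4 * \<beta> - q^2) * inner a a"
      by (simp add: distrib_left)
    show ?thesis unfolding energy_step x_def[symmetric] 2 using young_inequality[OF p, of v x] 1 by linarith
  qed
  then show ?thesis using that[of \<tau>] \<tau> \<beta> by simp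
qed

lemma energy_lower:
  assumes "0 < \<beta>" "q^2 < 4 * \<beta>"
  shows "inner a a \<le> 4 * \<beta> / (4 * \<beta> - q^2) * energy q \<beta> a c" "0 \<le> energy q \<beta> a c"
proof -
  have e: "(4 * \<beta> - q^2) * inner a a \<le> 4 * \<beta> * energy q \<beta> a c"
    unfolding energy_complete_square by simp
  then show "inner a a \<le> 4 * \<beta> / (4 * \<beta> - q^2) * energy q \<beta> a c"
    using assms by (simp add: field_simps)
  have "0 \<le> (4 * \<beta> - q^2) * inner a a" using assms by (intro mult_nonneg_nonneg) auto
  then have "0 \<le> 4 * \<beta> * energy q \<beta> a c" using e by linarith
  then show "0 \<le> energy q \<beta> a c" using assms by (simp add: zero_le_mult_iff)
qed

lemma energy_upper:
  assumes "0 \<le> \<beta>"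
  shows "energy q \<beta> a c \<le> (1 + \<bar>q\<bar> + \<beta>) * ((norm a)^2 + (norm c)^2)"
proof -
  have "- q * inner a c \<le> \<bar>q\<bar> * (norm a * norm c)"
  proof -
    have "- q * inner a c \<le> \<bar>q\<bar> * \<bar>inner a c\<bar>" by (metis abs_ge_self abs_minus_cancel abs_mult)
    also have "\<dots> \<le> \<bar>q\<bar> * (norm a * norm c)" by (intro mult_left_mono Cauchy_Schwarz_ineq2) auto
    finally show ?thesis .
  qed
  moreover have "\<bar>q\<bar> * (norm a * norm c) \<le> \<bar>q\<bar> * ((norm a)^2 + (norm c)^2)"
  proof (rule mult_left_mono)
    have "0 \<le> (norm a - norm c)^2 + (norm a)^2 + (norm c)^2" by simp
    then show "norm a * norm c \<le> (norm a)^2 + (norm c)^2" by (simp add: power2_eq_square algebra_simps)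
  qed simp
  moreover have "0 \<le> \<beta> * (norm a)^2" "0 \<le> (norm c)^2" using assms by simp_all
  moreover have "(1 + \<bar>q\<bar> + \<beta>) * ((norm a)^2 + (norm c)^2) - energy q \<beta> a c =
    q * inner a c + \<bar>q\<bar> * ((norm a)^2 + (norm c)^2) + \<beta> * (norm a)^2 + (norm c)^2"
    unfolding energy_def by (simp add: power2_norm_eq_inner algebra_simps)
  ultimately show ?thesis by linarith
qed

definition initial_error :: "'a::real_normed_vector \<Rightarrow> 'a \<Rightarrow> 'a \<Rightarrow> real" where
  "initial_error xs xm x0 = (norm (x0 - xs))^2 + (norm (xm - xs))^2"

lemma exponential_decay:
  fixes m L \<alpha> \<beta> :: real
  assumes mL: "0 < m" "m < L" and \<alpha>: "0 < \<alpha>" and \<beta>: "0 < \<beta>" "\<beta> < 1"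
    and c: "\<bar>circle_offset m L \<alpha> \<beta>\<bar> < 2 * sqrt (\<beta> * L * m)"
  obtains K \<tau> where "0 < K" "0 < \<tau>" "\<tau> < 1"
    "\<And>(f :: real^'n \<Rightarrow> real) xs xm x0 t. F1_at m L f xs \<Longrightarrow>
       (norm (hb \<alpha> \<beta> f xm x0 t - xs))^2 \<le> K * \<tau> ^ t * initial_error xs xm x0"
proof -
  define q where "q = 1 + \<beta> - \<alpha> * (L + m) / 2"
  define \<theta> where "\<theta> = \<alpha> * (L - m) / 2"
  have circ: "4 * \<beta> * \<theta>^2 < (1 - \<beta>)^2 * (4 * \<beta> - q^2)"
    unfolding q_def \<theta>_def by (rule circle_condition) (use assms in auto)
  have q2: "q^2 < 4 * \<beta>"
  proof (rule ccontr)
    assume "\<not> q^2 < 4 * \<beta>"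
    then have "(1 - \<beta>)^2 * (4 * \<beta> - q^2) \<le> 0" by (intro mult_nonneg_nonpos) auto
    moreover have "0 \<le> 4 * \<beta> * \<theta>^2" using \<beta> by simp
    ultimately show False using circ by linarith
  qed
  obtain \<tau> where \<tau>: "0 < \<tau>" "\<tau> < 1"
    "\<And>a c v :: real^'n. inner v v \<le> \<theta>^2 * inner a a \<Longrightarrow>
       energy q \<beta> (q *\<^sub>R a - \<beta> *\<^sub>R c + v) a \<le> \<tau> * energy q \<beta> a c"
    using energy_contraction[OF \<beta> circ, where 'a = "real^'n"] by metis
  define K where "K = 4 * \<beta> / (4 * \<beta> - q^2) * (1 + \<bar>q\<bar> + \<beta>)"
  have P: "0 < 4 * \<beta> / (4 * \<beta> - q^2)" using \<beta> q2 by simp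
  have K: "0 < K" unfolding K_def using P \<beta> by (intro mult_pos_pos) auto
  have "(norm (hb \<alpha> \<beta> f xm x0 t - xs))^2 \<le> K * \<tau> ^ t * initial_error xs xm x0"
    if F: "F1_at m L f xs" for f :: "real^'n \<Rightarrow> real" and xs xm x0 t
  proof -
    define a where "a = (\<lambda>t. hb \<alpha> \<beta> f xm x0 t - xs)"
    define b where "b = (\<lambda>t. hb_prev \<alpha> \<beta> f xm x0 t - xs)"
    have bS: "b (Suc t) = a t" for t unfolding a_def b_def hb_prev_def by simp
    have step: "energy q \<beta> (a (Suc t)) (b (Suc t)) \<le> \<tau> * energy q \<beta> (a t) (b t)" for t
    proof -
      define g where "g = gradient f (hb \<alpha> \<beta> f xm x0 t)"
      define v where "v = - (\<alpha> *\<^sub>R (g - ((L + m) / 2) *\<^sub>R a t))"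
      have "inner (m *\<^sub>R a t - g) (L *\<^sub>R a t - g) \<le> 0" using F unfolding F1_at_def a_def g_def by blast
      then have "inner v v \<le> \<alpha>^2 * (((L - m) / 2)^2 * inner (a t) (a t))"
        unfolding v_def using mult_left_mono[OF sector_residual, of m "a t" g L "\<alpha>^2"]
        by (simp add: power2_eq_square mult.assoc)
      then have v: "inner v v \<le> \<theta>^2 * inner (a t) (a t)" unfolding \<theta>_def by (simp add: power_mult_distrib power_divide)
      have "a (Suc t) = q *\<^sub>R a t - \<beta> *\<^sub>R b t + v"
        unfolding a_def b_def v_def q_def g_def hb_Suc by (simp add: algebra_simps)
      then show ?thesis unfolding bS using \<tau>(3)[OF v, of "b t"] by simp
    qed
    have "energy q \<beta> (a t) (b t) \<le> \<tau> ^ t * energy q \<beta> (a 0) (b 0)" for t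
    proof (induction t)
      case (Suc t)
      have "energy q \<beta> (a (Suc t)) (b (Suc t)) \<le> \<tau> * energy q \<beta> (a t) (b t)" by (rule step)
      also have "\<dots> \<le> \<tau> * (\<tau> ^ t * energy q \<beta> (a 0) (b 0))" using Suc \<tau>(1) by simp
      finally show ?case by simp
    qed simp
    moreover have "energy q \<beta> (a 0) (b 0) \<le> (1 + \<bar>q\<bar> + \<beta>) * initial_error xs xm x0"
      using energy_upper[of \<beta> q "a 0" "b 0"] \<beta> unfolding a_def b_def hb_prev_def initial_error_def by simp
    ultimately have "energy q \<beta> (a t) (b t) \<le> \<tau> ^ t * ((1 + \<bar>q\<bar> + \<beta>) * initial_error xs xm x0)"
      using \<tau>(1) by (meson mult_left_mono order_trans zero_le_power less_imp_le)
    then have "4 * \<beta> / (4 * \<beta> - q^2) * energy q \<beta> (a t) (b t) \<le>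
       4 * \<beta> / (4 * \<beta> - q^2) * (\<tau> ^ t * ((1 + \<bar>q\<bar> + \<beta>) * initial_error xs xm x0))"
      using P by (intro mult_left_mono) auto
    also have "\<dots> = K * \<tau> ^ t * initial_error xs xm x0"
      unfolding K_def by (simp only: mult_ac)
    finally have "inner (a t) (a t) \<le> K * \<tau> ^ t * initial_error xs xm x0"
      using energy_lower(1)[OF \<beta>(1) q2, of "a t" "b t"] by linarith
    then show ?thesis unfolding a_def by (simp add: power2_norm_eq_inner)
  qed
  then show ?thesis using that[of K \<tau>] K \<tau> by blast
qed

lemma gas_of_decay:
  fixes f :: "real^'n \<Rightarrow> real"
  assumes K: "0 < K" and \<tau>: "0 < \<tau>" "\<tau> < 1"
    and decay: "\<And>xm x0 t. (norm (hb \<alpha> \<beta> f xm x0 t - xs))^2 \<le> K * \<tau> ^ t * initial_error xs xm x0"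
  shows "gas \<alpha> \<beta> f xs"
  unfolding gas_def
proof (intro conjI allI impI)
  fix \<epsilon> :: real assume e: "0 < \<epsilon>"
  define \<delta> where "\<delta> = \<epsilon> / sqrt (2 * K)"
  have "norm (hb \<alpha> \<beta> f xm x0 t - xs) < \<epsilon>" if "norm (xm - xs) < \<delta>" "norm (x0 - xs) < \<delta>" for xm x0 t
  proof -
    have "(norm (xm - xs))^2 < \<delta>^2" "(norm (x0 - xs))^2 < \<delta>^2"
      using that by (auto intro!: power_strict_mono)
    then have "K * \<tau> ^ t * initial_error xs xm x0 < K * \<tau> ^ t * (2 * \<delta>^2)"
      unfolding initial_error_def using K \<tau> by (intro mult_strict_left_mono) auto
    also have "\<dots> \<le> K * 1 * (2 * \<delta>^2)"
      using K \<tau> by (intro mult_right_mono mult_left_mono power_le_one) auto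
    also have "\<dots> = \<epsilon>^2" unfolding \<delta>_def power_divide using K by simp
    finally have "(norm (hb \<alpha> \<beta> f xm x0 t - xs))^2 < \<epsilon>^2" using decay[of xm x0 t] by linarith
    then show ?thesis by (rule power_less_imp_less_base) (use e in simp)
  qed
  moreover have "0 < \<delta>" unfolding \<delta>_def using e K by simp
  ultimately show "\<exists>\<delta>>0. \<forall>xm x0. norm (xm - xs) < \<delta> \<longrightarrow> norm (x0 - xs) < \<delta> \<longrightarrow> (\<forall>t. norm (hb \<alpha> \<beta> f xm x0 t - xs) < \<epsilon>)"
    by blast
next
  fix B :: "((real^'n) \<times> (real^'n)) set" assume "bounded B"
  then obtain R where R: "\<And>p. p \<in> B \<Longrightarrow> norm p \<le> R" unfolding bounded_iff by blast
  define R' where "R' = \<bar>R\<bar> + norm xs"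
  show "uniform_limit B (\<lambda>t (xm, x0). norm (hb \<alpha> \<beta> f xm x0 t - xs)) (\<lambda>_. 0) sequentially"
  proof (rule uniform_limitI)
    fix \<epsilon> :: real assume e: "0 < \<epsilon>"
    have "(\<lambda>t. K * \<tau> ^ t * (2 * R'^2)) \<longlonglongrightarrow> K * 0 * (2 * R'^2)"
      using \<tau> by (intro tendsto_intros LIMSEQ_realpow_zero) auto
    then have "\<forall>\<^sub>F t in sequentially. K * \<tau> ^ t * (2 * R'^2) < \<epsilon>^2"
      by (rule order_tendstoD(2)) (use e in simp)
    then show "\<forall>\<^sub>F t in sequentially. \<forall>p\<in>B. dist (case p of (xm, x0) \<Rightarrow> norm (hb \<alpha> \<beta> f xm x0 t - xs)) 0 < \<epsilon>"
    proof (rule eventually_mono)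
      fix t assume t: "K * \<tau> ^ t * (2 * R'^2) < \<epsilon>^2"
      show "\<forall>p\<in>B. dist (case p of (xm, x0) \<Rightarrow> norm (hb \<alpha> \<beta> f xm x0 t - xs)) 0 < \<epsilon>"
      proof (clarify)
        fix xm x0 assume "(xm, x0) \<in> B"
        then have "norm (xm, x0) \<le> R" by (rule R)
        then have "norm xm \<le> \<bar>R\<bar>" "norm x0 \<le> \<bar>R\<bar>"
          using norm_fst_le[of xm x0] norm_snd_le[of x0 xm] by linarith+
        then have "norm (xm - xs) \<le> R'" "norm (x0 - xs) \<le> R'"
          unfolding R'_def using norm_triangle_ineq4[of xm xs] norm_triangle_ineq4[of x0 xs] by linarith+
        then have "(norm (xm - xs))^2 \<le> R'^2" "(norm (x0 - xs))^2 \<le> R'^2"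
          by (auto intro!: power_mono)
        then have "K * \<tau> ^ t * initial_error xs xm x0 \<le> K * \<tau> ^ t * (2 * R'^2)"
          unfolding initial_error_def using K \<tau> by (intro mult_left_mono) auto
        then have "(norm (hb \<alpha> \<beta> f xm x0 t - xs))^2 < \<epsilon>^2" using decay[of xm x0 t] t by linarith
        then have "norm (hb \<alpha> \<beta> f xm x0 t - xs) < \<epsilon>" by (rule power_less_imp_less_base) (use e in simp)
        then show "dist (norm (hb \<alpha> \<beta> f xm x0 t - xs)) 0 < \<epsilon>" by simp
      qed
    qed
  qed
qed

lemma globally_convergent:
  fixes m L \<alpha> \<beta> :: real
  assumes mL: "0 < m" "m < L" and \<alpha>: "0 < \<alpha>" and \<beta>: "0 < \<beta>" "\<beta> < 1"
    and c: "\<bar>circle_offset m L \<alpha> \<beta>\<bar> < 2 * sqrt (\<beta> * L * m)"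
  shows "(\<alpha>, \<beta>) \<in> GHB_set (F2 m L :: (real^'n \<Rightarrow> real) set)"
proof -
  obtain K \<tau> where K: "0 < K" "0 < \<tau>" "\<tau> < 1"
    "\<And>(f :: real^'n \<Rightarrow> real) xs xm x0 t. F1_at m L f xs \<Longrightarrow>
       (norm (hb \<alpha> \<beta> f xm x0 t - xs))^2 \<le> K * \<tau> ^ t * initial_error xs xm x0"
    using exponential_decay[OF mL \<alpha> \<beta> c, where 'n = 'n] by metis
  have "gas \<alpha> \<beta> f (minimizer f)" if "f \<in> F2 m L" for f :: "real^'n \<Rightarrow> real"
  proof -
    obtain xs where xs: "F1_at m L f xs" using \<open>f \<in> F2 m L\<close> unfolding F2_def F1_def by blast
    have "minimizer f = xs" using F1_at_minimizer[OF mL(1) _ xs] mL by simp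
    then show ?thesis using gas_of_decay[OF K(1-3) K(4)[OF xs]] by simp
  qed
  then show ?thesis unfolding GHB_set_def by simp
qed

section \<open>The Hessian at the minimizer\<close>

lemma GDERIV_gradient:
  fixes f :: "real^'n \<Rightarrow> real"
  assumes "f differentiable (at x)"
  shows "GDERIV f x :> gradient f x"
proof -
  from assms obtain f' where f': "(f has_derivative f') (at x)" unfolding differentiable_def by blast
  then have lin: "linear f'" by (rule has_derivative_linear)
  define D where "D = (\<Sum>b\<in>Basis. f' b *\<^sub>R b)"
  have "inner h D = f' h" for h
  proof -
    have "f' h = f' (\<Sum>b\<in>Basis. inner h b *\<^sub>R b)" by (simp add: euclidean_representation)
    also have "\<dots> = (\<Sum>b\<in>Basis. inner h b * f' b)"
      using lin by (simp add: linear_sum linear_scale)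
    also have "\<dots> = inner h D" unfolding D_def by (simp add: inner_sum_right mult.commute)
    finally show ?thesis ..
  qed
  then have D: "GDERIV f x :> D" unfolding gderiv_def using f' by (simp add: ext)
  moreover have "E = D" if "GDERIV f x :> E" for E
  proof -
    have "(\<lambda>h. inner h E) = (\<lambda>h. inner h D)"
      using that D unfolding gderiv_def by (rule has_derivative_unique)
    then have "inner (E - D) E = inner (E - D) D" by metis
    then have "inner (E - D) (E - D) = 0" by (simp add: inner_diff_right)
    then show ?thesis by simp
  qed
  ultimately show ?thesis unfolding gradient_def by (rule theI)
qed

lemma gradient_at_minimum: assumes "F1_at m L f xs" shows "gradient f xs = 0"
proof -
  have "inner (m *\<^sub>R (xs - xs) - gradient f xs) (L *\<^sub>R (xs - xs) - gradient f xs) \<le> 0"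
    using assms unfolding F1_at_def by blast
  then have "inner (gradient f xs) (gradient f xs) \<le> 0" by simp
  then show ?thesis by (metis inner_eq_zero_iff inner_ge_zero order_antisym)
qed

definition mixed_difference :: "('a::real_vector \<Rightarrow> real) \<Rightarrow> 'a \<Rightarrow> 'a \<Rightarrow> 'a \<Rightarrow> real \<Rightarrow> real" where
  "mixed_difference f a u v h = (f (a + h *\<^sub>R u + h *\<^sub>R v) - f (a + h *\<^sub>R u) - f (a + h *\<^sub>R v) + f a) / h^2"

text \<open>Apply the mean value theorem to \<open>t \<mapsto> f (a + t u + h v) - f (a + t u)\<close> on \<open>[0, h]\<close>. Its derivative is a
difference of two values of \<open>G\<close> near \<open>a\<close>, and both are given by the linear approximation at
\<open>a\<close> up to \<open>o(h)\<close>.\<close>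

lemma mixed_difference_tendsto:
  fixes f :: "'a::real_inner \<Rightarrow> real"
  assumes G: "\<And>x. GDERIV f x :> G x" and J: "(G has_derivative J) (at a)"
  shows "(mixed_difference f a u v \<longlongrightarrow> inner u (J v)) (at_right 0)"
proof (rule tendstoI)
  fix e :: real assume e: "0 < e"
  have blJ: "bounded_linear J" using J by (rule has_derivative_bounded_linear)
  define M where "M = norm u + norm v + 1"
  have M: "0 < M" unfolding M_def by (simp add: add_nonneg_pos)
  \<comment> \<open>Two remainders, each at most c h M, are paired with a vector of norm at most M;
    the error is then at most h e / 2.\<close>
  define c where "c = e / (4 * M * M)"
  have c: "0 < c" unfolding c_def using e M by simp
  obtain d where d: "0 < d" "\<And>y. norm (y - a) < d \<Longrightarrow> norm (G y - G a - J (y - a)) \<le> c * norm (y - a)"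
    using J c unfolding has_derivative_at_alt by blast
  have "\<forall>\<^sub>F h in at_right 0. h \<in> {0<..<d / M}"
    by (rule eventually_at_right_real) (use d M in simp)
  then show "\<forall>\<^sub>F h in at_right 0. dist (mixed_difference f a u v h) (inner u (J v)) < e"
  proof (rule eventually_mono)
    fix h :: real assume "h \<in> {0<..<d / M}"
    then have h: "0 < h" "h * M < d" using M by (simp_all add: field_simps)
    define \<phi> where "\<phi> = (\<lambda>t. f (a + t *\<^sub>R u + h *\<^sub>R v) - f (a + t *\<^sub>R u))"
    define \<phi>' where "\<phi>' = (\<lambda>t. inner u (G (a + t *\<^sub>R u + h *\<^sub>R v)) - inner u (G (a + t *\<^sub>R u)))"
    have line: "((\<lambda>t. f (a + t *\<^sub>R u + w)) has_real_derivative inner u (G (a + t *\<^sub>R u + w))) (at t)" for t w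
    proof -
      have "((\<lambda>t. a + t *\<^sub>R u + w) has_derivative (\<lambda>t. t *\<^sub>R u)) (at t)"
        by (auto intro!: derivative_eq_intros)
      moreover have "(f has_derivative (\<lambda>h. inner h (G (a + t *\<^sub>R u + w)))) (at (a + t *\<^sub>R u + w))"
        using G unfolding gderiv_def .
      ultimately have "((\<lambda>t. f (a + t *\<^sub>R u + w)) has_derivative (\<lambda>x. inner (x *\<^sub>R u) (G (a + t *\<^sub>R u + w)))) (at t)"
        by (rule has_derivative_compose)
      then show ?thesis unfolding has_field_derivative_def by (simp add: mult_commute_abs)
    qed
    have "DERIV \<phi> t :> \<phi>' t" for t
      unfolding \<phi>_def \<phi>'_def using DERIV_diff[OF line[of "h *\<^sub>R v" t] line[of 0 t]] by simp
    then obtain \<xi> where xi: "0 < \<xi>" "\<xi> < h" "\<phi> h - \<phi> 0 = (h - 0) * \<phi>' \<xi>"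
      using MVT2[OF h(1), of \<phi> \<phi>'] by blast
    have num: "f (a + h *\<^sub>R u + h *\<^sub>R v) - f (a + h *\<^sub>R u) - f (a + h *\<^sub>R v) + f a = h * \<phi>' \<xi>"
      using xi(3) unfolding \<phi>_def by simp
    define R where "R = (\<lambda>y. G y - G a - J (y - a))"
    have small: "norm w \<le> h * M \<Longrightarrow> norm (R (a + w)) \<le> c * (h * M)" for w
    proof -
      assume w: "norm w \<le> h * M"
      then have "norm (R (a + w)) \<le> c * norm w" using d(2)[of "a + w"] h unfolding R_def by simp
      also have "\<dots> \<le> c * (h * M)" using w c by simp
      finally show ?thesis .
    qed
    have n1: "norm (\<xi> *\<^sub>R u + h *\<^sub>R v) \<le> h * M" "norm (\<xi> *\<^sub>R u) \<le> h * M"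
    proof -
      have "\<xi> * norm u \<le> h * norm u" using xi by (intro mult_right_mono) auto
      moreover have "norm (\<xi> *\<^sub>R u + h *\<^sub>R v) \<le> \<xi> * norm u + h * norm v"
        using norm_triangle_ineq[of "\<xi> *\<^sub>R u" "h *\<^sub>R v"] xi h by simp
      moreover have "h * M = h * norm u + h * norm v + h" unfolding M_def by (simp add: algebra_simps)
      moreover have "0 \<le> h * norm v" "norm (\<xi> *\<^sub>R u) = \<xi> * norm u" using h xi by simp_all
      ultimately show "norm (\<xi> *\<^sub>R u + h *\<^sub>R v) \<le> h * M" "norm (\<xi> *\<^sub>R u) \<le> h * M"
        using h(1) by linarith+
    qed
    have "\<phi>' \<xi> = inner u (R (a + (\<xi> *\<^sub>R u + h *\<^sub>R v))) - inner u (R (a + \<xi> *\<^sub>R u)) + h * inner u (J v)"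
      unfolding \<phi>'_def R_def using linear_add[OF bounded_linear.linear[OF blJ]] linear_scale[OF bounded_linear.linear[OF blJ]]
      by (simp add: inner_diff_right inner_add_right add.assoc)
    then have "\<bar>\<phi>' \<xi> - h * inner u (J v)\<bar> \<le> \<bar>inner u (R (a + (\<xi> *\<^sub>R u + h *\<^sub>R v)))\<bar> + \<bar>inner u (R (a + \<xi> *\<^sub>R u))\<bar>"
      by simp
    also have "\<dots> \<le> norm u * (c * (h * M)) + norm u * (c * (h * M))"
      using small[OF n1(1)] small[OF n1(2)]
      by (intro add_mono order_trans[OF Cauchy_Schwarz_ineq2] mult_left_mono) auto
    also have "\<dots> \<le> M * (c * (h * M)) + M * (c * (h * M))"
      using c h M unfolding M_def by (intro add_mono mult_right_mono) auto
    also have "\<dots> = h * (e / 2)" unfolding c_def using M by (simp add: field_simps)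
    finally have "\<bar>\<phi>' \<xi> - h * inner u (J v)\<bar> \<le> h * (e / 2)" .
    then have "\<bar>\<phi>' \<xi> - h * inner u (J v)\<bar> / h \<le> e / 2" using h by (simp add: field_simps)
    moreover have "h * \<phi>' \<xi> / h^2 - inner u (J v) = (\<phi>' \<xi> - h * inner u (J v)) / h"
      using h by (simp add: field_simps power2_eq_square)
    ultimately have "\<bar>h * \<phi>' \<xi> / h^2 - inner u (J v)\<bar> \<le> e / 2"
      using h by (simp only: abs_divide abs_of_pos)
    then show "dist (mixed_difference f a u v h) (inner u (J v)) < e"
      unfolding mixed_difference_def num dist_real_def using e by simp
  qed
qed

text \<open>The mixed difference quotient is symmetric in \<open>u\<close> and \<open>v\<close>.\<close>

lemma second_derivative_symmetric:
  fixes f :: "'a::real_inner \<Rightarrow> real"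
  assumes G: "\<And>x. GDERIV f x :> G x" and J: "(G has_derivative J) (at a)"
  shows "inner u (J v) = inner v (J u)"
proof -
  have "mixed_difference f a v u = mixed_difference f a u v"
    unfolding mixed_difference_def by (simp add: algebra_simps)
  then have "(mixed_difference f a u v \<longlongrightarrow> inner v (J u)) (at_right 0)"
    using mixed_difference_tendsto[OF G J, of v u] by simp
  with mixed_difference_tendsto[OF G J, of u v] show ?thesis
    by (rule tendsto_unique[OF trivial_limit_at_right_real])
qed

text \<open>The sector inequality at \<open>a + t v\<close>, divided by \<open>t^2\<close>, passes to the limit \<open>t \<rightarrow> 0\<close>. The proof
fixes one small \<open>t\<close> for which the remainder is too small to compensate a positive value.\<close>

lemma sector_derivative:
  fixes G :: "'a::real_inner \<Rightarrow> 'a"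
  assumes J: "(G has_derivative J) (at a)" and Ga: "G a = 0"
    and sec: "\<And>x. inner (m *\<^sub>R (x - a) - G x) (L *\<^sub>R (x - a) - G x) \<le> 0"
  shows "inner (m *\<^sub>R v - J v) (L *\<^sub>R v - J v) \<le> 0"
proof (rule ccontr)
  define p where "p = m *\<^sub>R v - J v"
  define q where "q = L *\<^sub>R v - J v"
  assume "\<not> inner (m *\<^sub>R v - J v) (L *\<^sub>R v - J v) \<le> 0"
  then have P: "0 < inner p q" unfolding p_def q_def by simp
  have lin: "linear J" using J by (rule has_derivative_linear)
  define K where "K = norm p + norm q + 1"
  define c where "c = inner p q / (2 * (norm v + 1) * K)"
  have K: "0 < K" "0 < norm v + 1" unfolding K_def by (simp_all add: add_nonneg_pos)
  have c: "0 < c" unfolding c_def using P K by simp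
  obtain d where d: "0 < d" "\<And>y. norm (y - a) < d \<Longrightarrow> norm (G y - G a - J (y - a)) \<le> c * norm (y - a)"
    using J c unfolding has_derivative_at_alt by blast
  define t where "t = d / (2 * (norm v + 1))"
  have t: "0 < t" unfolding t_def using d K by simp
  have "t * norm v < d"
  proof -
    have "t * norm v < t * (norm v + 1)" using t by simp
    also have "\<dots> = d / 2" unfolding t_def using K(2) by (simp add: divide_simps)
    finally show ?thesis using d(1) by simp
  qed
  define R where "R = G (a + t *\<^sub>R v) - t *\<^sub>R J v"
  have R: "norm R \<le> c * (t * norm v)"
    using d(2)[of "a + t *\<^sub>R v"] \<open>t * norm v < d\<close> t unfolding R_def by (simp add: Ga linear_scale[OF lin])
  have "0 \<ge> inner (t *\<^sub>R p - R) (t *\<^sub>R q - R)"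
    using sec[of "a + t *\<^sub>R v"] unfolding p_def q_def R_def by (simp add: algebra_simps)
  also have "inner (t *\<^sub>R p - R) (t *\<^sub>R q - R) = t * t * inner p q - t * inner (p + q) R + inner R R"
    by (simp add: inner_diff_left inner_diff_right inner_add_left inner_commute algebra_simps)
  finally have "t * (t * inner p q) \<le> t * inner (p + q) R"
    using inner_ge_zero[of R] unfolding mult.assoc by linarith
  then have "t * inner p q \<le> inner (p + q) R" using t by simp
  also have "\<dots> \<le> norm (p + q) * norm R" by (rule norm_cauchy_schwarz)
  also have "\<dots> \<le> K * (c * (t * norm v))"
    using R norm_triangle_ineq[of p q] K unfolding K_def by (intro mult_mono) auto
  finally have "inner p q \<le> K * (c * norm v)" using t by (simp add: mult.left_commute)
  also have "\<dots> \<le> K * (c * (norm v + 1))" using K c by simp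
  also have "\<dots> = inner p q / 2" unfolding c_def using K by (simp add: divide_simps)
  finally show False using P by simp
qed

text \<open>With \<open>a = v \<bullet> w\<close> and \<open>N = |v|^2\<close> the Cauchy-Schwarz inequality turns the hypothesis into
\<open>(a - m N) (a - L N) \<le> 0\<close>.\<close>

lemma sector_quadratic_form:
  fixes v w :: "'a::real_inner"
  assumes "inner (m *\<^sub>R v - w) (L *\<^sub>R v - w) \<le> 0" and mL: "m \<le> L"
  shows "m * (norm v)^2 \<le> inner v w" "inner v w \<le> L * (norm v)^2"
proof -
  define N where "N = (norm v)^2"
  define a where "a = inner v w"
  have N: "N = inner v v" "0 \<le> N" unfolding N_def by (simp_all add: power2_norm_eq_inner)
  have 1: "m * L * N - (m + L) * a + inner w w \<le> 0"
    using assms(1) unfolding N a_def by (simp add: inner_diff_left inner_diff_right inner_commute algebra_simps)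
  have "a^2 \<le> N * inner w w" unfolding a_def N(1) by (rule Cauchy_Schwarz_ineq)
  moreover have "N * (m * L * N - (m + L) * a + inner w w) \<le> 0" using 1 N(2) by (rule mult_nonneg_nonpos[rotated])
  moreover have "(a - m * N) * (a - L * N) = N * (m * L * N - (m + L) * a + inner w w) + (a^2 - N * inner w w)"
    by (simp add: power2_eq_square algebra_simps)
  ultimately have "(a - m * N) * (a - L * N) \<le> 0" by linarith
  moreover have "m * N \<le> L * N" using mL N by (intro mult_right_mono)
  ultimately show "m * (norm v)^2 \<le> inner v w" "inner v w \<le> L * (norm v)^2"
    unfolding N_def[symmetric] a_def[symmetric] by (auto simp: mult_le_0_iff)
qed

section \<open>The R-factor\<close>

text \<open>After the rescaling \<open>y\<^sub>t = e\<^sub>t / r^t\<close> the recursion \<open>e\<^sub>t\<^sub>+\<^sub>1 = Q e\<^sub>t - \<beta> e\<^sub>t\<^sub>-\<^sub>1\<close> becomes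
\<open>y\<^sub>t\<^sub>+\<^sub>1 = (Q / r) y\<^sub>t - b y\<^sub>t\<^sub>-\<^sub>1\<close> with \<open>b = \<beta> / r^2\<close>. This is the standard Lyapunov form
\<open>(1 + b) (y^2 + y'^2) - 2 q y y'\<close> of a scalar recursion, with \<open>q\<close> replaced by the operator \<open>Q / r\<close>
and the rescaling undone; it is positive definite when \<open>Q / r\<close> has norm below \<open>1 + b\<close>.\<close>

definition rate_energy :: "real \<Rightarrow> real \<Rightarrow> ('a::real_inner \<Rightarrow> 'a) \<Rightarrow> 'a \<Rightarrow> 'a \<Rightarrow> real" where
  "rate_energy r b Q a c = (1 + b) * (inner a a + r^2 * inner c c) - 2 * inner a (Q c)"

lemma rate_energy_step:
  fixes Q :: "'a::real_inner \<Rightarrow> 'a"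
  assumes sym: "inner a (Q c) = inner c (Q a)"
  shows "rate_energy r b Q (Q a - (b * r^2) *\<^sub>R c) a = r^2 * rate_energy r b Q a c
    - (1 - b) * inner (Q a - ((1 + b) * r^2) *\<^sub>R c) (Q a - ((1 + b) * r^2) *\<^sub>R c)"
  unfolding rate_energy_def sym
  by (simp add: inner_diff_left inner_diff_right inner_commute power2_eq_square algebra_simps)

lemma rate_energy_step_le:
  fixes Q :: "'a::real_inner \<Rightarrow> 'a"
  assumes "inner a (Q c) = inner c (Q a)" "b \<le> 1"
  shows "rate_energy r b Q (Q a - (b * r^2) *\<^sub>R c) a \<le> r^2 * rate_energy r b Q a c"
proof -
  have "0 \<le> (1 - b) * inner (Q a - ((1 + b) * r^2) *\<^sub>R c) (Q a - ((1 + b) * r^2) *\<^sub>R c)"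
    using assms(2) by (intro mult_nonneg_nonneg) auto
  then show ?thesis unfolding rate_energy_step[OF assms(1)] by linarith
qed

lemma rate_energy_perturb:
  "rate_energy r b Q (x + g) a = rate_energy r b Q x a + (1 + b) * (2 * inner x g + inner g g) - 2 * inner g (Q a)"
  unfolding rate_energy_def by (simp add: inner_add_left inner_add_right inner_commute algebra_simps)

text \<open>Polarization: a symmetric operator is bounded by its numerical radius.\<close>

lemma symmetric_form_bound:
  fixes Q :: "'a::real_inner \<Rightarrow> 'a"
  assumes Q: "linear Q" and sym: "\<And>x y. inner x (Q y) = inner y (Q x)"
    and s: "\<And>x. \<bar>inner x (Q x)\<bar> \<le> s * inner x x"
  shows "2 * inner x (Q y) \<le> s * (inner x x + inner y y)"
proof -
  have "4 * inner x (Q y) = inner (x + y) (Q (x + y)) - inner (x - y) (Q (x - y))"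
    using sym[of y x] by (simp add: linear_add[OF Q] linear_diff[OF Q] inner_add_left inner_add_right inner_diff_left inner_diff_right)
  also have "\<dots> \<le> s * inner (x + y) (x + y) + s * inner (x - y) (x - y)"
    using s[of "x + y"] s[of "x - y"] by (simp add: abs_le_iff)
  also have "\<dots> = 2 * (s * (inner x x + inner y y))"
    by (simp add: inner_add_left inner_add_right inner_diff_left inner_diff_right inner_commute algebra_simps)
  finally show ?thesis by simp
qed

lemma rate_energy_lower:
  fixes Q :: "'a::real_inner \<Rightarrow> 'a"
  assumes Q: "linear Q" and sym: "\<And>x y. inner x (Q y) = inner y (Q x)"
    and s: "\<And>x. \<bar>inner x (Q x)\<bar> \<le> s * inner x x" and r: "0 < r"
  shows "(1 + b - s / r) * (inner a a + r^2 * inner c c) \<le> rate_energy r b Q a c"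
proof -
  have "2 * inner a (Q (r *\<^sub>R c)) \<le> s * (inner a a + inner (r *\<^sub>R c) (r *\<^sub>R c))"
    by (rule symmetric_form_bound[OF Q sym s])
  then have "2 * inner a (Q c) * r \<le> s * (inner a a + r^2 * inner c c)"
    by (simp add: linear_scale[OF Q] power2_eq_square mult_ac)
  then have "2 * inner a (Q c) \<le> s / r * (inner a a + r^2 * inner c c)"
    using r by (simp add: field_simps)
  then show ?thesis unfolding rate_energy_def by (simp add: left_diff_distrib)
qed

text \<open>The form \<open>rate_energy\<close> does not grow by more than \<open>r^2\<close> under the linear part. The perturbation
changes it by at most \<open>d t\<close> times a constant times the form itself, because the form is positive
definite. Since \<open>d t\<close> tends to 0, the growth factor is eventually below \<open>r'^2\<close> for each
\<open>r' > r\<close>.\<close>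

lemma perturbed_linear_rate:
  fixes Q :: "'a::real_inner \<Rightarrow> 'a" and e g :: "nat \<Rightarrow> 'a"
  assumes Q: "bounded_linear Q" and sym: "\<And>x y. inner x (Q y) = inner y (Q x)"
    and s: "\<And>x. \<bar>inner x (Q x)\<bar> \<le> s * inner x x"
    and r: "0 < r" and \<beta>: "0 \<le> \<beta>" "\<beta> < r^2" and sr: "s < r + \<beta> / r"
    and rec: "\<And>t. e (Suc (Suc t)) = Q (e (Suc t)) - \<beta> *\<^sub>R e t + g t"
    and g: "\<And>t. norm (g t) \<le> d t * norm (e (Suc t))" and d: "d \<longlonglongrightarrow> 0"
  shows "limsup (\<lambda>t. ereal (root t (norm (e t)))) \<le> ereal r"
proof (rule dense_ge)
  fix R' :: ereal assume R': "ereal r < R'"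
  obtain r' where r': "r < r'" "ereal r' < R'" using ereal_dense2[OF R'] by auto
  have lin: "linear Q" using Q by (rule bounded_linear.linear)
  obtain B where B: "0 < B" "\<And>x. norm (Q x) \<le> B * norm x" using bounded_linear.pos_bounded[OF Q] by (metis mult.commute)
  define b where "b = \<beta> / r^2"
  have b: "0 \<le> b" "b < 1" "b * r^2 = \<beta>" unfolding b_def using \<beta> r by simp_all
  define V where "V = (\<lambda>t. rate_energy r b Q (e (Suc t)) (e t))"
  define N where "N = (\<lambda>t. inner (e (Suc t)) (e (Suc t)) + r^2 * inner (e t) (e t))"
  define k0 where "k0 = 1 + b - s / r"
  have k0: "0 < k0"
  proof -
    have "s / r < (r + \<beta> / r) / r" using sr r by (simp add: divide_strict_right_mono)
    also have "\<dots> = 1 + b" unfolding b_def using r by (simp add: field_simps power2_eq_square)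
    finally show ?thesis unfolding k0_def by simp
  qed
  have low: "k0 * N t \<le> V t" for t
    unfolding k0_def N_def V_def by (rule rate_energy_lower[OF lin sym s r])
  have N0: "0 \<le> N t" for t unfolding N_def by simp
  \<comment> \<open>Collects the coefficients of all terms that contain the perturbation.\<close>
  define K where "K = (1 + b) * (2 * B + \<beta> + 1) + 2 * B + (1 + b) * b"
  have K: "0 < K"
  proof -
    have "0 \<le> (1 + b) * (2 * B + \<beta> + 1)" "0 \<le> (1 + b) * b"
      using B(1) b \<beta> by (auto intro!: mult_nonneg_nonneg add_nonneg_nonneg)
    then show ?thesis unfolding K_def using B(1) by linarith
  qed
  have step: "V (Suc t) \<le> (r^2 + d t * K / k0) * V t" if dt: "0 \<le> d t" "d t \<le> 1" for t
  proof -
    define a where "a = e (Suc t)"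
    define c where "c = e t"
    define x where "x = Q a - (b * r^2) *\<^sub>R c"
    have gn: "norm (g t) \<le> d t * norm a" using g unfolding a_def by simp
    have gn1: "norm (g t) \<le> norm a" using gn dt by (metis mult_left_le_one_le norm_ge_zero order_trans)
    have "V (Suc t) = rate_energy r b Q (x + g t) a" unfolding V_def rec x_def b(3) a_def c_def ..
    also have "\<dots> = rate_energy r b Q x a + ((1 + b) * (2 * inner x (g t) + inner (g t) (g t)) - 2 * inner (g t) (Q a))"
      unfolding rate_energy_perturb by simp
    also have "rate_energy r b Q x a \<le> r^2 * V t"
      unfolding x_def V_def a_def c_def using b by (intro rate_energy_step_le sym) simp
    also have "(1 + b) * (2 * inner x (g t) + inner (g t) (g t)) - 2 * inner (g t) (Q a) \<le> d t * K * N t"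
    proof -
      have na: "inner a a = norm a * norm a" "inner c c = norm c * norm c"
        by (simp_all add: power2_norm_eq_inner[symmetric] power2_eq_square)
      have nx: "norm x \<le> B * norm a + \<beta> * norm c"
        unfolding x_def b(3) using norm_triangle_ineq4[of "Q a" "\<beta> *\<^sub>R c"] B(2)[of a] \<beta> by simp
      have "inner x (g t) \<le> norm x * norm (g t)" by (rule norm_cauchy_schwarz)
      also have "\<dots> \<le> (B * norm a + \<beta> * norm c) * (d t * norm a)"
        using nx gn B \<beta> by (intro mult_mono) auto
      finally have 1: "2 * inner x (g t) \<le> d t * (2 * B * inner a a + \<beta> * (2 * (norm a * norm c)))"
        unfolding na by (simp add: algebra_simps)
      have "2 * (norm a * norm c) \<le> inner a a + inner c c"
        unfolding na using zero_le_power2[of "norm a - norm c"] by (simp add: power2_eq_square algebra_simps)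
      then have "d t * (2 * B * inner a a + \<beta> * (2 * (norm a * norm c))) \<le> d t * (2 * B * inner a a + \<beta> * (inner a a + inner c c))"
        using dt \<beta> by (intro mult_left_mono add_left_mono) auto
      with 1 have 1: "2 * inner x (g t) \<le> d t * (2 * B * inner a a + \<beta> * (inner a a + inner c c))" by linarith
      have "inner (g t) (g t) = norm (g t) * norm (g t)" by (simp add: power2_norm_eq_inner[symmetric] power2_eq_square)
      also have "\<dots> \<le> (d t * norm a) * norm a" using gn gn1 dt by (intro mult_mono) auto
      finally have 2: "inner (g t) (g t) \<le> d t * inner a a" unfolding na by (simp add: mult.assoc)
      have "- inner (g t) (Q a) \<le> norm (g t) * norm (Q a)"
        using Cauchy_Schwarz_ineq2[of "g t" "Q a"] by linarith
      also have "\<dots> \<le> (d t * norm a) * (B * norm a)" using gn B(2)[of a] dt by (intro mult_mono) auto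
      finally have "- inner (g t) (Q a) \<le> (d t * norm a) * (B * norm a)" .
      moreover have "d t * (2 * B * inner a a) = 2 * ((d t * norm a) * (B * norm a))" unfolding na by (simp only: mult_ac)
      ultimately have 3: "- 2 * inner (g t) (Q a) \<le> d t * (2 * B * inner a a)" by linarith
      have "(1 + b) * (2 * inner x (g t) + inner (g t) (g t)) \<le> (1 + b) * (d t * (2 * B * inner a a + \<beta> * (inner a a + inner c c)) + d t * inner a a)"
        using 1 2 b by (intro mult_left_mono add_mono) auto
      then have "(1 + b) * (2 * inner x (g t) + inner (g t) (g t)) - 2 * inner (g t) (Q a) \<le>
         (1 + b) * (d t * (2 * B * inner a a + \<beta> * (inner a a + inner c c)) + d t * inner a a) + d t * (2 * B * inner a a)"
        using 3 by linarith
      also have "\<dots> = d t * (((1 + b) * (2 * B + \<beta> + 1) + 2 * B) * inner a a + (1 + b) * b * (r^2 * inner c c))"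
        unfolding b(3)[symmetric] by (simp add: algebra_simps)
      also have "\<dots> \<le> d t * (K * inner a a + K * (r^2 * inner c c))"
      proof (intro mult_left_mono add_mono mult_right_mono)
        show "(1 + b) * (2 * B + \<beta> + 1) + 2 * B \<le> K" unfolding K_def using b by simp
        have "0 \<le> (1 + b) * (2 * B + \<beta> + 1)" using b B \<beta> by (intro mult_nonneg_nonneg) auto
        then show "(1 + b) * b \<le> K" unfolding K_def using B by linarith
      qed (use dt in auto)
      also have "\<dots> = d t * K * N t" unfolding N_def a_def c_def by (simp add: algebra_simps)
      finally show ?thesis .
    qed
    also have "d t * K * N t \<le> d t * K * (V t / k0)"
      using low[of t] k0 dt K by (intro mult_left_mono) (auto simp: field_simps)
    finally show ?thesis by (simp add: algebra_simps)
  qed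
  have gap: "0 < r'^2 - r^2" using r r' by (simp add: power_strict_mono)
  define d' where "d' = (\<lambda>t. \<bar>d t\<bar>)"
  have "(\<lambda>t. \<bar>d t\<bar> * K / k0) \<longlonglongrightarrow> \<bar>0\<bar> * K / k0" using d k0 by (intro tendsto_intros) auto
  then have "\<forall>\<^sub>F t in sequentially. \<bar>d t\<bar> * K / k0 < r'^2 - r^2"
    by (rule order_tendstoD(2)) (use gap in simp)
  moreover have "\<forall>\<^sub>F t in sequentially. d t < 1" by (rule order_tendstoD(2)[OF d]) simp
  ultimately have "\<forall>\<^sub>F t in sequentially. d t < 1 \<and> \<bar>d t\<bar> * K / k0 < r'^2 - r^2" by eventually_elim simp
  then obtain T where T: "\<And>t. T \<le> t \<Longrightarrow> d t < 1 \<and> \<bar>d t\<bar> * K / k0 < r'^2 - r^2"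
    unfolding eventually_sequentially by blast
  have V0: "0 \<le> V t" for t using low[of t] N0[of t] k0 by (meson mult_nonneg_nonneg less_imp_le order_trans)
  have Vstep: "V (Suc t) \<le> r'^2 * V t" if t: "T \<le> t" for t
  proof (cases "0 \<le> d t")
    case True
    have "V (Suc t) \<le> (r^2 + d t * K / k0) * V t" using step[of t] True T[OF t] by simp
    also have "\<dots> \<le> r'^2 * V t" using T[OF t] True V0[of t] by (intro mult_right_mono) auto
    finally show ?thesis .
  next
    case False
    then have "norm (g t) \<le> 0"
      using g[of t] by (meson mult_nonpos_nonneg norm_ge_zero not_le order_trans less_imp_le)
    then have g0: "g t = 0" by simp
    have "V (Suc t) \<le> r^2 * V t"
      unfolding V_def rec g0 using rate_energy_step_le[of "e (Suc t)" Q "e t" b r, OF sym] b by simp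
    also have "\<dots> \<le> r'^2 * V t" using gap V0[of t] by (intro mult_right_mono) auto
    finally show ?thesis .
  qed
  have Vpow: "V (T + t) \<le> (r'^2) ^ t * V T" for t
  proof (induction t)
    case (Suc t)
    have "V (T + Suc t) \<le> r'^2 * V (T + t)" using Vstep[of "T + t"] by simp
    also have "\<dots> \<le> r'^2 * ((r'^2) ^ t * V T)" using Suc by (intro mult_left_mono) auto
    finally show ?case by (simp add: mult.assoc)
  qed simp
  \<comment> \<open>The summand 1 only makes the constant positive.\<close>
  define C where "C = sqrt (V T / k0) / r' ^ Suc T + 1"
  have r'0: "0 < r'" using r r' by simp
  have C: "0 < C" unfolding C_def using V0[of T] k0 r'0 by (intro add_nonneg_pos) auto
  have bound: "norm (e t) \<le> C * r' ^ t" if t: "Suc T \<le> t" for t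
  proof -
    obtain j where j: "t = Suc (T + j)" using t by (metis add_Suc less_eqE)
    have "inner (e t) (e t) \<le> N (T + j)" unfolding N_def j using r by simp
    also have "\<dots> \<le> V (T + j) / k0" using low[of "T + j"] k0 by (simp add: field_simps)
    also have "\<dots> \<le> (r'^2) ^ j * V T / k0" using Vpow[of j] k0 by (intro divide_right_mono) auto
    finally have "(norm (e t))^2 \<le> (r' ^ j)^2 * (V T / k0)"
      by (simp add: power2_norm_eq_inner power_mult[symmetric] mult.commute)
    then have "norm (e t) \<le> sqrt ((r' ^ j)^2 * (V T / k0))" by (rule real_le_rsqrt)
    also have "\<dots> = r' ^ j * sqrt (V T / k0)"
      unfolding real_sqrt_mult[of "(r' ^ j)^2"] using r'0 by simp
    also have "\<dots> = sqrt (V T / k0) / r' ^ Suc T * r' ^ t" unfolding j using r'0 by (simp add: power_add)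
    also have "\<dots> \<le> C * r' ^ t" unfolding C_def using r'0 by (intro mult_right_mono) auto
    finally show ?thesis .
  qed
  have lim: "(\<lambda>t. root t C * r') \<longlonglongrightarrow> 1 * r'" by (intro tendsto_intros LIMSEQ_root_const C)
  have "\<forall>\<^sub>F t in sequentially. ereal (root t (norm (e t))) \<le> ereal (root t C * r')"
    unfolding eventually_sequentially
  proof (intro exI allI impI)
    fix t assume t: "Suc T \<le> t"
    then have "root t (norm (e t)) \<le> root t (C * r' ^ t)" using bound[OF t] by (intro real_root_le_mono) auto
    also have "\<dots> = root t C * r'" using t r'0 by (simp add: real_root_mult real_root_power_cancel)
    finally show "ereal (root t (norm (e t))) \<le> ereal (root t C * r')" by simp
  qed
  then have "limsup (\<lambda>t. ereal (root t (norm (e t)))) \<le> limsup (\<lambda>t. ereal (root t C * r'))" by (rule Limsup_mono)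
  also have "\<dots> = ereal r'" using lim by (intro lim_imp_Limsup) auto
  finally show "limsup (\<lambda>t. ereal (root t (norm (e t)))) \<le> R'" using r'(2) by simp
qed

text \<open>\<open>Q = (1 + \<beta>) I - \<alpha> J\<close> with \<open>J\<close> the Hessian at the minimizer. The sector bounds on \<open>J\<close> bound the
form of \<open>Q\<close> by the larger of the two quantities in \<open>rate_lt\<close>, and the relative error of the
linear approximation tends to 0 along a trajectory converging to the minimizer.\<close>

lemma r_GHB_le:
  fixes f :: "real^'n \<Rightarrow> real"
  assumes mL: "0 < m" "m < L" and \<alpha>: "0 \<le> \<alpha>" and \<beta>: "0 \<le> \<beta>" and r: "0 < r"
    and lt: "rate_lt r m L \<alpha> \<beta>" and f: "f \<in> F2 m L"
  shows "r_GHB \<alpha> \<beta> f \<le> ereal r"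
proof -
  obtain xs where xs: "F1_at m L f xs" using f unfolding F2_def F1_def by blast
  have mini: "minimizer f = xs" using F1_at_minimizer[OF mL(1) _ xs] mL by simp
  define G where "G = gradient f"
  have G: "GDERIV f x :> G x" for x
    unfolding G_def using xs by (intro GDERIV_gradient) (simp add: F1_at_def)
  have G0: "G xs = 0" unfolding G_def by (rule gradient_at_minimum[OF xs])
  obtain J where J: "(G has_derivative J) (at xs)"
    using f unfolding F2_def G_def differentiable_def by blast
  have blJ: "bounded_linear J" using J by (rule has_derivative_bounded_linear)
  have symJ: "inner u (J v) = inner v (J u)" for u v by (rule second_derivative_symmetric[OF G J])
  have sec: "inner (m *\<^sub>R (x - xs) - G x) (L *\<^sub>R (x - xs) - G x) \<le> 0" for x
    using xs unfolding F1_at_def G_def by blast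
  have form: "m * inner v v \<le> inner v (J v)" "inner v (J v) \<le> L * inner v v" for v
    using sector_quadratic_form[OF sector_derivative[OF J G0 sec, of v]] mL by (simp_all add: power2_norm_eq_inner)
  define Q where "Q = (\<lambda>v. (1 + \<beta>) *\<^sub>R v - \<alpha> *\<^sub>R J v)"
  have blQ: "bounded_linear Q" unfolding Q_def
    by (intro bounded_linear_sub bounded_linear_scaleR_right bounded_linear_const_scaleR blJ bounded_linear_ident)
  have symQ: "inner x (Q y) = inner y (Q x)" for x y
    unfolding Q_def using symJ[of x y] by (simp add: inner_diff_right inner_commute)
  define s where "s = max \<bar>\<alpha> * m - 1 - \<beta>\<bar> \<bar>\<alpha> * L - 1 - \<beta>\<bar>"
  have s: "\<bar>inner x (Q x)\<bar> \<le> s * inner x x" for x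
  proof -
    have "\<alpha> * (m * inner x x) \<le> \<alpha> * inner x (J x)" "\<alpha> * inner x (J x) \<le> \<alpha> * (L * inner x x)"
      using form[of x] \<alpha> by (auto intro!: mult_left_mono)
    moreover have "- (s * inner x x) \<le> (\<alpha> * m - 1 - \<beta>) * inner x x" "(\<alpha> * L - 1 - \<beta>) * inner x x \<le> s * inner x x"
    proof -
      have "(- s) * inner x x \<le> (\<alpha> * m - 1 - \<beta>) * inner x x" unfolding s_def by (intro mult_right_mono) auto
      then show "- (s * inner x x) \<le> (\<alpha> * m - 1 - \<beta>) * inner x x" by simp
      show "(\<alpha> * L - 1 - \<beta>) * inner x x \<le> s * inner x x" unfolding s_def by (intro mult_right_mono) auto
    qed
    ultimately show ?thesis unfolding Q_def by (simp add: abs_le_iff inner_diff_right algebra_simps)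
  qed
  have sr: "s < r + \<beta> / r" and \<beta>r: "\<beta> < r^2" using lt unfolding rate_lt_def s_def by auto
  have "seq_R_factor (hb \<alpha> \<beta> f xm x0) xs \<le> ereal r" if conv: "hb \<alpha> \<beta> f xm x0 \<longlonglongrightarrow> xs" for xm x0
  proof -
    define e where "e = (\<lambda>t. hb \<alpha> \<beta> f xm x0 t - xs)"
    define rem where "rem = (\<lambda>h. G (xs + h) - J h)"
    define \<rho> where "\<rho> = (\<lambda>h. norm (rem h) / norm h)"
    have "\<rho> \<midarrow>0\<rightarrow> 0" using J G0 unfolding has_derivative_at \<rho>_def rem_def by simp
    moreover have "\<rho> 0 = 0" unfolding \<rho>_def by simp
    ultimately have "isCont \<rho> 0" unfolding isCont_def by simp
    moreover have e0: "(\<lambda>t. e (Suc t)) \<longlonglongrightarrow> 0"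
      unfolding e_def using LIM_zero[OF LIMSEQ_Suc[OF conv]] by simp
    ultimately have "(\<lambda>t. \<rho> (e (Suc t))) \<longlonglongrightarrow> \<rho> 0" by (rule isCont_tendsto_compose)
    then have "(\<lambda>t. \<alpha> * \<rho> (e (Suc t))) \<longlonglongrightarrow> \<alpha> * 0"
      using \<open>\<rho> 0 = 0\<close> by (intro tendsto_mult_left) simp
    then have d: "(\<lambda>t. \<alpha> * \<rho> (e (Suc t))) \<longlonglongrightarrow> 0" by simp
    have rec: "e (Suc (Suc t)) = Q (e (Suc t)) - \<beta> *\<^sub>R e t + (- (\<alpha> *\<^sub>R rem (e (Suc t))))" for t
      unfolding e_def Q_def rem_def G_def by (simp add: algebra_simps)
    have rem0: "rem 0 = 0" unfolding rem_def using G0 linear_0[OF bounded_linear.linear[OF blJ]] by simp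
    have g: "norm (- (\<alpha> *\<^sub>R rem (e (Suc t)))) \<le> \<alpha> * \<rho> (e (Suc t)) * norm (e (Suc t))" for t
      unfolding \<rho>_def using \<alpha> rem0 by (cases "e (Suc t) = 0") simp_all
    show ?thesis unfolding seq_R_factor_def
      using perturbed_linear_rate[OF blQ symQ s r \<beta> \<beta>r sr rec g d] unfolding e_def .
  qed
  then show ?thesis unfolding r_GHB_def mini by (auto intro!: SUP_least)
qed

section \<open>Reduction to inequalities between real numbers\<close>

abbreviation inf_sup_R_factor :: "(real^'n \<Rightarrow> real) set \<Rightarrow> ereal" where
  "inf_sup_R_factor F \<equiv> INF (\<alpha>, \<beta>)\<in>GHB_set F. SUP f\<in>F. r_GHB \<alpha> \<beta> f"

text \<open>A pair on the boundary of the admissible region still determines the infimum over the open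
region: \<open>rate_lt\<close> for \<open>r > v\<close> is an open condition in \<open>\<alpha>\<close>, so it persists for slightly smaller
\<open>\<alpha>\<close>. Decreasing \<open>\<alpha>\<close> increases \<open>(1 - \<beta>)^2 / \<alpha>\<close>, which turns the first circle inequality into a
strict one, so these smaller \<open>\<alpha>\<close> also give global convergence for all functions of the class.\<close>

lemma optimal_tuning:
  fixes m L v \<alpha> \<beta> :: real
  assumes mL: "0 < m" "m < L" and n: "0 < n" and v: "0 < v"
    and \<alpha>: "0 < \<alpha>" "\<alpha> \<le> alpha_bar m L \<beta>" and \<beta>: "0 < \<beta>" "\<beta> < 1"
    and attained: "rate_le v m L \<alpha> \<beta>"
    and optimal: "\<And>\<alpha>' \<beta>'. \<alpha>' \<le> alpha_bar m L \<beta>' \<Longrightarrow> 0 \<le> \<beta>' \<Longrightarrow> \<not> rate_lt v m L \<alpha>' \<beta>'"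
    and circle: "- 2 * sqrt (\<beta> * L * m) \<le> circle_offset m L \<alpha> \<beta>"
      "circle_offset m L \<alpha> \<beta> < 2 * sqrt (\<beta> * L * m)"
  shows "r_star n m L = v" "r_star_achieved_at n m L \<alpha> \<beta>"
    "inf_sup_R_factor (F2 m L :: (real^'n \<Rightarrow> real) set) \<le> ereal v"
proof -
  have lower: "v \<le> sup_rho n m L a b" if "0 < a" "a \<le> alpha_bar m L b" "0 \<le> b" for a b
  proof (rule ccontr)
    assume "\<not> v \<le> sup_rho n m L a b"
    then have "rate_lt v m L a b" using rate_lt_of_sup_rho[OF n _ that(3) v, of a m L] that mL by simp
    then show False using optimal that by blast
  qed
  have "sup_rho n m L \<alpha> \<beta> \<le> v" using sup_rho_le[OF n _ _ v _ attained] \<alpha> \<beta> mL by simp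
  then have eq: "sup_rho n m L \<alpha> \<beta> = v" using lower[OF \<alpha>] \<beta> by simp
  define S where "S = {(a, b). a \<in> {0<..<alpha_bar m L b} \<and> b \<in> {0..<(1::real)}}"
  have approx: "\<exists>a. 0 < a \<and> a < \<alpha> \<and> rate_lt r m L a \<beta> \<and>
      \<bar>circle_offset m L a \<beta>\<bar> < 2 * sqrt (\<beta> * L * m)" if r: "v < r" for r
  proof -
    have lt: "rate_lt r m L \<alpha> \<beta>"
      using rate_lt_of_sup_rho[OF n _ _ _ _, of \<alpha> \<beta> r m L] \<alpha> \<beta> v r mL eq by simp
    have "((\<lambda>a. \<bar>a * m - 1 - \<beta>\<bar>) \<longlongrightarrow> \<bar>\<alpha> * m - 1 - \<beta>\<bar>) (at_left \<alpha>)"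
      "((\<lambda>a. \<bar>a * L - 1 - \<beta>\<bar>) \<longlongrightarrow> \<bar>\<alpha> * L - 1 - \<beta>\<bar>) (at_left \<alpha>)" by (intro tendsto_intros)+
    then have "\<forall>\<^sub>F a in at_left \<alpha>. \<bar>a * m - 1 - \<beta>\<bar> < r + \<beta> / r" "\<forall>\<^sub>F a in at_left \<alpha>. \<bar>a * L - 1 - \<beta>\<bar> < r + \<beta> / r"
      using lt unfolding rate_lt_def by (auto dest: order_tendstoD(2))
    moreover have "\<forall>\<^sub>F a in at_left \<alpha>. a \<in> {0<..<\<alpha>}" using \<alpha> by (intro eventually_at_left_real)
    moreover have "((\<lambda>a. circle_offset m L a \<beta>) \<longlongrightarrow> circle_offset m L \<alpha> \<beta>) (at_left \<alpha>)"
      unfolding circle_offset_def using \<alpha> by (intro tendsto_intros) auto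
    then have "\<forall>\<^sub>F a in at_left \<alpha>. circle_offset m L a \<beta> < 2 * sqrt (\<beta> * L * m)"
      using circle(2) by (rule order_tendstoD(2))
    ultimately have "\<forall>\<^sub>F a in at_left \<alpha>. \<bar>a * m - 1 - \<beta>\<bar> < r + \<beta> / r \<and> \<bar>a * L - 1 - \<beta>\<bar> < r + \<beta> / r \<and>
      a \<in> {0<..<\<alpha>} \<and> circle_offset m L a \<beta> < 2 * sqrt (\<beta> * L * m)"
      by eventually_elim simp
    then obtain a where a: "\<bar>a * m - 1 - \<beta>\<bar> < r + \<beta> / r" "\<bar>a * L - 1 - \<beta>\<bar> < r + \<beta> / r" "0 < a" "a < \<alpha>"
      "circle_offset m L a \<beta> < 2 * sqrt (\<beta> * L * m)"
      using eventually_happens'[OF trivial_limit_at_left_real] by fastforce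
    have "(1 - \<beta>)^2 / \<alpha> < (1 - \<beta>)^2 / a" using a \<beta> by (intro divide_strict_left_mono) auto
    then have "\<bar>circle_offset m L a \<beta>\<bar> < 2 * sqrt (\<beta> * L * m)"
      using a(5) circle(1) unfolding circle_offset_def by (simp add: abs_less_iff)
    moreover have "rate_lt r m L a \<beta>" using a(1,2) lt unfolding rate_lt_def by simp
    ultimately show ?thesis using a(3,4) by blast
  qed
  have S_lower: "v \<le> (case p of (a, b) \<Rightarrow> sup_rho n m L a b)" if "p \<in> S" for p
    using that lower unfolding S_def by auto
  have "v \<le> r_star n m L"
    unfolding r_star_def S_def[symmetric]
  proof (rule cINF_greatest)
    have "(\<alpha> / 2, \<beta>) \<in> S" unfolding S_def using \<alpha> \<beta> by auto
    then show "S \<noteq> {}" by blast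
  qed (rule S_lower)
  moreover have "r_star n m L \<le> v"
  proof (rule dense_ge)
    fix r assume r: "v < r"
    obtain a where a: "0 < a" "a < \<alpha>" "rate_lt r m L a \<beta>" using approx[OF r] by blast
    have "(a, \<beta>) \<in> S" unfolding S_def using a \<alpha> \<beta> by auto
    then have "r_star n m L \<le> (case (a, \<beta>) of (a, b) \<Rightarrow> sup_rho n m L a b)"
      unfolding r_star_def S_def[symmetric] by (intro cINF_lower bdd_belowI2[of _ v] S_lower)
    also have "\<dots> \<le> r" using sup_rho_le[OF n _ _ _ _ rate_lt_imp_le[OF a(3)]] a \<beta> v r mL by simp
    finally show "r_star n m L \<le> r" .
  qed
  ultimately show star: "r_star n m L = v" by simp
  show "r_star_achieved_at n m L \<alpha> \<beta>"
    unfolding r_star_achieved_at_def is_arg_min_def using eq star \<alpha> \<beta> lower by (auto simp: not_less)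
  show "inf_sup_R_factor (F2 m L :: (real^'n \<Rightarrow> real) set) \<le> ereal v" (is "?I \<le> _")
  proof (rule dense_ge)
    fix R :: ereal assume "ereal v < R"
    then obtain r where r: "v < r" "ereal r < R" using ereal_dense2[of "ereal v" R] by auto
    obtain a where a: "0 < a" "a < \<alpha>" "rate_lt r m L a \<beta>"
      "\<bar>circle_offset m L a \<beta>\<bar> < 2 * sqrt (\<beta> * L * m)"
      using approx[OF r(1)] by blast
    have "?I \<le> (case (a, \<beta>) of (\<alpha>, \<beta>) \<Rightarrow> SUP f\<in>(F2 m L :: (real^'n \<Rightarrow> real) set). r_GHB \<alpha> \<beta> f)"
      by (rule INF_lower[OF globally_convergent[OF mL a(1) \<beta> a(4)]])
    also have "\<dots> \<le> ereal r"
      using r_GHB_le[OF mL _ _ _ a(3)] a(1) \<beta> v r(1) by (auto intro!: SUP_least)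
    finally show "?I \<le> R" using r(2) by simp
  qed
qed

section \<open>Hyperbolic coordinates on the boundary of the admissible region\<close>

text \<open>The second case in the definition of \<open>alpha_bar\<close>, for \<open>\<beta> = s^2\<close>.\<close>

definition second_branch :: "real \<Rightarrow> real \<Rightarrow> bool" where
  "second_branch k s \<longleftrightarrow> k - sqrt (k^2 - 1) < s"

lemma nonneg_cancel: "0 < p \<Longrightarrow> 0 \<le> x * p \<Longrightarrow> 0 \<le> (x::real)"
  by (simp add: zero_le_mult_iff)

lemma cancel_pos: "p * a = p * b \<Longrightarrow> 0 < p \<Longrightarrow> a = (b::real)"
  by simp

lemma sq_lt_1: "0 \<le> s \<Longrightarrow> s < 1 \<Longrightarrow> s^2 < (1::real)"
  by (simp add: power_less_one_iff abs_square_less_1)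

lemma quartic_factor_pos: fixes k s :: real assumes "s < k"
  shows "0 < (1 + s^2) * (k^2 + 1) - 4 * s * k"
proof -
  have "(1 + s^2) * (k^2 + 1) - 4 * s * k = (1 - k * s)^2 + (k - s)^2" by Groebner_Basis.algebra
  moreover have "0 < (k - s)^2" using assms by simp
  ultimately show ?thesis using zero_le_power2[of "1 - k * s"] by linarith
qed

lemma sqrt_k_bounds: assumes "1 < (k::real)"
  shows "0 < k - sqrt (k^2 - 1)" "k * (k - sqrt (k^2 - 1)) < 1"
proof -
  define h where "h = sqrt (k^2 - 1)"
  have k2: "1 < k^2" using assms by simp
  then have h: "0 < h" "h^2 = k^2 - 1" unfolding h_def by simp_all
  have "h^2 < k^2" using h by simp
  then have "h < k" by (rule power_less_imp_less_base) (use assms in simp)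
  then show "0 < k - sqrt (k^2 - 1)" unfolding h_def by simp
  have "h * h < k * h" using \<open>h < k\<close> h by simp
  then show "k * (k - sqrt (k^2 - 1)) < 1"
    using h(2) unfolding h_def[symmetric] by (simp add: power2_eq_square right_diff_distrib mult.commute[of k h])
qed

lemma second_branch_if_ge: assumes "1 < k" "1 \<le> k * s" shows "second_branch k s"
proof -
  have "k * (k - sqrt (k^2 - 1)) < k * s" using sqrt_k_bounds(2)[OF assms(1)] assms(2) by linarith
  then show ?thesis unfolding second_branch_def using assms(1) by simp
qed

lemma alpha_bar_scaled:
  assumes m: "0 < m" and k: "1 < k" and s: "0 \<le> s"
  shows "m * alpha_bar m (k^2 * m) (s^2) =
    (if second_branch k s then 2 * (1 - s^2)^2 / ((1 + s^2) * (k^2 + 1) - 4 * s * k)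
     else 2 * (1 + s^2) / k^2)"
proof -
  have km: "k^2 * m / m = k^2" "sqrt (k^2) = k" using m k by simp_all
  have c: "s^2 \<le> (k - sqrt (k^2 - 1))^2 \<longleftrightarrow> \<not> second_branch k s"
    unfolding second_branch_def not_less using sqrt_k_bounds(1)[OF k] s
    by (meson less_imp_le power2_le_imp_le power_mono)
  have r: "sqrt (s^2 * (k^2 * m) * m) = s * k * m"
  proof -
    have "s^2 * (k^2 * m) * m = (s * k * m)^2" by Groebner_Basis.algebra
    then show ?thesis using m k s by simp
  qed
  show ?thesis unfolding alpha_bar_def km c r
  proof (simp, intro conjI impI)
    have "(1 + s^2) * (k^2 * m + m) - 4 * (s * k * m) = m * ((1 + s^2) * (k^2 + 1) - 4 * s * k)" by Groebner_Basis.algebra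
    then show "m * (2 * (1 - s^2)^2) / ((1 + s^2) * (k^2 * m + m) - 4 * (s * k * m)) =
      2 * (1 - s^2)^2 / ((1 + s^2) * (k^2 + 1) - 4 * s * k)"
      using m by simp
  qed (use m k in auto)
qed

text \<open>The equation says that at \<open>\<beta> = s^2\<close> and \<open>\<alpha> = alpha_bar\<close> one has \<open>m \<alpha> = (1 - v) (1 - s^2 / v)\<close>, that is,
\<open>v\<close> and \<open>s^2 / v\<close> are the two roots at \<open>\<mu> = m\<close>; \<open>eta\<close> is the larger of them.\<close>

lemma alpha_bar_equality:
  assumes m: "0 < m" and k: "1 < k" and s: "0 < s" "s \<le> v" and v: "v < 1" and sec: "second_branch k s"
    and eq: "2 * v * (1 - s^2)^2 = (1 - v) * (v - s^2) * ((1 + s^2) * (k^2 + 1) - 4 * s * k)"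
  shows "m * alpha_bar m (k^2 * m) (s^2) = (1 - v) * (1 - s^2 / v)"
    and "eta m (k^2 * m) (s^2) = v"
proof -
  have D: "0 < (1 + s^2) * (k^2 + 1) - 4 * s * k" using quartic_factor_pos[of s k] s v k by simp
  have v0: "0 < v" using s by simp
  have "2 * (1 - s^2)^2 = (1 - v) * (1 - s^2 / v) * ((1 + s^2) * (k^2 + 1) - 4 * s * k)"
  proof -
    have "v * (2 * (1 - s^2)^2) = v * ((1 - v) * (1 - s^2 / v) * ((1 + s^2) * (k^2 + 1) - 4 * s * k))"
    proof -
      have "v * (1 - s^2 / v) = v - s^2" using v0 by (simp add: field_simps)
      then show ?thesis using eq by Groebner_Basis.algebra
    qed
    then show ?thesis using v0 by simp
  qed
  then show ab: "m * alpha_bar m (k^2 * m) (s^2) = (1 - v) * (1 - s^2 / v)"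
    unfolding alpha_bar_scaled[OF m k less_imp_le[OF s(1)]] using sec D by simp
  have g: "- gamma_m m (alpha_bar m (k^2 * m) (s^2)) (s^2) = v + s^2 / v"
    unfolding gamma_m_def ab using v0 by (simp add: field_simps power2_eq_square)
  have "(gamma_m m (alpha_bar m (k^2 * m) (s^2)) (s^2))^2 = (v + s^2 / v)^2"
    using g by (metis power2_minus)
  also have "\<dots> - 4 * s^2 = (v - s^2 / v)^2" using v0 by (simp add: field_simps power2_eq_square)
  finally have "sqrt ((gamma_m m (alpha_bar m (k^2 * m) (s^2)) (s^2))^2 - 4 * s^2) = \<bar>v - s^2 / v\<bar>" by simp
  also have "s^2 \<le> v^2" using s by (simp add: power_mono)
  then have "\<bar>v - s^2 / v\<bar> = v - s^2 / v" using v0 by (simp add: field_simps power2_eq_square)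
  finally show "eta m (k^2 * m) (s^2) = v" unfolding eta_def g by simp
qed

text \<open>After division by \<open>v\<close> and by the last factor this is
\<open>m alpha_bar \<le> (1 - v) (1 - s^2 / v)\<close> on the second branch: even with the largest admissible \<open>\<alpha>\<close>, the
polynomial at \<open>\<mu> = m\<close> has a root of modulus at least \<open>v\<close>.\<close>

definition boundary_rate_ge :: "real \<Rightarrow> real \<Rightarrow> real \<Rightarrow> bool" where
  "boundary_rate_ge k v s \<longleftrightarrow>
     2 * v * (1 - s^2)^2 \<le> (1 - v) * (v - s^2) * ((1 + s^2) * (k^2 + 1) - 4 * s * k)"

text \<open>With \<open>s = tanh (u / 2)\<close> these are \<open>cosh u\<close> and \<open>sinh u\<close>, and \<open>cayley s = exp u\<close>.\<close>

definition ch :: "real \<Rightarrow> real" where "ch s = (1 + s^2) / (1 - s^2)"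

definition sh :: "real \<Rightarrow> real" where "sh s = 2 * s / (1 - s^2)"

definition cayley :: "real \<Rightarrow> real" where "cayley v = (1 + v) / (1 - v)"

definition gap :: "real \<Rightarrow> real \<Rightarrow> real \<Rightarrow> real \<Rightarrow> real" where
  "gap k T C S = (T - C) * ((k^2 + 1) * C - 2 * k * S) - (T^2 - 1)"

lemma ch_sh: assumes "0 \<le> s" "s < 1" shows "(ch s)^2 - (sh s)^2 = 1"
proof -
  have "1 - s^2 \<noteq> 0" using sq_lt_1[OF assms] by simp
  then show ?thesis unfolding ch_def sh_def power_divide
    by (simp add: diff_divide_distrib[symmetric]) (simp add: field_simps power2_eq_square)
qed

lemma gap_eq_quotient:
  assumes "0 < v" "v < 1" "0 \<le> s" "s < 1"
  shows "gap k (cayley v) (ch s) (sh s)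
      = 2 * ((1 - v) * (v - s^2) * ((1 + s^2) * (k^2 + 1) - 4 * s * k) - 2 * v * (1 - s^2)^2)
         / ((1 - v)^2 * (1 - s^2)^2)"
proof -
  have p: "0 < 1 - s^2" using sq_lt_1[OF assms(3,4)] by simp
  have q: "0 < 1 - v" using assms by simp
  have "cayley v - ch s = 2 * (v - s^2) / ((1 - v) * (1 - s^2))"
    unfolding cayley_def ch_def using p q by (simp add: field_simps)
  moreover have "(k^2 + 1) * ch s - 2 * k * sh s = ((1 + s^2) * (k^2 + 1) - 4 * s * k) / (1 - s^2)"
    unfolding ch_def sh_def times_divide_eq_right diff_divide_distrib[symmetric]
    by (simp add: algebra_simps)
  moreover have "(cayley v)^2 - 1 = 4 * v / (1 - v)^2"
  proof -
    have "(1 + v)^2 - (1 - v)^2 = 4 * v" by Groebner_Basis.algebra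
    then have "(1 + v)^2 = 4 * v + (1 - v)^2" by simp
    then show ?thesis unfolding cayley_def power_divide using q by (simp add: add_divide_distrib)
  qed
  ultimately have "gap k (cayley v) (ch s) (sh s) = 2 * (v - s^2) / ((1 - v) * (1 - s^2)) *
      (((1 + s^2) * (k^2 + 1) - 4 * s * k) / (1 - s^2)) - 4 * v / (1 - v)^2"
    unfolding gap_def by simp
  also have "\<dots> = (2 * (v - s^2) * ((1 + s^2) * (k^2 + 1) - 4 * s * k)) * (1 - v) / ((1 - v)^2 * (1 - s^2)^2)
      - 4 * v * (1 - s^2)^2 / ((1 - v)^2 * (1 - s^2)^2)"
    using p q by (simp add: power2_eq_square)
  also have "\<dots> = 2 * ((1 - v) * (v - s^2) * ((1 + s^2) * (k^2 + 1) - 4 * s * k) - 2 * v * (1 - s^2)^2)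
         / ((1 - v)^2 * (1 - s^2)^2)"
    unfolding diff_divide_distrib[symmetric] by (rule arg_cong[of _ _ "\<lambda>x. x / _"]) Groebner_Basis.algebra
  finally show ?thesis .
qed

lemma boundary_rate_ge_iff_gap:
  assumes "0 < v" "v < 1" "0 \<le> s" "s < 1"
  shows "boundary_rate_ge k v s \<longleftrightarrow> 0 \<le> gap k (cayley v) (ch s) (sh s)"
proof -
  have "0 < (1 - v)^2 * (1 - s^2)^2"
    using assms sq_lt_1[OF assms(3,4)] by simp
  then show ?thesis unfolding boundary_rate_ge_def gap_eq_quotient[OF assms]
    by (auto simp: zero_le_divide_iff mult.assoc)
qed

lemma gap_eq_0_iff:
  assumes "0 < v" "v < 1" "0 \<le> s" "s < 1"
  shows "gap k (cayley v) (ch s) (sh s) = 0 \<longleftrightarrow>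
    2 * v * (1 - s^2)^2 = (1 - v) * (v - s^2) * ((1 + s^2) * (k^2 + 1) - 4 * s * k)"
  unfolding gap_eq_quotient[OF assms] using assms sq_lt_1[OF assms(3,4)] by auto

lemma ch_mono: assumes "0 \<le> s" "s \<le> t" "t < 1" shows "ch s \<le> ch t"
proof -
  have "s^2 \<le> t^2" "t^2 < 1" using assms sq_lt_1[of t] by auto
  then show ?thesis unfolding ch_def by (simp add: field_simps) 
qed

lemma sh_mono: assumes "0 \<le> s" "s \<le> t" "t < 1" shows "sh s \<le> sh t"
proof -
  have "s^2 \<le> t^2" "t^2 < 1" using assms sq_lt_1[of t] by auto
  then show ?thesis unfolding sh_def using assms
    by (intro frac_le) auto
qed

lemma sh_nonneg: "0 \<le> s \<Longrightarrow> s < 1 \<Longrightarrow> 0 \<le> sh s"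
  using sq_lt_1[of s] unfolding sh_def by (auto intro!: divide_nonneg_nonneg)

lemma ch_plus_sh: assumes "0 \<le> s" "s < 1" shows "ch s + sh s = cayley s"
proof -
  have "1 - s^2 = (1 - s) * (1 + s)" by Groebner_Basis.algebra
  then show ?thesis unfolding ch_def sh_def cayley_def using assms
    by (simp add: add_divide_distrib[symmetric] divide_simps) (simp add: power2_eq_square algebra_simps)
qed

lemma ch_minus_sh: assumes "0 \<le> s" "s < 1" shows "(ch s - sh s) * cayley s = 1"
  using ch_sh[OF assms] ch_plus_sh[OF assms] by (metis power2_eq_square square_diff_square_factored mult.commute)

lemma cayley_ge_1: "0 \<le> s \<Longrightarrow> s < 1 \<Longrightarrow> 1 \<le> cayley s"
  unfolding cayley_def by simp

lemma cayley_inverse: "1 < T \<Longrightarrow> cayley ((T - 1) / (T + 1)) = T"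
  unfolding cayley_def by (simp add: field_simps)

lemma cayley_le_iff: "s < 1 \<Longrightarrow> t < 1 \<Longrightarrow> cayley s \<le> cayley t \<longleftrightarrow> s \<le> t"
  unfolding cayley_def by (simp add: divide_simps algebra_simps)

lemma le_of_cayley_le: "v < 1 \<Longrightarrow> 0 < K \<Longrightarrow> cayley v \<le> K \<Longrightarrow> v \<le> (K - 1) / (K + 1)"
  unfolding cayley_def by (simp add: field_simps)

section \<open>Optimality of a pair on the boundary\<close>

text \<open>The first inequality is the lower bound on \<open>\<alpha>\<close> from \<open>\<mu> = m\<close>. The second one eliminates \<open>\<alpha>\<close> between
the conditions at \<open>m\<close> and at \<open>L = K m\<close>.\<close>

lemma rate_lt_imp:
  assumes v: "0 < v" and w: "rate_lt v m (K * m) \<alpha> \<beta>" and K: "0 < K"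
  shows "(1 - v) * (v - \<beta>) < v * (m * \<alpha>)" "(K - 1) * ((1 + \<beta>) * v) < (K + 1) * (v^2 + \<beta>)"
proof -
  define a where "a = m * \<alpha>"
  have 1: "1 + \<beta> - a < v + \<beta> / v" "K * a < 1 + \<beta> + (v + \<beta> / v)"
    using w unfolding rate_lt_def a_def by (auto simp: abs_less_iff algebra_simps)
  have c: "v * (v + \<beta> / v) = v^2 + \<beta>" using v by (simp add: field_simps power2_eq_square)
  have 2: "v * (1 + \<beta>) - v * a < v^2 + \<beta>"
    using mult_strict_left_mono[OF 1(1) v] unfolding c by (simp add: right_diff_distrib)
  then show "(1 - v) * (v - \<beta>) < v * (m * \<alpha>)" unfolding a_def[symmetric]
    by (simp add: algebra_simps power2_eq_square)
  have 3: "K * (v * a) < v * (1 + \<beta>) + (v^2 + \<beta>)"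
    using mult_strict_left_mono[OF 1(2) v] unfolding distrib_left[of v "1 + \<beta>"] c by (simp add: mult.left_commute)
  have "K * (v * (1 + \<beta>) - (v^2 + \<beta>)) < K * (v * a)" using 2 K by simp
  then show "(K - 1) * ((1 + \<beta>) * v) < (K + 1) * (v^2 + \<beta>)" using 3 by (simp add: algebra_simps)
qed

text \<open>On the first branch the conditions at \<open>m\<close> and \<open>L\<close> contradict each other: the claim is the
opposite of the second inequality of \<open>rate_lt_imp\<close>. The claim is affine in \<open>\<beta>\<close>, so it need only be
checked at \<open>\<beta> = 0\<close>, where it is the bound on \<open>v\<close>, and at the threshold \<open>t^2\<close>, where both
branches of \<open>alpha_bar\<close> agree and \<open>boundary_rate_ge\<close> applies.\<close>

lemma rate_not_lt_small_momentum:
  fixes k v \<beta> t :: real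
  assumes v: "0 < v" "v \<le> (k^2 - 1) / (k^2 + 1)" and k: "1 < k"
    and t: "t = k - sqrt (k^2 - 1)" and b: "boundary_rate_ge k v t" and \<beta>: "0 \<le> \<beta>" "\<beta> \<le> t^2" and v1: "v < 1"
  shows "(k^2 + 1) * (v^2 + \<beta>) \<le> (k^2 - 1) * ((1 + \<beta>) * v)"
proof -
  have k2: "1 < k^2" using k by simp
  have t0: "0 < t" "k * t < 1" using sqrt_k_bounds[OF k] unfolding t by auto
  have "t < 1"
  proof -
    have "1 * t \<le> k * t" using k t0 by (intro mult_right_mono) auto
    then show ?thesis using t0 by linarith
  qed
  then have p: "0 < (1 - t^2)^2" using sq_lt_1[of t] t0 by simp
  \<comment> \<open>The threshold satisfies t + 1/t = 2k; this is why the two branches meet there.\<close>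
  have tk: "1 + t^2 = 2 * k * t"
  proof -
    define h where "h = sqrt (k^2 - 1)"
    have "h^2 = k^2 - 1" unfolding h_def using k2 by simp
    then show ?thesis unfolding t h_def[symmetric] by Groebner_Basis.algebra
  qed
  have "2 * v * (1 - t^2)^2 * (1 + t^2) \<le> (1 - v) * (v - t^2) * ((1 + t^2) * (k^2 + 1) - 4 * t * k) * (1 + t^2)"
    using b unfolding boundary_rate_ge_def by (intro mult_right_mono) auto
  also have "\<dots> = (1 - v) * (v - t^2) * k^2 * (1 - t^2)^2" using tk by Groebner_Basis.algebra
  finally have "(2 * v * (1 + t^2)) * (1 - t^2)^2 \<le> ((1 - v) * (v - t^2) * k^2) * (1 - t^2)^2"
    by (simp only: mult_ac)
  then have "2 * v * (1 + t^2) \<le> (1 - v) * (v - t^2) * k^2" using p by (rule mult_right_le_imp_le)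
  then have bt: "k^2 * (v^2 + t^2) \<le> (k^2 - 2) * ((1 + t^2) * v)" by (simp add: algebra_simps power2_eq_square)
  have end1: "(k^2 + 1) * (v^2 + t^2) \<le> (k^2 - 1) * ((1 + t^2) * v)"
  proof -
    have "k^2 * ((k^2 + 1) * (v^2 + t^2)) \<le> (k^2 + 1) * ((k^2 - 2) * ((1 + t^2) * v))"
      using mult_left_mono[OF bt, of "k^2 + 1"] by (simp add: mult_ac)
    also have "\<dots> = k^2 * ((k^2 - 1) * ((1 + t^2) * v)) - 2 * ((1 + t^2) * v)" by Groebner_Basis.algebra
    also have "\<dots> \<le> k^2 * ((k^2 - 1) * ((1 + t^2) * v))" using v by simp
    finally show ?thesis by (rule mult_left_le_imp_le) (use k in simp)
  qed
  have end0: "(k^2 + 1) * v^2 \<le> (k^2 - 1) * v"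
  proof -
    have "0 < k^2 + 1" by (simp add: add_nonneg_pos)
    then have "(k^2 + 1) * v \<le> k^2 - 1" using v(2) by (simp add: pos_le_divide_eq mult.commute)
    then show ?thesis using mult_right_mono[of "(k^2 + 1) * v" "k^2 - 1" v] v(1) by (simp add: power2_eq_square mult.assoc)
  qed
  define \<theta> where "\<theta> = \<beta> / t^2"
  have th: "0 \<le> \<theta>" "\<theta> \<le> 1" "\<beta> = \<theta> * t^2" unfolding \<theta>_def using \<beta> t0 by simp_all
  have "(k^2 - 1) * ((1 + \<beta>) * v) - (k^2 + 1) * (v^2 + \<beta>) =
     (1 - \<theta>) * ((k^2 - 1) * v - (k^2 + 1) * v^2) + \<theta> * ((k^2 - 1) * ((1 + t^2) * v) - (k^2 + 1) * (v^2 + t^2))"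
    unfolding th(3) by Groebner_Basis.algebra
  also have "0 \<le> \<dots>" using th end0 end1 by (intro add_nonneg_nonneg mult_nonneg_nonneg) auto
  finally show ?thesis by simp
qed

lemma rate_not_lt:
  assumes m: "0 < m" and k: "1 < k" and v: "1 \<le> k * v" "v < 1" "v \<le> (k^2 - 1) / (k^2 + 1)"
    and b: "\<And>s. 0 \<le> s \<Longrightarrow> s \<le> v \<Longrightarrow> boundary_rate_ge k v s"
    and \<beta>: "0 \<le> \<beta>" and \<alpha>: "\<alpha> \<le> alpha_bar m (k^2 * m) \<beta>"
  shows "\<not> rate_lt v m (k^2 * m) \<alpha> \<beta>"
proof
  assume w: "rate_lt v m (k^2 * m) \<alpha> \<beta>"
  have v0: "0 < v" using zero_less_mult_pos[of k v] v(1) k by linarith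
  define s where "s = sqrt \<beta>"
  have s: "0 \<le> s" "s^2 = \<beta>" unfolding s_def using \<beta> by simp_all
  have "s^2 < v^2" using w s unfolding rate_lt_def by simp
  then have sv: "s < v" by (rule power_less_imp_less_base) (use v0 in simp)
  have K0: "0 < k^2" using k by simp
  note wi = rate_lt_imp[OF v0 w K0]
  have ma: "m * \<alpha> \<le> m * alpha_bar m (k^2 * m) (s^2)" using \<alpha> m s by simp
  show False
  proof (cases "second_branch k s")
    case True
    define D where "D = (1 + s^2) * (k^2 + 1) - 4 * s * k"
    have D: "0 < D" unfolding D_def using quartic_factor_pos[of s k] sv v k by simp
    have "m * \<alpha> \<le> 2 * (1 - s^2)^2 / D" using ma unfolding alpha_bar_scaled[OF m k s(1)] D_def using True by simp
    then have "D * (m * \<alpha>) \<le> 2 * (1 - s^2)^2" using D by (simp add: field_simps)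
    then have "v * (D * (m * \<alpha>)) \<le> v * (2 * (1 - s^2)^2)" using v0 by simp
    also have "\<dots> \<le> (1 - v) * (v - s^2) * D" using b[of s] s sv unfolding boundary_rate_ge_def D_def by simp
    finally have "D * (v * (m * \<alpha>)) \<le> D * ((1 - v) * (v - \<beta>))" unfolding s(2) by (simp add: mult_ac)
    then show False using wi(1) D by simp
  next
    case False
    define t where "t = k - sqrt (k^2 - 1)"
    have st: "s \<le> t" using False unfolding second_branch_def t_def by simp
    have t: "0 \<le> t" "k * t < 1" using sqrt_k_bounds[OF k] unfolding t_def by auto
    have "k * t \<le> k * v" using t v(1) by simp
    then have "t \<le> v" using k by simp
    have "\<beta> \<le> t^2" using st s power_mono[of s t 2] by simp
    have "(k^2 + 1) * (v^2 + \<beta>) \<le> (k^2 - 1) * ((1 + \<beta>) * v)"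
      by (rule rate_not_lt_small_momentum[OF v0 v(3) k t_def b[OF t(1) \<open>t \<le> v\<close>] \<beta> \<open>\<beta> \<le> t^2\<close> v(2)])
    then show False using wi(2) by simp
  qed
qed

text \<open>With \<open>\<alpha> = alpha_bar\<close> the condition at \<open>m\<close> is an equality by the choice of \<open>v\<close>. The condition at
\<open>L\<close> follows from \<open>(k^2 + 1) m \<alpha> \<le> 2 (1 + s^2)\<close>, which on the second branch is equivalent to
\<open>(k s - 1) (k - s) \<ge> 0\<close>.\<close>

lemma boundary_rate_le:
  assumes m: "0 < m" and k: "1 < k" and s: "1 \<le> k * s" "s \<le> v" and v: "v < 1"
    and eq: "2 * v * (1 - s^2)^2 = (1 - v) * (v - s^2) * ((1 + s^2) * (k^2 + 1) - 4 * s * k)"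
    and \<alpha>: "\<alpha> = alpha_bar m (k^2 * m) (s^2)"
  shows "0 < \<alpha>" "rate_le v m (k^2 * m) \<alpha> (s^2)"
    "circle_offset m (k^2 * m) \<alpha> (s^2) = - 2 * sqrt (s^2 * (k^2 * m) * m)"
proof -
  have sec: "second_branch k s" using second_branch_if_ge[OF k s(1)] .
  have s0: "0 < s" using zero_less_mult_pos[of k s] s(1) k by linarith
  have v0: "0 < v" using s0 s(2) by simp
  have s1: "s < 1" using s v by simp
  define D where "D = (1 + s^2) * (k^2 + 1) - 4 * s * k"
  have D: "0 < D" unfolding D_def using quartic_factor_pos[of s k] s v k by simp
  have aD: "m * \<alpha> = 2 * (1 - s^2)^2 / D" unfolding \<alpha> alpha_bar_scaled[OF m k less_imp_le[OF s0]] D_def using sec by simp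
  have p: "0 < (1 - s^2)^2" using sq_lt_1[of s] s0 s1 by simp
  have ma0: "0 < m * \<alpha>" unfolding aD using D p by simp
  then show "0 < \<alpha>" using m by (rule zero_less_mult_pos)
  have a: "m * \<alpha> = (1 - v) * (1 - s^2 / v)" unfolding \<alpha> using alpha_bar_equality(1)[OF m k s0 s(2) v sec eq] .
  then have am: "\<alpha> * m - 1 - s^2 = - (v + s^2 / v)" using v0 by (simp add: field_simps power2_eq_square)
  have r0: "0 \<le> v + s^2 / v" using v0 by simp
  have "(k^2 + 1) * (m * \<alpha>) \<le> 2 * (1 + s^2)"
  proof -
    have "(1 + s^2) * D - (k^2 + 1) * (1 - s^2)^2 = 4 * s * ((k * s - 1) * (k - s))" unfolding D_def by Groebner_Basis.algebra
    moreover have "0 \<le> 4 * s * ((k * s - 1) * (k - s))" using s0 s s1 k by simp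
    ultimately have "(k^2 + 1) * (1 - s^2)^2 \<le> (1 + s^2) * D" by linarith
    then show ?thesis unfolding aD using D by (simp add: field_simps)
  qed
  then have "\<alpha> * (k^2 * m) - 1 - s^2 \<le> v + s^2 / v" using am by (simp add: algebra_simps)
  moreover have "- (v + s^2 / v) \<le> \<alpha> * (k^2 * m) - 1 - s^2"
  proof -
    have "1 * (m * \<alpha>) \<le> k^2 * (m * \<alpha>)" using k ma0 by (intro mult_right_mono) auto
    then show ?thesis unfolding am[symmetric] by (simp add: mult_ac)
  qed
  moreover have "s^2 \<le> v^2" using s0 s(2) by (intro power_mono) auto
  ultimately show "rate_le v m (k^2 * m) \<alpha> (s^2)" unfolding rate_le_def using am r0 by (simp add: abs_le_iff)
  have r: "sqrt (s^2 * (k^2 * m) * m) = s * k * m"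
  proof -
    have "s^2 * (k^2 * m) * m = (s * k * m)^2" by Groebner_Basis.algebra
    then show ?thesis using m k s0 by simp
  qed
  have "(1 - s^2)^2 / \<alpha> = m * D / 2"
  proof -
    have "m * \<alpha> * D = 2 * (1 - s^2)^2" unfolding aD using D by simp
    then show ?thesis using \<open>0 < \<alpha>\<close> by (simp add: field_simps)
  qed
  then show "circle_offset m (k^2 * m) \<alpha> (s^2) = - 2 * sqrt (s^2 * (k^2 * m) * m)"
    unfolding circle_offset_def r D_def by (simp add: field_simps)
qed

lemma boundary_tuning:
  fixes m k s v :: real
  assumes m: "0 < m" and k: "1 < k" and s: "1 \<le> k * s" "s \<le> v" and v: "v < 1" "v \<le> (k^2 - 1) / (k^2 + 1)"
    and eq: "2 * v * (1 - s^2)^2 = (1 - v) * (v - s^2) * ((1 + s^2) * (k^2 + 1) - 4 * s * k)"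
    and b: "\<And>s. 0 \<le> s \<Longrightarrow> s \<le> v \<Longrightarrow> boundary_rate_ge k v s"
    and L: "L = k^2 * m" and n: "0 < n"
  shows "r_star n m L = v" "r_star_achieved_at n m L (alpha_bar m L (s^2)) (s^2)"
    "inf_sup_R_factor (F2 m L :: (real^'n \<Rightarrow> real) set) \<le> ereal v"
proof -
  have s0: "0 < s" using zero_less_mult_pos[of k s] s(1) k by linarith
  have mL: "m < L" unfolding L using m k by simp
  have s2: "0 < s^2" "s^2 < 1" using s0 s v sq_lt_1[of s] by auto
  have kv: "1 \<le> k * v" using s k mult_left_mono[of s v k] by linarith
  note bd = boundary_rate_le[OF m k s v(1) eq refl, folded L]
  note opt = optimal_tuning[OF m mL n, of v, OF _ bd(1) order_refl s2 bd(2)]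
  have v0: "0 < v" using s0 s by simp
  have nl: "\<not> rate_lt v m L \<alpha>' \<beta>'" if "\<alpha>' \<le> alpha_bar m L \<beta>'" "0 \<le> \<beta>'" for \<alpha>' \<beta>'
    using rate_not_lt[OF m k kv v b that(2)] that(1) unfolding L by blast
  have sq: "0 < sqrt (s^2 * L * m)" using s2 m mL by simp
  show "r_star n m L = v" "r_star_achieved_at n m L (alpha_bar m L (s^2)) (s^2)"
    "inf_sup_R_factor (F2 m L :: (real^'n \<Rightarrow> real) set) \<le> ereal v"
    by (rule opt[OF v0 nl], use bd(3) sq in simp_all)+
qed

section \<open>Small condition numbers\<close>

text \<open>The difference of the two sides of the second inequality of \<open>rate_lt_imp\<close> is affine in \<open>\<beta>\<close> and
vanishes at \<open>\<beta> = v^2\<close>, the bound for \<open>\<beta>\<close> in \<open>rate_lt\<close>.\<close>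

lemma small_kappa_rate_not_lt:
  assumes m: "0 < m" and k: "1 < k" and v: "v = (k - 1) / (k + 1)"
  shows "\<not> rate_lt v m (k^2 * m) \<alpha> \<beta>"
proof
  assume w: "rate_lt v m (k^2 * m) \<alpha> \<beta>"
  have v0: "0 < v" "v < 1" unfolding v using k by simp_all
  have kv: "v * (k + 1) = k - 1" unfolding v using k by simp
  have K0: "0 < k^2" using k by simp
  note wi = rate_lt_imp(2)[OF v0(1) w K0]
  have "(k + 1)^2 * ((k^2 + 1) * (v^2 + \<beta>) - (k^2 - 1) * ((1 + \<beta>) * v)) =
     - ((v^2 - \<beta>) * ((k + 1)^2 * (k^2 + 1 - (k^2 - 1) * v)))"
    using kv by Groebner_Basis.algebra
  moreover have "0 < v^2 - \<beta>" using w unfolding rate_lt_def by simp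
  moreover have "(k^2 - 1) * v \<le> (k^2 - 1) * 1" using v0 k by (intro mult_left_mono) auto
  then have "0 < k^2 + 1 - (k^2 - 1) * v" by (simp add: algebra_simps)
  then have "0 < (k + 1)^2 * (k^2 + 1 - (k^2 - 1) * v)" using k by (intro mult_pos_pos) auto
  ultimately have "(k + 1)^2 * ((k^2 + 1) * (v^2 + \<beta>) - (k^2 - 1) * ((1 + \<beta>) * v)) < 0"
    by (simp add: mult_pos_pos)
  then have "(k^2 + 1) * (v^2 + \<beta>) - (k^2 - 1) * ((1 + \<beta>) * v) < 0"
    using k by (simp add: mult_less_0_iff)
  then show False using wi by simp
qed

lemma small_kappa_rate_le:
  assumes m: "0 < m" and k: "1 < k" and v: "v = (k - 1) / (k + 1)" and \<alpha>: "\<alpha> = 4 / (m * (k + 1)^2)"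
  shows "rate_le v m (k^2 * m) \<alpha> (v^2)"
proof -
  have v0: "0 < v" unfolding v using k by simp
  have am: "\<alpha> * m = 4 / (k + 1)^2" "\<alpha> * (k^2 * m) = 4 * k^2 / (k + 1)^2" unfolding \<alpha> using m by simp_all
  have v2: "v^2 = (k - 1)^2 / (k + 1)^2" unfolding v power_divide ..
  have v': "v = (k - 1) * (k + 1) / (k + 1)^2" unfolding v using k by (simp add: power2_eq_square)
  have kk: "(k + 1)^2 \<noteq> 0" using k by simp
  have 1: "1 = (k + 1)^2 / (k + 1)^2" using kk by simp
  have "\<alpha> * m - 1 - v^2 = (4 - (k + 1)^2 - (k - 1)^2) / (k + 1)^2"
    unfolding am v2 diff_divide_distrib using kk by simp
  also have "\<dots> = - 2 * v" unfolding v' by (simp add: power2_eq_square algebra_simps)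
  finally have a: "\<alpha> * m - 1 - v^2 = - 2 * v" .
  have "\<alpha> * (k^2 * m) - 1 - v^2 = (4 * k^2 - (k + 1)^2 - (k - 1)^2) / (k + 1)^2"
    unfolding am v2 diff_divide_distrib using kk by simp
  also have "\<dots> = 2 * v" unfolding v' by (simp add: power2_eq_square algebra_simps)
  finally have b: "\<alpha> * (k^2 * m) - 1 - v^2 = 2 * v" .
  show ?thesis unfolding rate_le_def a b using v0 by (simp add: power2_eq_square)
qed

text \<open>The comparison with the second branch of \<open>alpha_bar\<close> and the lower bound for \<open>circle_offset\<close> both come
down to the sign of \<open>1 + 2 k - k^2\<close>, hence to
\<open>k \<le> 1 + sqrt 2\<close>.\<close>

lemma small_kappa_alpha_bar:
  assumes m: "0 < m" and k: "1 < k" "k \<le> 1 + sqrt 2" and v: "v = (k - 1) / (k + 1)" and \<alpha>: "\<alpha> = 4 / (m * (k + 1)^2)"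
  shows "\<alpha> \<le> alpha_bar m (k^2 * m) (v^2)" "k < 1 + sqrt 2 \<Longrightarrow> \<alpha> < alpha_bar m (k^2 * m) (v^2)"
    "- 2 * sqrt (v^2 * (k^2 * m) * m) \<le> circle_offset m (k^2 * m) \<alpha> (v^2)"
    "circle_offset m (k^2 * m) \<alpha> (v^2) < 2 * sqrt (v^2 * (k^2 * m) * m)"
proof -
  have v0: "0 < v" "v < 1" unfolding v using k by simp_all
  have kv: "v * (k + 1) = k - 1" unfolding v using k by simp
  have am: "m * \<alpha> = 4 / (k + 1)^2" unfolding \<alpha> using m by simp
  have k2: "k^2 - 1 - 2 * k \<le> 0" "k < 1 + sqrt 2 \<Longrightarrow> k^2 - 1 - 2 * k < 0"
  proof -
    have e: "k^2 - 1 - 2 * k = (k - 1)^2 - (sqrt 2)^2" by (simp add: power2_eq_square algebra_simps)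
    have "(k - 1)^2 \<le> (sqrt 2)^2" using k by (intro power_mono) auto
    then show "k^2 - 1 - 2 * k \<le> 0" unfolding e by simp
    assume "k < 1 + sqrt 2"
    then have "(k - 1)^2 < (sqrt 2)^2" using k by (intro power_strict_mono) auto
    then show "k^2 - 1 - 2 * k < 0" unfolding e by simp
  qed
  have P: "0 < (k + 1)^2" using k by simp
  have v2: "(k + 1)^2 * (1 - v^2) = 4 * k" "(k + 1)^2 * (1 + v^2) = 2 * (k^2 + 1)" "(k + 1)^2 * v = (k - 1) * (k + 1)"
    using kv by Groebner_Basis.algebra+
  define D where "D = (1 + v^2) * (k^2 + 1) - 4 * v * k"
  have D0: "0 < D" unfolding D_def using quartic_factor_pos[of v k] v0 k by simp
  define X where "X = 2 * (1 - v^2)^2 * (k + 1)^2 - 4 * D"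
  have X: "X * (k + 1)^2 = 8 * ((k^2 - 1) * (1 + 2 * k - k^2))"
    unfolding X_def D_def using v2 by Groebner_Basis.algebra
  have k1: "0 < k^2 - 1" using k by simp
  have X0: "0 \<le> X" 
    by (rule nonneg_cancel[OF P]) (unfold X, use k1 k2(1) in simp)
  have X1: "0 < X" if "k < 1 + sqrt 2"
  proof -
    have "0 < X * (k + 1)^2" unfolding X using k1 k2(2)[OF that] by simp
    then show ?thesis using P by (rule zero_less_mult_pos2)
  qed
  have 2: "4 / (k + 1)^2 \<le> 2 * (1 - v^2)^2 / D" using X0 D0 P unfolding X_def by (simp add: field_simps)
  have 3: "4 / (k + 1)^2 < 2 * (1 - v^2)^2 / D" if "k < 1 + sqrt 2"
    using X1[OF that] D0 P unfolding X_def by (simp add: field_simps)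
  have 4: "4 / (k + 1)^2 < 2 * (1 + v^2) / k^2"
  proof -
    have "4 * k^2 < 2 * ((k + 1)^2 * (1 + v^2))" unfolding v2 by simp
    then show ?thesis using P k by (simp add: field_simps)
  qed
  have "m * \<alpha> \<le> m * alpha_bar m (k^2 * m) (v^2)"
    unfolding am alpha_bar_scaled[OF m k(1) less_imp_le[OF v0(1)]] D_def[symmetric] using 2 4 by auto
  then show "\<alpha> \<le> alpha_bar m (k^2 * m) (v^2)" using m by simp
  show "\<alpha> < alpha_bar m (k^2 * m) (v^2)" if "k < 1 + sqrt 2"
  proof -
    have "m * \<alpha> < m * alpha_bar m (k^2 * m) (v^2)"
      unfolding am alpha_bar_scaled[OF m k(1) less_imp_le[OF v0(1)]] D_def[symmetric] using 3[OF that] 4 by auto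
    then show ?thesis using m by simp
  qed
  have r: "sqrt (v^2 * (k^2 * m) * m) = v * k * m"
  proof -
    have "v^2 * (k^2 * m) * m = (v * k * m)^2" by Groebner_Basis.algebra
    then show ?thesis using m k v0 by simp
  qed
  have "(1 - v^2)^2 / \<alpha> = m * ((1 - v^2)^2 * (k + 1)^2) / 4" unfolding \<alpha> using m by simp
  also have "\<dots> = m * (X + 4 * D) / 8" unfolding X_def by simp
  finally have q: "circle_offset m (k^2 * m) \<alpha> (v^2) = m * X / 8 - 2 * (v * k * m)"
    unfolding circle_offset_def D_def by (simp add: field_simps)
  show "- 2 * sqrt (v^2 * (k^2 * m) * m) \<le> circle_offset m (k^2 * m) \<alpha> (v^2)"
    unfolding q r using X0 m by simp
  have "X < 32 * (v * k)"
  proof -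
    have "(32 * (v * k) - X) * (k + 1)^2 = 8 * (k^2 - 1) * (k^2 - 1 + 2 * k)"
      using X v2(3) by Groebner_Basis.algebra
    moreover have "0 < 8 * (k^2 - 1) * (k^2 - 1 + 2 * k)"
      using k1 k by (intro mult_pos_pos add_pos_pos) auto
    ultimately have "0 < 32 * (v * k) - X" using P by (metis zero_less_mult_pos2)
    then show ?thesis by simp
  qed
  then have "m * X < m * (32 * (v * k))" using m by simp
  then show "circle_offset m (k^2 * m) \<alpha> (v^2) < 2 * sqrt (v^2 * (k^2 * m) * m)"
    unfolding q r by (simp add: algebra_simps)
qed

lemma small_kappa:
  fixes m k :: real
  assumes m: "0 < m" and k: "1 < k" "k \<le> 1 + sqrt 2" and v: "v = (k - 1) / (k + 1)"
    and \<alpha>: "\<alpha> = 4 / (m * (k + 1)^2)" and L: "L = k^2 * m" and n: "0 < n"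
  shows "r_star n m L = v" "r_star_achieved_at n m L \<alpha> (v^2)"
    "inf_sup_R_factor (F2 m L :: (real^'n \<Rightarrow> real) set) \<le> ereal v"
    "k < 1 + sqrt 2 \<Longrightarrow> \<alpha> < alpha_bar m L (v^2)"
proof -
  have v0: "0 < v" "v < 1" unfolding v using k by simp_all
  have v2: "0 < v^2" "v^2 < 1" using v0 sq_lt_1[of v] by auto
  have mL: "m < L" unfolding L using m k by simp
  have \<alpha>0: "0 < \<alpha>" unfolding \<alpha> using m k by simp
  note ab = small_kappa_alpha_bar[OF m k v \<alpha>, folded L]
  note opt = optimal_tuning[OF m mL n v0(1) \<alpha>0 ab(1) v2 small_kappa_rate_le[OF m k(1) v \<alpha>, folded L]
      small_kappa_rate_not_lt[OF m k(1) v, folded L] ab(3,4)]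
  show "r_star n m L = v" "r_star_achieved_at n m L \<alpha> (v^2)"
    "inf_sup_R_factor (F2 m L :: (real^'n \<Rightarrow> real) set) \<le> ereal v"
    by (rule opt)+
  show "k < 1 + sqrt 2 \<Longrightarrow> \<alpha> < alpha_bar m L (v^2)" by (rule ab(2))
qed

lemma kappa0_le_iff: assumes "0 < k" shows "k^2 \<le> kappa0 \<longleftrightarrow> k \<le> 1 + sqrt 2" "kappa0 \<le> k^2 \<longleftrightarrow> 1 + sqrt 2 \<le> k"
proof -
  have "kappa0 = (1 + sqrt 2)^2" unfolding kappa0_def by (simp add: power2_eq_square algebra_simps)
  moreover have "0 \<le> 1 + sqrt 2" by simp
  ultimately show "k^2 \<le> kappa0 \<longleftrightarrow> k \<le> 1 + sqrt 2" "kappa0 \<le> k^2 \<longleftrightarrow> 1 + sqrt 2 \<le> k"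
    using assms power_mono_iff[of k "1 + sqrt 2" 2] power_mono_iff[of "1 + sqrt 2" k 2] by simp_all
qed

section \<open>The point of tangency\<close>

text \<open>For \<open>a = W cosh p\<close>, \<open>b = W sinh p\<close>, \<open>C = cosh u\<close>, \<open>S = sinh u\<close> this is
\<open>cosh (u - p) \<ge> 1\<close>.\<close>

lemma product_ge_hyperbolic:
  fixes a b C S W :: real
  assumes "a^2 - b^2 = W^2" "C^2 - S^2 = 1" "0 \<le> a" "0 \<le> b" "0 \<le> C" "0 \<le> S"
  shows "W \<le> C * a - S * b"
proof -
  have "b \<le> a" "S \<le> C" using assms
    by (smt (verit) power2_le_imp_le zero_le_power2)+
  then have nn: "0 \<le> C * a - S * b" using assms by (simp add: mult_mono)
  have "(C * a - S * b)^2 = W^2 + (C * b - S * a)^2"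
    using assms(1,2) by Groebner_Basis.algebra
  then have "W^2 \<le> (C * a - S * b)^2" by simp
  then show ?thesis using nn by (rule power2_le_imp_le)
qed

text \<open>The first factor on the right is \<open>w1 w2 (cosh (u - u\<^sub>0) - 1)\<close> for the point \<open>u\<^sub>0\<close> with
\<open>cosh u\<^sub>0 = z (z^2 + 3) / (w1 w2)\<close> and \<open>sinh u\<^sub>0 = 2 (z^2 + 1) / (w1 w2)\<close>: it has a double zero
at \<open>u\<^sub>0\<close>. The value of \<open>T\<close> and the point \<open>u\<^sub>0\<close> solve the two equations of tangency; once a double
zero is known, the cofactor linear in \<open>C\<close> and \<open>S\<close> is found by comparing coefficients modulo
\<open>C^2 - S^2 = 1\<close>.\<close>

lemma gap_factorization:
  fixes z w1 w2 T C S :: real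
  assumes z: "z \<noteq> 0" and w1: "w1^2 = z^2 - 1" and w2: "w2^2 = z^4 + 3 * z^2 + 4"
    and T: "T * w1 = z * w2" and CS: "C^2 - S^2 = 1"
  shows "gap (z + 2 / z) T C S * (z^2 * w1^2) =
    (C * (z * (z^2 + 3)) - S * (2 * (z^2 + 1)) - w1 * w2) *
    ((z^2 + 1) * (w1 * w2) - z * (z^2 + 1) * C - 2 * S)"
proof -
  define W where "W = w1 * w2"
  have W2: "W^2 = (z^2 - 1) * (z^4 + 3 * z^2 + 4)"
    unfolding W_def power_mult_distrib w1 w2 ..
  have TW: "T * w1^2 = z * W" using T unfolding W_def by (simp add: power2_eq_square)
  have TT: "(T^2 - 1) * w1^2 = z^2 * (z^4 + 3 * z^2 + 4) - (z^2 - 1)"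
    using arg_cong[OF T, of "\<lambda>x. x^2"] by (simp add: power_mult_distrib w1 w2 algebra_simps)
  have k: "z^2 * ((z + 2 / z)^2 + 1) = z^4 + 5 * z^2 + 4" "z^2 * (2 * (z + 2 / z)) = 2 * z * (z^2 + 2)"
    using z by (simp_all add: field_simps power2_eq_square power4_eq_xxxx)
  have "gap (z + 2 / z) T C S * (z^2 * w1^2) =
     (T * w1^2 - w1^2 * C) * ((z^2 * ((z + 2 / z)^2 + 1)) * C - (z^2 * (2 * (z + 2 / z))) * S) - z^2 * ((T^2 - 1) * w1^2)"
    unfolding gap_def by Groebner_Basis.algebra
  also have "\<dots> = (z * W - (z^2 - 1) * C) * ((z^4 + 5 * z^2 + 4) * C - (2 * z * (z^2 + 2)) * S)
       - z^2 * (z^2 * (z^4 + 3 * z^2 + 4) - (z^2 - 1))"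
    unfolding k TW TT unfolding w1 ..
  also have "\<dots> = (C * (z * (z^2 + 3)) - S * (2 * (z^2 + 1)) - W) * ((z^2 + 1) * W - z * (z^2 + 1) * C - 2 * S)"
    using W2 CS by Groebner_Basis.algebra
  finally show ?thesis unfolding W_def .
qed

text \<open>The solution \<open>T\<close> of the tangency equations for \<open>k = z + 2 / z\<close>.\<close>

definition tangency_T :: "real \<Rightarrow> real" where
  "tangency_T z = z * sqrt (z^4 + 3 * z^2 + 4) / sqrt (z^2 - 1)"

definition tangency_w :: "real \<Rightarrow> real" where
  "tangency_w z = sqrt ((z^2 - 1) * (z^4 + 3 * z^2 + 4))"

lemma tangency_w_sq: "1 < z \<Longrightarrow> (tangency_w z)^2 = (z^2 - 1) * (z^4 + 3 * z^2 + 4)"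
  unfolding tangency_w_def by (simp add: add_nonneg_nonneg)

lemma tangency_w_pos: assumes "1 < z" shows "0 < tangency_w z"
proof -
  have "1 < z^2" using assms by simp
  moreover have "0 < z^4 + 3 * z^2 + 4" by (simp add: add_nonneg_pos)
  ultimately show ?thesis unfolding tangency_w_def by simp
qed

lemma tangency_T_pos: "1 < z \<Longrightarrow> 0 < tangency_T z"
  unfolding tangency_T_def by (simp add: add_pos_pos)

lemma tangency_T_w: assumes "1 < z" shows "tangency_T z * tangency_w z = z * (z^4 + 3 * z^2 + 4)"
proof -
  have "1 < z^2" using assms by simp
  then show ?thesis unfolding tangency_T_def tangency_w_def
    by (simp add: real_sqrt_mult add_pos_pos)
qed

lemma tangency_T_sq: assumes "1 < z" shows "((tangency_T z)^2 - 1) * (z^2 - 1) = (z^2 + 1)^3"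
proof -
  have z: "1 < z^2" using assms by simp
  then have "(tangency_T z)^2 * (z^2 - 1) = z^2 * (z^4 + 3 * z^2 + 4)"
    unfolding tangency_T_def power_mult_distrib power_divide by (simp add: add_nonneg_nonneg)
  then show ?thesis by Groebner_Basis.algebra
qed

lemma tangency_T_gt_1: assumes "1 < z" shows "1 < tangency_T z"
proof -
  have "1 < z^2" using assms by simp
  moreover have "0 < (z^2 + 1)^3" by (simp add: add_nonneg_pos)
  ultimately have "0 < (tangency_T z)^2 - 1" using tangency_T_sq[OF assms] by (metis diff_gt_0_iff_gt zero_less_mult_pos2)
  then show ?thesis using tangency_T_pos[OF assms] by (simp add: power2_eq_square) (smt (verit) mult_le_one)
qed

lemma gap_at_tangency:
  fixes z C S :: real
  assumes z: "1 < z" and CS: "C^2 - S^2 = 1"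
  shows "gap (z + 2 / z) (tangency_T z) C S * (z^2 * (z^2 - 1)) =
    (C * (z * (z^2 + 3)) - S * (2 * (z^2 + 1)) - tangency_w z) *
    ((z^2 + 1) * tangency_w z - z * (z^2 + 1) * C - 2 * S)"
proof -
  have z2: "1 < z^2" using z by simp
  have "tangency_w z = sqrt (z^2 - 1) * sqrt (z^4 + 3 * z^2 + 4)"
    unfolding tangency_w_def by (rule real_sqrt_mult)
  moreover have "tangency_T z * sqrt (z^2 - 1) = z * sqrt (z^4 + 3 * z^2 + 4)"
    unfolding tangency_T_def using z2 by simp
  ultimately show ?thesis
    using gap_factorization[of z "sqrt (z^2 - 1)" "sqrt (z^4 + 3 * z^2 + 4)" "tangency_T z" C S] z z2 CS
    by (simp add: add_nonneg_nonneg)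
qed

definition tangency_rate :: "real \<Rightarrow> real" where "tangency_rate z = (tangency_T z - 1) / (tangency_T z + 1)"

lemma tangency_rate_bounds: assumes "1 < z" shows "0 < tangency_rate z" "tangency_rate z < 1"
  using tangency_T_gt_1[OF assms] unfolding tangency_rate_def by (auto simp: field_simps)

text \<open>In the factorization the first factor is nonnegative and the second is decreasing in \<open>s\<close>, so
only its value at the end \<open>s = v\<close> matters. That value is a positive multiple of
\<open>(z^2 + 1) (z - 1)^2 - 2\<close>.\<close>

lemma boundary_rate_ge_tangency:
  assumes z: "1 < z" and cross: "2 \<le> (z^2 + 1) * (z - 1)^2" and s: "0 \<le> s" "s \<le> tangency_rate z"
  shows "boundary_rate_ge (z + 2 / z) (tangency_rate z) s"
proof -
  let ?v = "tangency_rate z" and ?T = "tangency_T z" and ?W = "tangency_w z"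
  note v = tangency_rate_bounds[OF z]
  have s1: "s < 1" using s v by simp
  have cayley: "cayley ?v = ?T" unfolding tangency_rate_def by (rule cayley_inverse[OF tangency_T_gt_1[OF z]])
  have T: "0 < ?T" using tangency_T_pos[OF z] .
  have z2: "1 < z^2" using z by simp
  have CSv: "2 * ?T * ch ?v = ?T^2 + 1" "2 * ?T * sh ?v = ?T^2 - 1"
  proof -
    have "(ch ?v + sh ?v) * ?T = ?T * ?T" "(ch ?v - sh ?v) * ?T = 1"
      using ch_plus_sh[of ?v] ch_minus_sh[of ?v] v cayley by simp_all
    then have "?T * ch ?v + ?T * sh ?v = ?T * ?T" "?T * ch ?v - ?T * sh ?v = 1"
      by (simp_all add: algebra_simps)
    then show "2 * ?T * ch ?v = ?T^2 + 1" "2 * ?T * sh ?v = ?T^2 - 1"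
      unfolding power2_eq_square by linarith+
  qed
  have pos: "0 \<le> ch s" "0 \<le> sh s"
    using s s1 sq_lt_1[of s] unfolding ch_def sh_def by (auto intro!: divide_nonneg_nonneg)
  have fac1: "?W \<le> ch s * (z * (z^2 + 3)) - sh s * (2 * (z^2 + 1))"
  proof (rule product_ge_hyperbolic)
    show "(z * (z^2 + 3))^2 - (2 * (z^2 + 1))^2 = ?W^2"
      unfolding tangency_w_sq[OF z] by Groebner_Basis.algebra
  qed (use ch_sh[of s] s s1 z pos in \<open>auto intro!: mult_nonneg_nonneg add_nonneg_nonneg\<close>)
  have "0 \<le> (z^2 + 1) * ((z^2 + 1) * (z - 1)^2 - 2) * (z^3 + 2 * z^2 + 3 * z + 2)"
    using cross z by (intro mult_nonneg_nonneg add_nonneg_nonneg) auto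
  also have "\<dots> = (z^2 - 1) * (2 * ?T * (z^2 + 1) * ?W - z * (z^2 + 1) * (?T^2 + 1) - 2 * (?T^2 - 1))"
    using tangency_T_sq[OF z] tangency_T_w[OF z] by Groebner_Basis.algebra
  also have "\<dots> = (z^2 - 1) * (2 * ?T) * ((z^2 + 1) * ?W - z * (z^2 + 1) * ch ?v - 2 * sh ?v)"
    using CSv by Groebner_Basis.algebra
  finally have "0 \<le> (z^2 + 1) * ?W - z * (z^2 + 1) * ch ?v - 2 * sh ?v"
    unfolding mult.commute[of "(z^2 - 1) * (2 * ?T)"]
    by (rule nonneg_cancel[rotated]) (use z2 T in simp)
  moreover have "z * (z^2 + 1) * ch s \<le> z * (z^2 + 1) * ch ?v"
    using ch_mono[of s ?v] s v z by (intro mult_left_mono) auto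
  moreover have "sh s \<le> sh ?v" using sh_mono[of s ?v] s v by auto
  ultimately have fac2: "0 \<le> (z^2 + 1) * ?W - z * (z^2 + 1) * ch s - 2 * sh s" by simp
  have "0 \<le> gap (z + 2 / z) ?T (ch s) (sh s) * (z^2 * (z^2 - 1))"
    unfolding gap_at_tangency[OF z ch_sh[OF s(1) s1]] using fac1 fac2 by simp
  then have "0 \<le> gap (z + 2 / z) ?T (ch s) (sh s)"
    by (rule nonneg_cancel[rotated]) (use z z2 in simp)
  then show ?thesis using boundary_rate_ge_iff_gap[of ?v s] v s s1 cayley by simp
qed

text \<open>The \<open>s\<close> of the point of tangency, that is, the square root of \<open>beta0\<close>.\<close>

definition tangency_s :: "real \<Rightarrow> real" where
  "tangency_s z = (z * (z^2 + 3) - tangency_w z) / (2 * (z^2 + 1))"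

lemma hyperbola_point:
  fixes a b W :: real
  assumes ab: "a^2 - b^2 = W^2" and pos: "0 < a" "0 < b" "0 < W"
  shows "0 < (a - W) / b" "(a - W) / b < 1" "ch ((a - W) / b) = a / W" "sh ((a - W) / b) = b / W"
proof -
  define s where "s = (a - W) / b"
  have bs: "b * s = a - W" using pos unfolding s_def by simp
  have "0 < (a - W) * (a + W)" using ab pos
    by (metis add.commute add_diff_cancel_right' diff_add_cancel power2_eq_square square_diff_square_factored
        zero_less_power mult.commute)
  then have aW: "0 < a - W" using pos by (simp add: zero_less_mult_iff)
  then show s0: "0 < (a - W) / b" using pos by simp
  have "(a - W)^2 < b^2"
  proof -
    have "b^2 - (a - W)^2 = 2 * W * (a - W)" using ab by Groebner_Basis.algebra
    moreover have "0 < 2 * W * (a - W)" using aW pos by simp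
    ultimately show ?thesis by simp
  qed
  then have "a - W < b" using pos by (meson power_less_imp_less_base less_imp_le)
  then show s1: "(a - W) / b < 1" using pos by simp
  have p: "0 < 1 - s^2" using sq_lt_1[of s] s0 s1 unfolding s_def by simp
  have "(1 + s^2) * W * b^2 = a * (1 - s^2) * b^2" using ab bs by Groebner_Basis.algebra
  then have "(1 + s^2) * W = a * (1 - s^2)" using pos by simp
  then show "ch ((a - W) / b) = a / W" unfolding ch_def s_def[symmetric]
    using p pos by (simp add: frac_eq_eq)
  have "2 * s * W * b = b * (1 - s^2) * b" using ab bs by Groebner_Basis.algebra
  then have "2 * s * W = b * (1 - s^2)" using pos by simp
  then show "sh ((a - W) / b) = b / W" unfolding sh_def s_def[symmetric]
    using p pos by (simp add: frac_eq_eq)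
qed

lemma tangency_s_props:
  assumes z: "1 < z"
  shows "0 < tangency_s z" "tangency_s z < 1" "ch (tangency_s z) = z * (z^2 + 3) / tangency_w z" "sh (tangency_s z) = 2 * (z^2 + 1) / tangency_w z"
proof -
  have "(z * (z^2 + 3))^2 - (2 * (z^2 + 1))^2 = (tangency_w z)^2"
    unfolding tangency_w_sq[OF z] by (simp add: algebra_simps eval_nat_numeral)
  moreover have "0 < z * (z^2 + 3)" "0 < 2 * (z^2 + 1)"
    using z by (auto intro!: mult_pos_pos add_nonneg_pos)
  ultimately show "0 < tangency_s z" "tangency_s z < 1" "ch (tangency_s z) = z * (z^2 + 3) / tangency_w z" "sh (tangency_s z) = 2 * (z^2 + 1) / tangency_w z"
    using hyperbola_point[of "z * (z^2 + 3)" "2 * (z^2 + 1)" "tangency_w z"] tangency_w_pos[OF z]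
    unfolding tangency_s_def by simp_all
qed

lemma gap_tangency_s:
  assumes z: "1 < z"
  shows "gap (z + 2 / z) (tangency_T z) (ch (tangency_s z)) (sh (tangency_s z)) = 0"
proof -
  have "ch (tangency_s z) * (z * (z^2 + 3)) - sh (tangency_s z) * (2 * (z^2 + 1)) = tangency_w z"
  proof -
    have "z * (z^2 + 3) * (z * (z^2 + 3)) - 2 * (z^2 + 1) * (2 * (z^2 + 1)) = tangency_w z * tangency_w z"
      using tangency_w_sq[OF z] by Groebner_Basis.algebra
    then show ?thesis unfolding tangency_s_props[OF z] using tangency_w_pos[OF z]
      by (simp add: diff_divide_distrib[symmetric])
  qed
  then have "gap (z + 2 / z) (tangency_T z) (ch (tangency_s z)) (sh (tangency_s z)) * (z^2 * (z^2 - 1)) = 0"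
    unfolding gap_at_tangency[OF z ch_sh[OF less_imp_le[OF tangency_s_props(1)[OF z]] tangency_s_props(2)[OF z]]] by simp
  moreover have "1 < z^2" using z by simp
  ultimately show ?thesis using z by simp
qed

text \<open>Equivalent to \<open>(k^2 + 1) sh s \<ge> 2 k ch s\<close>, that is, the derivative of
\<open>(k^2 + 1) cosh u - 2 k sinh u\<close> is nonnegative at the point of tangency.\<close>

lemma tangency_s_ge: assumes z: "1 < z" shows "1 \<le> (z + 2 / z) * tangency_s z"
proof -
  let ?k = "z + 2 / z" and ?s = "tangency_s z"
  note s = tangency_s_props[OF z] and W = tangency_w_pos[OF z]
  have p: "0 < 1 - ?s^2" using sq_lt_1[of ?s] s by simp
  have k: "z^2 * (?k^2 + 1) = z^4 + 5 * z^2 + 4" "z^2 * (2 * ?k) = 2 * z * (z^2 + 2)"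
    using z by (simp_all add: field_simps power2_eq_square power4_eq_xxxx)
  have "z^2 * ((?k^2 + 1) * (2 * (z^2 + 1)) - 2 * ?k * (z * (z^2 + 3))) = 2 * (z^4 + 3 * z^2 + 4)"
    using k by Groebner_Basis.algebra
  moreover have "0 < 2 * (z^4 + 3 * z^2 + 4)" by (simp add: add_nonneg_pos)
  ultimately have "0 < (?k^2 + 1) * (2 * (z^2 + 1)) - 2 * ?k * (z * (z^2 + 3))"
    by (metis zero_le_power2 zero_less_mult_pos less_le mult_zero_left)
  then have "0 < ((?k^2 + 1) * (2 * (z^2 + 1)) - 2 * ?k * (z * (z^2 + 3))) / tangency_w z" using W by simp
  also have "\<dots> = (?k^2 + 1) * sh ?s - 2 * ?k * ch ?s"
    unfolding s by (simp add: diff_divide_distrib)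
  also have "\<dots> = 2 * ((?k * ?s - 1) * (?k - ?s)) / (1 - ?s^2)"
    unfolding ch_def sh_def times_divide_eq_right diff_divide_distrib[symmetric]
    by (rule arg_cong[of _ _ "\<lambda>x. x / _"]) Groebner_Basis.algebra
  finally have "0 < (?k * ?s - 1) * (?k - ?s)" using p by (simp add: zero_less_divide_iff mult.commute)
  moreover have "0 < ?k - ?s" using s z by (smt (verit) divide_pos_pos)
  ultimately show ?thesis by (simp add: zero_less_mult_iff)
qed

lemma tangency_s_le_rate: assumes z: "1 < z" shows "tangency_s z \<le> tangency_rate z"
proof -
  note s = tangency_s_props[OF z] and W = tangency_w_pos[OF z] and v = tangency_rate_bounds[OF z]
  have "cayley (tangency_s z) = (z * (z^2 + 3) + 2 * (z^2 + 1)) / tangency_w z"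
    using ch_plus_sh[of "tangency_s z"] s by (simp add: add_divide_distrib)
  also have "\<dots> \<le> z * (z^4 + 3 * z^2 + 4) / tangency_w z"
  proof (rule divide_right_mono)
    have "1 * 1 \<le> z * z^2" using z by (intro mult_mono) auto
    then have "0 \<le> (z^2 + 1) * (z * (z^2 + 1) - 2)" using z
      by (intro mult_nonneg_nonneg) (auto simp: algebra_simps)
    also have "\<dots> = z * (z^4 + 3 * z^2 + 4) - (z * (z^2 + 3) + 2 * (z^2 + 1))" by Groebner_Basis.algebra
    finally show "z * (z^2 + 3) + 2 * (z^2 + 1) \<le> z * (z^4 + 3 * z^2 + 4)" by simp
  qed (use W in simp)
  also have "\<dots> = tangency_T z" using tangency_T_w[OF z] W by (simp add: field_simps)
  also have "\<dots> = cayley (tangency_rate z)" unfolding tangency_rate_def using cayley_inverse[OF tangency_T_gt_1[OF z]] by simp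
  finally show ?thesis using cayley_le_iff s v by simp
qed

lemma tangency_rate_le: assumes z: "1 < z" "2 \<le> z^2"
  shows "tangency_rate z \<le> ((z + 2 / z)^2 - 1) / ((z + 2 / z)^2 + 1)"
proof -
  let ?K = "(z + 2 / z)^2"
  have zK: "z^2 * ?K = (z^2 + 2)^2"
    using z by (simp add: field_simps power2_eq_square)
  have "(tangency_T z)^2 * (z^4 * (z^2 - 1)) \<le> ?K^2 * (z^4 * (z^2 - 1))"
  proof -
    have eq: "(tangency_T z)^2 * (z^4 * (z^2 - 1)) = (z^2)^3 * ((z^2)^2 + 3 * z^2 + 4)"
      using tangency_T_sq[OF z(1)] by Groebner_Basis.algebra
    have "?K^2 * (z^4 * (z^2 - 1)) = (z^2 + 2)^4 * (z^2 - 1)" using zK by Groebner_Basis.algebra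
    moreover have "y^3 * (y^2 + 3 * y + 4) \<le> (y + 2)^4 * (y - 1)" if "2 \<le> y" for y :: real
    proof -
      have "(y + 2)^4 * (y - 1) - y^3 * (y^2 + 3 * y + 4) = 4 * y^4 + 12 * y^3 + (8 * y * (y - 2) - 16)"
        by Groebner_Basis.algebra
      moreover have "0 \<le> 8 * y * (y - 2)" "16 \<le> y^4"
        using that power_mono[of 2 y 4] by auto
      ultimately show ?thesis using that by (smt (verit) zero_le_power)
    qed
    ultimately show ?thesis using z(2) eq by metis
  qed
  moreover have "0 < z^4 * (z^2 - 1)" using z by auto
  ultimately have "(tangency_T z)^2 \<le> ?K^2" by (simp only: mult_le_cancel_right_pos)
  then have "tangency_T z \<le> ?K" by (rule power2_le_imp_le) simp
  moreover have "(t - 1) / (t + 1) \<le> (K - 1) / (K + 1)" if "0 < t" "t \<le> K" for t K :: real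
    using that by (simp add: field_simps)
  ultimately show ?thesis unfolding tangency_rate_def using tangency_T_pos[OF z(1)] by blast
qed

lemma tangency_rate_equality:
  assumes z: "1 < z"
  shows "2 * tangency_rate z * (1 - (tangency_s z)^2)^2 =
    (1 - tangency_rate z) * (tangency_rate z - (tangency_s z)^2) * ((1 + (tangency_s z)^2) * ((z + 2 / z)^2 + 1) - 4 * tangency_s z * (z + 2 / z))"
proof -
  have "cayley (tangency_rate z) = tangency_T z" unfolding tangency_rate_def by (rule cayley_inverse[OF tangency_T_gt_1[OF z]])
  then show ?thesis
    using gap_eq_0_iff[of "tangency_rate z" "tangency_s z" "z + 2 / z"] gap_tangency_s[OF z] tangency_s_props[OF z] tangency_rate_bounds[OF z] by simp
qed

text \<open>For \<open>\<kappa> = (z + 2 / z)^2\<close> the inner root of \<open>beta0\<close> is \<open>(z^2 - 2) / (z^2 + 2)\<close>, and twice the outer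
radicand is the square of a rational function times \<open>(z^2 - 1) (z^4 + 3 z^2 + 4)\<close>.\<close>

lemma beta0_eq: assumes z: "1 < z" "2 \<le> z^2"
  shows "beta0 ((z + 2 / z)^2) = (tangency_s z)^2"
proof -
  define y where "y = z^2"
  define K where "K = (z + 2 / z)^2"
  define W where "W = tangency_w z"
  have y: "2 \<le> y" "0 < y" using z unfolding y_def by auto
  have K: "K = (y + 2)^2 / y" unfolding K_def y_def using z by (simp add: field_simps power2_eq_square)
  have g: "0 < y^2 + 3 * y + 4" using y by (simp add: add_pos_pos)
  have W2: "W^2 = (y - 1) * (y^2 + 3 * y + 4)" unfolding W_def tangency_w_sq[OF z(1)] y_def by simp
  have W0: "0 < W" unfolding W_def using tangency_w_pos[OF z(1)] .
  have "(K - 8) / K = ((y - 2) / (y + 2))^2"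
    unfolding K using y by (simp add: divide_simps) ( Groebner_Basis.algebra)
  then have s: "sqrt ((K - 8) / K) = (y - 2) / (y + 2)" using y by simp
  have "2 * ((K - 1) * (((y - 2) / (y + 2) + 1) * K^2 + (7 * ((y - 2) / (y + 2)) - 5) * K + 12) / K^3)
     = (2 * W * (y + 4) * z / (y + 2)^3)^2"
  proof -
    have y2: "y + 2 \<noteq> 0" using y by simp
    have a: "(y - 2) / (y + 2) + 1 = 2 * y / (y + 2)" using y by (simp add: field_simps)
    have b: "7 * ((y - 2) / (y + 2)) - 5 = (2 * y - 24) / (y + 2)" using y by (simp add: field_simps)
    have "2 * y / (y + 2) * K^2 = 2 * (y + 2)^3 / y"
    proof -
      have "2 * y / (y + 2) * K^2 = 2 * y * (y + 2)^4 / ((y + 2) * y^2)"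
        unfolding K power_divide by simp
      also have "\<dots> = 2 * (y + 2)^3 / y" using y by (simp add: frac_eq_eq eval_nat_numeral)
      finally show ?thesis .
    qed
    moreover have "(2 * y - 24) / (y + 2) * K = (2 * y - 24) * (y + 2) / y"
      unfolding K using y2 by (simp add: power2_eq_square)
    ultimately have "2 * y / (y + 2) * K^2 + (2 * y - 24) / (y + 2) * K + 12 =
      (2 * (y + 2)^3 + (2 * y - 24) * (y + 2) + 12 * y) / y" using y by (simp add: add_divide_distrib)
    also have "\<dots> = 2 * (y - 1) * (y + 4)^2 / y"
      by (rule arg_cong[of _ _ "\<lambda>x. x / y"]) Groebner_Basis.algebra
    finally have c: "2 * y / (y + 2) * K^2 + (2 * y - 24) / (y + 2) * K + 12 = 2 * (y - 1) * (y + 4)^2 / y" .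
    have d: "K - 1 = (y^2 + 3 * y + 4) / y" unfolding K using y by (simp add: field_simps power2_eq_square)
    have "2 * ((y^2 + 3 * y + 4) / y * (2 * (y - 1) * (y + 4)^2 / y) / K^3)
       = 4 * W^2 * (y + 4)^2 * y / ((y + 2)^3)^2"
      unfolding K W2 using y y2 by (simp add: divide_simps) Groebner_Basis.algebra
    then show ?thesis unfolding a b c d by (simp add: power_divide power_mult_distrib y_def)
  qed
  then have "sqrt 2 * sqrt ((K - 1) * (((y - 2) / (y + 2) + 1) * K^2 + (7 * ((y - 2) / (y + 2)) - 5) * K + 12) / K^3)
     = 2 * W * (y + 4) * z / (y + 2)^3"
    unfolding real_sqrt_mult[symmetric] using W0 y z by simp
  then have B: "beta0 K = K * (K * (- (2 * W * (y + 4) * z / (y + 2)^3) + (y - 2) / (y + 2) + 1)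
            - (y - 2) / (y + 2) + 7)^2 / (16 * (K + 1)^2)"
    unfolding beta0_def Let_def s by simp
  have sq: "K * (K * (- (2 * W * (y + 4) * z / (y + 2)^3) + (y - 2) / (y + 2) + 1) - (y - 2) / (y + 2) + 7)^2 / (16 * (K + 1)^2)
     = ((z + 2 / z) * (K * (- (2 * W * (y + 4) * z / (y + 2)^3) + (y - 2) / (y + 2) + 1) - (y - 2) / (y + 2) + 7) / (4 * (K + 1)))^2"
    unfolding K_def power_divide power_mult_distrib by simp
  have "K * (- (2 * W * (y + 4) * z / (y + 2)^3) + (y - 2) / (y + 2) + 1) - (y - 2) / (y + 2) + 7
      = 2 * (y + 4) * (y * (y + 3) - z * W) / (y * (y + 2))"
    unfolding K using y by (simp add: divide_simps) Groebner_Basis.algebra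
  moreover have "4 * (K + 1) = 4 * (y + 1) * (y + 4) / y"
    unfolding K using y by (simp add: divide_simps) Groebner_Basis.algebra
  moreover have "z + 2 / z = (y + 2) / z" unfolding y_def using z by (simp add: field_simps power2_eq_square)
  ultimately have "(z + 2 / z) * (K * (- (2 * W * (y + 4) * z / (y + 2)^3) + (y - 2) / (y + 2) + 1) - (y - 2) / (y + 2) + 7) / (4 * (K + 1))
    = (y + 2) / z * (2 * (y + 4) * (y * (y + 3) - z * W) / (y * (y + 2))) / (4 * (y + 1) * (y + 4) / y)"
    by simp
  also have "\<dots> = (y * (y + 3) - z * W) / (2 * z * (y + 1))"
    using y z by (simp add: divide_simps) (simp add: algebra_simps)
  also have "\<dots> = z * (z * (z^2 + 3) - W) / (z * (2 * (z^2 + 1)))"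
    unfolding y_def by (rule arg_cong2[of _ _ _ _ "(/)"]) Groebner_Basis.algebra+
  also have "\<dots> = tangency_s z"
    unfolding tangency_s_def W_def[symmetric] using z by simp
  finally show ?thesis using B sq unfolding K_def by simp
qed

lemma kappa_root_gt_1: "1 < z \<Longrightarrow> 1 < z + 2 / (z::real)"
  using divide_pos_pos[of 2 z] by linarith

lemma eta_beta0:
  assumes z: "1 < z" "2 \<le> z^2" and m: "0 < m"
  shows "eta m ((z + 2 / z)^2 * m) (beta0 ((z + 2 / z)^2)) = tangency_rate z"
  unfolding beta0_eq[OF z]
proof (rule alpha_bar_equality(2)[OF m _ _ _ _ _ tangency_rate_equality[OF z(1)]])
  show "1 < z + 2 / z" using kappa_root_gt_1[OF z(1)] .
  show "second_branch (z + 2 / z) (tangency_s z)"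
    using second_branch_if_ge[OF kappa_root_gt_1[OF z(1)] tangency_s_ge[OF z(1)]] .
qed (use tangency_s_props[OF z(1)] tangency_rate_bounds[OF z(1)] tangency_s_le_rate[OF z(1)] in auto)

section \<open>The crossing point of the two candidate rates\<close>

text \<open>\<open>nu\<close> is the rate \<open>v\<close> for which \<open>boundary_rate_ge\<close> is an equality at \<open>s = v\<close>.\<close>

lemma nu_props:
  assumes k: "1 < k" "k < 3"
  shows "0 < nu (k^2)" "nu (k^2) < 1" "(k - 1) * (1 + (nu (k^2))^2) = 4 * nu (k^2)"
    "(cayley (nu (k^2)))^2 * (3 - k) = k + 1"
proof -
  define w where "w = sqrt ((k + 1) * (3 - k))"
  have pos: "0 < (k + 1) * (3 - k)" using k by simp
  have w: "w^2 = (k + 1) * (3 - k)" "0 < w" unfolding w_def using pos by simp_all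
  have "2 * sqrt (k^2) + 3 - k^2 = (k + 1) * (3 - k)" using k by (simp add: power2_eq_square algebra_simps)
  then have nu: "nu (k^2) = (2 - w) / (k - 1)" unfolding nu_def w_def using k by simp
  have "w^2 < 2^2"
  proof -
    have "2^2 - w^2 = (k - 1)^2" unfolding w by Groebner_Basis.algebra
    moreover have "0 < (k - 1)^2" using k by simp
    ultimately show ?thesis by linarith
  qed
  then have "w < 2" by (rule power_less_imp_less_base) simp
  then show v0: "0 < nu (k^2)" unfolding nu using k by simp
  have "(3 - k) * (3 - k) < (k + 1) * (3 - k)" using k by (intro mult_strict_right_mono) auto
  then have "(3 - k)^2 < w^2" unfolding w(1) by (simp only: power2_eq_square)
  then have "3 - k < w" by (rule power_less_imp_less_base) (use w(2) in simp)
  then show v1: "nu (k^2) < 1" unfolding nu using k by simp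
  have wv: "w = 2 - nu (k^2) * (k - 1)" unfolding nu using k by simp
  have "(k - 1) * ((k - 1) * (1 + (nu (k^2))^2)) = (k - 1) * (4 * nu (k^2))"
    using w(1) unfolding wv by Groebner_Basis.algebra
  then show e: "(k - 1) * (1 + (nu (k^2))^2) = 4 * nu (k^2)" using k by simp
  have "(1 + nu (k^2))^2 * (3 - k) = (k + 1) * (1 - nu (k^2))^2" using e by Groebner_Basis.algebra
  then show "(cayley (nu (k^2)))^2 * (3 - k) = k + 1"
    unfolding cayley_def power_divide using v1 by (simp add: divide_simps)
qed

lemma nu_equality:
  assumes k: "1 < k" "k < 3" and v: "v = nu (k^2)"
  shows "2 * v * (1 - v^2)^2 = (1 - v) * (v - v^2) * ((1 + v^2) * (k^2 + 1) - 4 * v * k)"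
  using nu_props(3)[OF k, folded v] by Groebner_Basis.algebra

text \<open>The quadratic equation of \<open>nu\<close>, evaluated at \<open>1 / k\<close>, gives \<open>(k + 1) (k^2 - 2 k - 1) / k^2\<close>, which
is nonnegative for \<open>k \<ge> 1 + sqrt 2\<close>.\<close>

lemma nu_ge:
  assumes k: "1 + sqrt 2 \<le> k" "k < 3"
  shows "1 \<le> k * nu (k^2)"
proof (rule ccontr)
  define v where "v = nu (k^2)"
  assume "\<not> 1 \<le> k * nu (k^2)"
  then have kv: "k * v < 1" unfolding v_def by simp
  have k1: "1 < k" using k(1) real_sqrt_gt_zero[of 2] by linarith
  have v: "0 < v" "v < 1" "(k - 1) * (1 + v^2) = 4 * v" unfolding v_def using nu_props[OF k1 k(2)] by auto
  have "(sqrt 2)^2 \<le> (k - 1)^2" using k by (intro power_mono) auto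
  then have q: "0 \<le> k^2 - 2 * k - 1" by (simp add: power2_eq_square algebra_simps)
  have "(1 - k * v) * ((k - 1) * (1 + k * v) - 4 * k) = (k + 1) * (k^2 - 2 * k - 1)"
    using v(3) by Groebner_Basis.algebra
  then have "0 \<le> (1 - k * v) * ((k - 1) * (1 + k * v) - 4 * k)" using q k1 by simp
  then have "0 \<le> (k - 1) * (1 + k * v) - 4 * k" using kv by (simp add: zero_le_mult_iff)
  moreover have "(k - 1) * (1 + k * v) \<le> (k - 1) * 2" using kv k1 by (intro mult_left_mono) auto
  ultimately show False using k1 by simp
qed

text \<open>Its sign decides which of the two candidate rates, at the tangency or \<open>nu\<close>, is smaller.\<close>

definition crossing :: "real \<Rightarrow> real" where "crossing z = (z^2 + 1) * (z - 1)^2 - 2"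

lemma crossing_strict_mono: assumes "1 \<le> y" "y < z" shows "crossing y < crossing z"
proof -
  have "(y^2 + 1) * (y - 1)^2 < (z^2 + 1) * (z - 1)^2"
  proof (rule mult_strict_mono')
    show "y^2 + 1 < z^2 + 1" using assms by (simp add: power_strict_mono)
    show "(y - 1)^2 < (z - 1)^2" using assms by (intro power_strict_mono) auto
  qed auto
  then show ?thesis unfolding crossing_def by simp
qed

lemma crossing_mono: "1 \<le> y \<Longrightarrow> y \<le> z \<Longrightarrow> crossing y \<le> crossing z"
  using crossing_strict_mono[of y z] by (cases "y = z") auto

text \<open>The square of \<open>tangency_T z\<close> is \<open>z^2 (z^4 + 3 z^2 + 4) / (z^2 - 1)\<close>, and the quotient is the square of \<open>cayley (nu (k^2))\<close>. Both contain \<open>z^2 + z + 2\<close>, because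
\<open>z^4 + 3 z^2 + 4 = (z^2 + z + 2) (z^2 - z + 2)\<close>.\<close>

lemma tangency_T_nu_identity:
  assumes z: "1 < z" "z < 2"
  shows "((tangency_T z)^2 - (z + 2 / z + 1) / (3 - (z + 2 / z))) * ((z^2 - 1) * (2 - z))
     = - ((z^2 + z + 2) * (z - 1) * crossing z)"
proof -
  have h: "0 < z^2 - 1" "0 < z - 1" "0 < 2 - z" "0 < z" using z by auto
  have "3 - (z + 2 / z) = (z - 1) * (2 - z) / z" "z + 2 / z + 1 = (z^2 + z + 2) / z"
    using z by (simp_all add: field_simps power2_eq_square)
  then have r: "(z + 2 / z + 1) / (3 - (z + 2 / z)) = (z^2 + z + 2) / ((z - 1) * (2 - z))"
    using h by (simp add: divide_simps)
  have "z^2 - 1 = (z - 1) * (z + 1)" by Groebner_Basis.algebra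
  then have "(z + 2 / z + 1) / (3 - (z + 2 / z)) * ((z^2 - 1) * (2 - z)) = (z^2 + z + 2) * (z + 1)"
    unfolding r using h by simp
  moreover have "((t - 1) * (z^2 - 1) = (z^2 + 1)^3) \<Longrightarrow> Q * ((z^2 - 1) * (2 - z)) = (z^2 + z + 2) * (z + 1)
    \<Longrightarrow> (t - Q) * ((z^2 - 1) * (2 - z)) = - ((z^2 + z + 2) * (z - 1) * crossing z)" for t Q
    unfolding crossing_def by Groebner_Basis.algebra
  ultimately show ?thesis using tangency_T_sq[OF z(1)] by blast
qed

lemma kappa_root_less_3: assumes "1 < z" "z < 2" shows "z + 2 / z < (3::real)"
proof -
  have "0 < (z - 1) * (2 - z)" using assms by simp
  then show ?thesis using assms by (simp add: field_simps power2_eq_square)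
qed

lemma opposite_signs:
  fixes X p q c :: real
  assumes e: "X * p = - (q * c)" and p: "0 < p" and q: "0 < q"
  shows "X < 0 \<longleftrightarrow> 0 < c" "X = 0 \<longleftrightarrow> c = 0"
proof -
  have "X < 0 \<longleftrightarrow> X * p < 0" using p by (simp add: mult_less_0_iff)
  then show "X < 0 \<longleftrightarrow> 0 < c" unfolding e using q by (simp add: zero_less_mult_iff)
  have "X = 0 \<longleftrightarrow> X * p = 0" using p by simp
  then show "X = 0 \<longleftrightarrow> c = 0" unfolding e using q by simp
qed

lemma tangency_T_vs_nu:
  assumes z: "1 < z" "z < 2"
  shows "tangency_T z < cayley (nu ((z + 2 / z)^2)) \<longleftrightarrow> 0 < crossing z"
    and "tangency_T z = cayley (nu ((z + 2 / z)^2)) \<longleftrightarrow> crossing z = 0"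
proof -
  let ?k = "z + 2 / z" and ?t = "cayley (nu ((z + 2 / z)^2))"
  have k: "1 < ?k" "?k < 3" using kappa_root_gt_1[OF z(1)] kappa_root_less_3[OF z] by auto
  note n = nu_props[OF k]
  have t0: "0 \<le> ?t" using cayley_ge_1[of "nu (?k^2)"] n by simp
  have "?t^2 = (?k + 1) / (3 - ?k)" using n(4) k by (simp add: eq_divide_eq)
  then have "((tangency_T z)^2 - ?t^2) * ((z^2 - 1) * (2 - z)) = - ((z^2 + z + 2) * (z - 1) * crossing z)"
    using tangency_T_nu_identity[OF z] by simp
  moreover have "0 < (z^2 - 1) * (2 - z)" "0 < (z^2 + z + 2) * (z - 1)"
    using z by (auto intro!: mult_pos_pos add_pos_pos)
  ultimately have "(tangency_T z)^2 - ?t^2 < 0 \<longleftrightarrow> 0 < crossing z" "(tangency_T z)^2 - ?t^2 = 0 \<longleftrightarrow> crossing z = 0"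
    by (rule opposite_signs)+
  moreover have "(tangency_T z)^2 < ?t^2 \<longleftrightarrow> tangency_T z < ?t" "(tangency_T z)^2 = ?t^2 \<longleftrightarrow> tangency_T z = ?t"
    using t0 tangency_T_pos[OF z(1)] power_mono_iff[of ?t "tangency_T z" 2] by (auto simp: not_le[symmetric])
  ultimately show "tangency_T z < ?t \<longleftrightarrow> 0 < crossing z" "tangency_T z = ?t \<longleftrightarrow> crossing z = 0"
    by simp_all
qed

lemma eta_eq_nu_iff:
  assumes z: "1 < z" "2 \<le> z^2" "z \<le> 2"
  shows "eta 1 ((z + 2 / z)^2) (beta0 ((z + 2 / z)^2)) = nu ((z + 2 / z)^2) \<longleftrightarrow> crossing z = 0"
proof (cases "z = 2")
  \<comment> \<open>At z = 2 the condition number is 9 and the rate nu has the value 1.\<close>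
  case True
  have "nu ((z + 2 / z)^2) = 1" unfolding True nu_def by (simp add: real_sqrt_abs2)
  moreover have "crossing z \<noteq> 0" unfolding True crossing_def by simp
  ultimately show ?thesis using eta_beta0[OF z(1,2), of 1] tangency_rate_bounds[OF z(1)] by simp
next
  case False
  then have z2: "z < 2" using z by simp
  note n = nu_props[OF kappa_root_gt_1[OF z(1)] kappa_root_less_3[OF z(1) z2]] and v = tangency_rate_bounds[OF z(1)]
  have "tangency_rate z = nu ((z + 2 / z)^2) \<longleftrightarrow> cayley (tangency_rate z) = cayley (nu ((z + 2 / z)^2))"
    using cayley_le_iff n v by (metis order_antisym order_refl)
  also have "cayley (tangency_rate z) = tangency_T z" unfolding tangency_rate_def by (rule cayley_inverse[OF tangency_T_gt_1[OF z(1)]])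
  finally show ?thesis using eta_beta0[OF z(1,2), of 1] tangency_T_vs_nu(2)[OF z(1) z2] by simp
qed

text \<open>The larger solution \<open>z\<close> of \<open>k = z + 2 / z\<close>.\<close>

definition zroot :: "real \<Rightarrow> real" where "zroot k = (k + sqrt (k^2 - 8)) / 2"

lemma zroot: assumes "8 \<le> k^2" "0 < k"
  shows "1 < zroot k" "2 \<le> (zroot k)^2" "zroot k + 2 / zroot k = k"
proof -
  define w where "w = sqrt (k^2 - 8)"
  have w: "0 \<le> w" "w^2 = k^2 - 8" unfolding w_def using assms by simp_all
  have z: "zroot k = (k + w) / 2" unfolding zroot_def w_def ..
  have "2^2 < k^2" using assms by simp
  then have "2 < k" by (rule power_less_imp_less_base) (use assms(2) in simp)
  then show z1: "1 < zroot k" unfolding z using w by simp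
  have e: "(zroot k)^2 - k * zroot k + 2 = 0" unfolding z using w(2) by (simp add: power2_eq_square field_simps)
  then show "zroot k + 2 / zroot k = k" using z1 by (simp add: field_simps power2_eq_square)
  have "4 * (zroot k)^2 = 8 + 2 * (w^2 + k * w)" unfolding z using w(2) by (simp add: power2_eq_square field_simps)
  moreover have "0 \<le> w^2 + k * w" using w assms by simp
  ultimately show "2 \<le> (zroot k)^2" by simp
qed

lemma zroot_mono: assumes "0 \<le> k" "k \<le> l" shows "zroot k \<le> zroot l"
proof -
  have "k^2 \<le> l^2" using assms by (intro power_mono)
  then have "sqrt (k^2 - 8) \<le> sqrt (l^2 - 8)" by simp
  then show ?thesis unfolding zroot_def by (intro divide_right_mono add_mono assms) auto
qed

lemma crossing_root: obtains z where "1 < z" "2 \<le> z^2" "z \<le> 2" "crossing z = 0"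
proof -
  have s2: "1 < sqrt 2" "sqrt 2 \<le> 2" by (simp_all add: real_le_lsqrt)
  have "crossing (sqrt 2) \<le> 0"
  proof -
    have "4/3 \<le> sqrt 2" by (rule real_le_rsqrt) (simp add: power2_eq_square)
    moreover have "crossing (sqrt 2) = 7 - 6 * sqrt 2" unfolding crossing_def by (simp add: power2_diff)
    ultimately show ?thesis by linarith
  qed
  moreover have "0 \<le> crossing 2" unfolding crossing_def by simp
  moreover have "continuous_on {sqrt 2..2} crossing" unfolding crossing_def by (intro continuous_intros)
  ultimately obtain z where z: "sqrt 2 \<le> z" "z \<le> 2" "crossing z = 0"
    using IVT'[of crossing "sqrt 2" 0 2] s2 by auto
  have "2 \<le> z^2" using power_mono[OF z(1), of 2] by simp
  then show ?thesis using that[of z] z s2 by simp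
qed

text \<open>The map \<open>z \<mapsto> (z + 2 / z)^2\<close> takes \<open>[sqrt 2, 2]\<close> onto \<open>[8, 9]\<close>, so the equation that defines
\<open>kappa_bar\<close> is \<open>crossing z = 0\<close>, and \<open>crossing\<close> is increasing.\<close>

lemma kappa_bar_crossing:
  obtains z where "1 < z" "2 \<le> z^2" "z \<le> 2" "crossing z = 0" "kappa_bar = (z + 2 / z)^2"
proof -
  obtain z where z: "1 < z" "2 \<le> z^2" "z \<le> 2" "crossing z = 0" by (rule crossing_root)
  have "kappa_bar = (z + 2 / z)^2" unfolding kappa_bar_def
  proof (rule the_equality)
    have "(z + 2 / z)^2 = 8 + (z - 2 / z)^2" using z by (simp add: field_simps power2_eq_square)
    then have "8 \<le> (z + 2 / z)^2" by simp
    moreover have "z + 2 / z \<le> 3"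
    proof -
      have "0 \<le> (z - 1) * (2 - z)" using z by simp
      then show ?thesis using z by (simp add: field_simps power2_eq_square)
    qed
    then have "(z + 2 / z)^2 \<le> 3^2" using z by (intro power_mono) auto
    ultimately show "(z + 2 / z)^2 \<in> {8..9} \<and> eta 1 ((z + 2 / z)^2) (beta0 ((z + 2 / z)^2)) = nu ((z + 2 / z)^2)"
      using eta_eq_nu_iff[OF z(1-3)] z(4) by simp
  next
    fix K assume K: "K \<in> {8..9} \<and> eta 1 K (beta0 K) = nu K"
    define y where "y = zroot (sqrt K)"
    have sK: "8 \<le> (sqrt K)^2" "0 < sqrt K" "(sqrt K)^2 = K" using K by auto
    note y = zroot[OF sK(1,2), folded y_def]
    have "sqrt K \<le> 3" using K by (simp add: real_le_lsqrt)
    then have "y \<le> zroot 3" unfolding y_def using zroot_mono sK(2) by simp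
    then have y2: "y \<le> 2" unfolding zroot_def by simp
    have "crossing y = 0" using eta_eq_nu_iff[OF y(1,2) y2] K y(3) sK(3) by simp
    then have "y = z" using crossing_strict_mono[of y z] crossing_strict_mono[of z y] y(1) z(1,4)
      by (cases y z rule: linorder_cases) auto
    then show "K = (z + 2 / z)^2" using y(3) sK(3) by simp
  qed
  then show ?thesis using that z by blast
qed

lemma kappa_bar_le_iff:
  assumes z: "1 < z" "2 \<le> z^2"
  shows "kappa_bar \<le> (z + 2 / z)^2 \<longleftrightarrow> 0 \<le> crossing z"
proof -
  obtain y where y: "1 < y" "2 \<le> y^2" "y \<le> 2" "crossing y = 0" "kappa_bar = (y + 2 / y)^2"
    by (rule kappa_bar_crossing)
  have inc: "(a + 2 / a)^2 < (b + 2 / b)^2" if "1 < a" "2 \<le> a^2" "a < b" for a b :: real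
  proof (rule power_strict_mono)
    have "a * a < b * a" using that by simp
    moreover have "2 \<le> a * a" using that by (simp add: power2_eq_square)
    ultimately have "0 < a * b - 2" by (simp add: mult.commute)
    then have "0 < (b - a) * (a * b - 2)" using that by simp
    also have "\<dots> = (b + 2 / b - (a + 2 / a)) * (a * b)" using that by (simp add: field_simps)
    finally have "0 < (b + 2 / b - (a + 2 / a)) * (a * b)" .
    moreover have "0 < a * b" using that by simp
    ultimately have "0 < b + 2 / b - (a + 2 / a)" by (rule zero_less_mult_pos2)
    then show "a + 2 / a < b + 2 / b" by simp
  qed (use that in auto)
  show ?thesis
  proof (cases rule: linorder_cases[of y z])
    case less then show ?thesis using inc[of y z] crossing_strict_mono[of y z] y by simp
  next
    case equal then show ?thesis using y by simp
  next
    case greater then show ?thesis using inc[of z y] crossing_strict_mono[of z y] y z by simp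
  qed
qed

lemma kappa_bar_bounds: "8 \<le> kappa_bar" "kappa_bar \<le> 9"
proof -
  obtain z where z: "1 < z" "2 \<le> z^2" "z \<le> 2" "crossing z = 0" "kappa_bar = (z + 2 / z)^2"
    by (rule kappa_bar_crossing)
  have "(z + 2 / z)^2 = 8 + (z - 2 / z)^2" using z by (simp add: field_simps power2_eq_square)
  then show "8 \<le> kappa_bar" unfolding z by simp
  have "0 \<le> (z - 1) * (2 - z)" using z by simp
  then have "z + 2 / z \<le> 3" using z by (simp add: field_simps power2_eq_square)
  then show "kappa_bar \<le> 9" unfolding z using z(1) power_mono[of "z + 2 / z" 3 2] by auto
qed

text \<open>A margin below \<open>9\<close> keeps the factor \<open>3 - k\<close> in the equation for \<open>nu\<close> away from 0.\<close>

lemma kappa_bar_le: "kappa_bar \<le> 2.9^2"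
proof -
  let ?z = "zroot 2.9"
  have "0.62 \<le> sqrt (2.9^2 - 8)" by (rule real_le_rsqrt) (simp add: power2_eq_square)
  then have z: "1.76 \<le> ?z" unfolding zroot_def by simp
  have "crossing 1.76 \<le> crossing ?z"
    using z by (intro crossing_mono) auto
  moreover have "0 \<le> crossing 1.76" unfolding crossing_def by (simp add: power2_eq_square)
  ultimately have "0 \<le> crossing ?z" by simp
  moreover have "8 \<le> (2.9::real)^2" by (simp add: power2_eq_square)
  ultimately show ?thesis using kappa_bar_le_iff[of ?z] zroot[of "2.9"] by simp
qed

section \<open>Intermediate condition numbers\<close>

text \<open>Let \<open>E = (k^2 + 1) C - 2 k S\<close>, \<open>F = (k^2 + 1) S - 2 k C\<close> and \<open>x = T - C\<close>, so that
\<open>x E = (C + x)^2 - 1\<close> and \<open>x F = S E\<close>. Eliminating \<open>x\<close> gives a homogeneous cubic equation in \<open>(C, S)\<close>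
with the extraneous factor \<open>k C - S\<close>; the remaining quadratic has discriminant
\<open>(k^2 - 1)^2 (k^2 - 8)\<close>. Its two roots correspond to the two solutions \<open>z\<close> of
\<open>k = z + 2 / z\<close>, and both of them yield the same formula for \<open>T\<close>.\<close>

lemma critical_point:
  fixes k C S T :: real
  assumes k: "1 < k" "k < 3" and CS: "C^2 - S^2 = 1" "0 < S" "0 < C"
    and gap0: "gap k T C S = 0"
    and crit: "(T - C) * ((k^2 + 1) * S - 2 * k * C) = S * ((k^2 + 1) * C - 2 * k * S)"
  obtains z where "1 < z" "z < 2" "k = z + 2 / z" "T = tangency_T z"
proof -
  define E where "E = (k^2 + 1) * C - 2 * k * S"
  define F where "F = (k^2 + 1) * S - 2 * k * C"
  define x where "x = T - C"
  define quad where "quad = (3 * k^2 + 1) * S^2 - k * (k^2 + 7) * (S * C) + 2 * (k^2 + 1) * C^2"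
  have xF: "x * F = S * E" using crit unfolding x_def E_def F_def .
  have xE: "x * E = (C + x)^2 - 1" using gap0 unfolding gap_def x_def E_def by simp
  have SC: "S < C"
  proof (rule power_less_imp_less_base)
    show "S^2 < C^2" using CS(1) by simp
  qed (use CS in simp)
  have "S * (S * F^2 + 2 * C * E * F + S * E^2 - E^2 * F) = 0"
    using xE xF CS(1) by Groebner_Basis.algebra
  then have "S * F^2 + 2 * C * E * F + S * E^2 - E^2 * F = 0" using CS by simp
  moreover have "S * F^2 + 2 * C * E * F + S * E^2 - E^2 * F = (k^2 - 1) * (k * C - S) * quad"
    unfolding E_def F_def quad_def by (simp add: algebra_simps eval_nat_numeral)
  moreover have "k * C - S > 0"
  proof -
    have "1 * C \<le> k * C" using k CS by (intro mult_right_mono) auto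
    then show ?thesis using SC by simp
  qed
  moreover have "1 < k^2" using k by simp
  ultimately have quad0: "quad = 0" by simp
  \<comment> \<open>The quadratic, multiplied by four times its leading coefficient and completed to a square.\<close>
  have disc: "(2 * (3 * k^2 + 1) * S - k * (k^2 + 7) * C)^2 = (k^2 - 1)^2 * (k^2 - 8) * C^2"
    using quad0 unfolding quad_def by Groebner_Basis.algebra
  have k8: "8 \<le> k^2"
  proof (rule ccontr)
    assume "\<not> 8 \<le> k^2"
    then have "(k^2 - 1)^2 * (k^2 - 8) * C^2 < 0"
      using \<open>1 < k^2\<close> CS by (intro mult_neg_pos mult_pos_neg) auto
    then show False using disc by (metis not_less zero_le_power2)
  qed
  define w where "w = sqrt (k^2 - 8)"
  have w: "0 \<le> w" "w^2 = k^2 - 8" unfolding w_def using k8 by simp_all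
  have "w < k - 2" "w < 4 - k"
  proof -
    have "2^2 < k^2" using k8 by simp
    then have "2 < k" by (rule power_less_imp_less_base) (use k in simp)
    have "w^2 < (k - 2)^2" unfolding w using k by (simp add: power2_eq_square algebra_simps)
    then show "w < k - 2" by (rule power_less_imp_less_base) (use \<open>2 < k\<close> in simp)
    have "w^2 < (4 - k)^2" unfolding w using k by (simp add: power2_eq_square algebra_simps)
    then show "w < 4 - k" by (rule power_less_imp_less_base) (use k in simp)
  qed
  have "(2 * (3 * k^2 + 1) * S - k * (k^2 + 7) * C)^2 = ((k^2 - 1) * w * C)^2"
    unfolding disc power_mult_distrib w(2) ..
  then have "2 * (3 * k^2 + 1) * S - k * (k^2 + 7) * C = - ((k^2 - 1) * w * C) \<or>
     2 * (3 * k^2 + 1) * S - k * (k^2 + 7) * C = (k^2 - 1) * w * C"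
    by (auto simp: power2_eq_iff)
  then obtain z where z: "1 < z" "z < 2" "z^2 - k * z + 2 = 0"
    "2 * (3 * k^2 + 1) * S = (k * (k^2 + 7) - (k^2 - 1) * (2 * z - k)) * C"
  proof (elim disjE)
    assume "2 * (3 * k^2 + 1) * S - k * (k^2 + 7) * C = - ((k^2 - 1) * w * C)"
    moreover define z where "z = (k + w) / 2"
    have zw: "2 * z - k = w" unfolding z_def by (simp add: field_simps)
    ultimately have "2 * (3 * k^2 + 1) * S = (k * (k^2 + 7) - (k^2 - 1) * (2 * z - k)) * C"
      unfolding zw by Groebner_Basis.algebra
    moreover have "z^2 - k * z + 2 = 0" using w(2) unfolding z_def by (simp add: power2_eq_square field_simps)
    moreover have "1 < z" "z < 2" unfolding z_def using w \<open>w < k - 2\<close> \<open>w < 4 - k\<close> by simp_all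
    ultimately show ?thesis using that by blast
  next
    assume "2 * (3 * k^2 + 1) * S - k * (k^2 + 7) * C = (k^2 - 1) * w * C"
    moreover define z where "z = (k - w) / 2"
    have zw: "2 * z - k = - w" unfolding z_def by (simp add: field_simps)
    ultimately have "2 * (3 * k^2 + 1) * S = (k * (k^2 + 7) - (k^2 - 1) * (2 * z - k)) * C"
      unfolding zw by Groebner_Basis.algebra
    moreover have "z^2 - k * z + 2 = 0" using w(2) unfolding z_def by (simp add: power2_eq_square field_simps)
    moreover have "1 < z" "z < 2" unfolding z_def using w \<open>w < k - 2\<close> \<open>w < 4 - k\<close> by simp_all
    ultimately show ?thesis using that by blast
  qed
  have kz: "k = z + 2 / z" using z by (simp add: field_simps power2_eq_square)
  have kz': "k * z = z^2 + 2" using z(3) by simp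
  have "(2 * (3 * z^2 + 4)) * (S * (z * (z^2 + 3))) = (2 * (3 * z^2 + 4)) * (2 * (z^2 + 1) * C)"
  proof -
    have "z^3 * (2 * (3 * k^2 + 1)) = 2 * z * (3 * (k * z)^2 + z^2)" by Groebner_Basis.algebra
    moreover have "z^3 * (k * (k^2 + 7) - (k^2 - 1) * (2 * z - k))
       = (k * z) * ((k * z)^2 + 7 * z^2) - ((k * z)^2 - z^2) * (2 * z^2 - k * z)" by Groebner_Basis.algebra
    ultimately have "2 * z * (3 * (z^2 + 2)^2 + z^2) * S =
      ((z^2 + 2) * ((z^2 + 2)^2 + 7 * z^2) - ((z^2 + 2)^2 - z^2) * (2 * z^2 - (z^2 + 2))) * C"
      using arg_cong[OF z(4), of "\<lambda>t. z^3 * t"] unfolding kz' by (simp add: mult.assoc[symmetric])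
    then show ?thesis by Groebner_Basis.algebra
  qed
  moreover have "0 < 2 * (3 * z^2 + 4)" by (simp add: add_nonneg_pos)
  ultimately have ratio: "S * (z * (z^2 + 3)) = 2 * (z^2 + 1) * C" by (rule cancel_pos)
  define W where "W = tangency_w z"
  have W: "0 < W" "W^2 = (z^2 - 1) * (z^4 + 3 * z^2 + 4)"
    unfolding W_def using tangency_w_pos[OF z(1)] tangency_w_sq[OF z(1)] by auto
  have "(C * W)^2 = (z * (z^2 + 3))^2"
    using W(2) ratio CS(1) by Groebner_Basis.algebra
  then have CW: "C * W = z * (z^2 + 3)"
    by (rule power2_eq_imp_eq) (use CS W z in \<open>auto intro!: mult_nonneg_nonneg add_nonneg_nonneg\<close>)
  have "(z * (z^2 + 3)) * (S * W) = (z * (z^2 + 3)) * (2 * (z^2 + 1))"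
    using ratio CW by Groebner_Basis.algebra
  moreover have "0 < z * (z^2 + 3)" using z by (auto intro!: mult_pos_pos add_nonneg_pos)
  ultimately have SW: "S * W = 2 * (z^2 + 1)" by (rule cancel_pos)
  have FW: "F * W * z^2 = 2 * (z^4 + 3 * z^2 + 4)"
  proof -
    have "F * W * z^2 = ((k * z)^2 + z^2) * (S * W) - 2 * z * (k * z) * (C * W)" unfolding F_def by Groebner_Basis.algebra
    also have "\<dots> = 2 * (z^4 + 3 * z^2 + 4)" unfolding kz' CW SW by Groebner_Basis.algebra
    finally show ?thesis .
  qed
  have EW: "E * W * z^2 = z * (z^2 + 1) * (z^4 + 3 * z^2 + 4)"
  proof -
    have "E * W * z^2 = ((k * z)^2 + z^2) * (C * W) - 2 * z * (k * z) * (S * W)" unfolding E_def by Groebner_Basis.algebra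
    also have "\<dots> = z * (z^2 + 1) * (z^4 + 3 * z^2 + 4)" unfolding kz' CW SW by Groebner_Basis.algebra
    finally show ?thesis .
  qed
  have "(2 * (z^4 + 3 * z^2 + 4)) * (x * W) = (2 * (z^4 + 3 * z^2 + 4)) * (z * (z^2 + 1)^2)"
    using xF FW EW SW by Groebner_Basis.algebra
  moreover have "0 < 2 * (z^4 + 3 * z^2 + 4)" by (simp add: add_nonneg_pos)
  ultimately have "x * W = z * (z^2 + 1)^2" by (rule cancel_pos)
  then have "T * W = z * (z^2 + 3) + z * (z^2 + 1)^2" unfolding x_def using CW by (simp add: algebra_simps)
  also have "\<dots> = z * (z^4 + 3 * z^2 + 4)" by Groebner_Basis.algebra
  also have "\<dots> = tangency_T z * W" unfolding W_def using tangency_T_w[OF z(1)] by simp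
  finally have "T = tangency_T z" using W by simp
  then show ?thesis using that z kz by blast
qed

text \<open>The smaller solution of \<open>k = z + 2 / z\<close> is treated through the larger one, \<open>2 / z\<close>, because
\<open>crossing\<close> is increasing.\<close>

lemma crossing_neg:
  assumes z: "1 < z" "z < 2" and K: "(z + 2 / z)^2 < kappa_bar"
  shows "crossing z < 0"
proof (cases "2 \<le> z^2")
  case True
  then show ?thesis using kappa_bar_le_iff[OF z(1)] K by simp
next
  case False
  define y where "y = 2 / z"
  have y: "1 < y" "2 / y = z" unfolding y_def using z by simp_all
  have "z * z < 2" using False by (simp add: power2_eq_square)
  then have zy: "z < y" unfolding y_def using z by (simp add: field_simps)
  have "2 * (z * z) \<le> 2 * 2" using \<open>z * z < 2\<close> by simp
  then have "2 \<le> y^2" unfolding y_def power_divide using z by (simp add: field_simps power2_eq_square)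
  moreover have "y + 2 / y = z + 2 / z" unfolding y(2) y_def by simp
  ultimately have "crossing y < 0" using kappa_bar_le_iff[OF y(1)] K by simp
  then show ?thesis using crossing_strict_mono[of z y] zy z by simp
qed

text \<open>At \<open>s = 0\<close> the boundary rate has the Cayley transform \<open>k^2\<close>, so this excludes a minimum at
\<open>s = 0\<close>.\<close>

lemma cayley_nu_le:
  assumes k: "1 + sqrt 2 \<le> k" "k^2 < kappa_bar"
  shows "k < 3" "cayley (nu (k^2)) \<le> k^2"
proof -
  have "k^2 < 2.9^2" using k(2) kappa_bar_le by simp
  then have k29: "k < 2.9" by (rule power_less_imp_less_base) simp
  then show k3: "k < 3" by simp
  have "1.4 \<le> sqrt 2" by (rule real_le_rsqrt) (simp add: power2_eq_square)
  then have k24: "2.4 \<le> k" using k by simp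
  have "k + 1 \<le> (k^2)^2 * (3 - k)"
  \<comment> \<open>Near 2.9 the factor 3 - k is small, near 2.4 the power is; hence two ranges.\<close>
  proof (cases "k \<le> 2.6")
    case True
    have "(2.4^2)^2 \<le> (k^2)^2" using k24 by (intro power_mono) auto
    then have "(2.4^2)^2 * 0.4 \<le> (k^2)^2 * (3 - k)" using True by (intro mult_mono) auto
    then show ?thesis using True by (simp add: power2_eq_square)
  next
    case False
    have "(2.6^2)^2 \<le> (k^2)^2" using False by (intro power_mono) auto
    then have "(2.6^2)^2 * 0.1 \<le> (k^2)^2 * (3 - k)" using k29 by (intro mult_mono) auto
    then show ?thesis using k29 by (simp add: power2_eq_square)
  qed
  also have "k + 1 = (cayley (nu (k^2)))^2 * (3 - k)" using nu_props(4)[of k] k24 k3 by simp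
  finally have "(cayley (nu (k^2)))^2 \<le> (k^2)^2" using k3 by simp
  then show "cayley (nu (k^2)) \<le> k^2" by (rule power2_le_imp_le) simp
qed

definition gap_centre :: "real \<Rightarrow> real \<Rightarrow> real" where
  "gap_centre k s = ((k^2 + 1) * ch s - 2 * k * sh s - 2 * ch s) / 2"

text \<open>For fixed \<open>s\<close> the function \<open>gap\<close> is a concave quadratic polynomial in \<open>T\<close>, symmetric about
\<open>ch s + gap_centre k s\<close>; this is its larger root. It is the Cayley transform of the larger
root at \<open>\<mu> = m\<close> for \<open>\<beta> = s^2\<close> and \<open>\<alpha>\<close> on the second branch of \<open>alpha_bar\<close>.\<close>

definition gap_root :: "real \<Rightarrow> real \<Rightarrow> real" where
  "gap_root k s = ch s + gap_centre k s + sqrt ((gap_centre k s)^2 - (sh s)^2)"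

lemma gap_complete_square:
  assumes "C^2 - S^2 = 1"
  shows "gap k T C S = (((k^2 + 1) * C - 2 * k * S - 2 * C) / 2)^2 - S^2
     - (T - C - ((k^2 + 1) * C - 2 * k * S - 2 * C) / 2)^2"
proof -
  define H where "H = ((k^2 + 1) * C - 2 * k * S - 2 * C) / 2"
  have "(k^2 + 1) * C - 2 * k * S = 2 * H + 2 * C" unfolding H_def by (simp add: field_simps)
  then show ?thesis unfolding gap_def H_def[symmetric] using assms by Groebner_Basis.algebra
qed

text \<open>The product of the two roots, measured from \<open>ch s\<close>, is \<open>(sh s)^2\<close>, so the smaller root lies below
\<open>ch s + sh s = cayley s\<close>.\<close>

lemma gap_nonneg_below:
  assumes s: "0 \<le> s" "s < 1" and h: "sh s \<le> gap_centre k s" and T: "cayley s \<le> T" "T \<le> gap_root k s"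
  shows "0 \<le> gap k T (ch s) (sh s)"
proof -
  define H where "H = gap_centre k s"
  define x where "x = T - ch s"
  have S: "0 \<le> sh s" using sh_nonneg s .
  have "(sh s)^2 \<le> H^2" using h S unfolding H_def by (intro power_mono)
  define q where "q = sqrt (H^2 - (sh s)^2)"
  have q: "0 \<le> q" "q^2 = H^2 - (sh s)^2" unfolding q_def using \<open>(sh s)^2 \<le> H^2\<close> by simp_all
  have "x \<le> H + q" using T(2) unfolding x_def gap_root_def H_def q_def by simp
  have "sh s \<le> x" using T(1) ch_plus_sh[OF s] unfolding x_def by simp
  have "H - q \<le> sh s"
  proof -
    have "(H - sh s)^2 \<le> q^2"
    proof -
      have "q^2 - (H - sh s)^2 = 2 * sh s * (H - sh s)" unfolding q(2) by Groebner_Basis.algebra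
      moreover have "0 \<le> 2 * sh s * (H - sh s)" using S h unfolding H_def by simp
      ultimately show ?thesis by linarith
    qed
    then have "H - sh s \<le> q" by (rule power2_le_imp_le) (rule q(1))
    then show ?thesis by simp
  qed
  then have "\<bar>x - H\<bar> \<le> q" using \<open>x \<le> H + q\<close> \<open>sh s \<le> x\<close> by simp
  then have "(x - H)^2 \<le> q^2" using q(1) by (simp add: abs_le_square_iff[symmetric])
  then show ?thesis unfolding gap_complete_square[OF ch_sh[OF s]] gap_centre_def[symmetric] H_def[symmetric] x_def[symmetric] q(2) by simp
qed

lemma gap_gap_root:
  assumes s: "0 \<le> s" "s < 1" and h: "sh s \<le> gap_centre k s"
  shows "gap k (gap_root k s) (ch s) (sh s) = 0"
proof -
  have "(sh s)^2 \<le> (gap_centre k s)^2" using h sh_nonneg[OF s] by (intro power_mono)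
  then have "(gap_root k s - ch s - gap_centre k s)^2 = (gap_centre k s)^2 - (sh s)^2" unfolding gap_root_def by simp
  then show ?thesis unfolding gap_complete_square[OF ch_sh[OF s]] gap_centre_def[symmetric] by simp
qed

lemma gap_centre_minus_sh:
  assumes k: "1 < k" "k < 3" and s: "0 \<le> s" "s < 1"
  shows "(gap_centre k s - sh s) * ((1 - s^2) * (1 + (nu (k^2))^2)) = 2 * (k + 1) * (nu (k^2) - s) * (1 - nu (k^2) * s)"
proof -
  define v where "v = nu (k^2)"
  have v: "(k - 1) * (1 + v^2) = 4 * v" unfolding v_def using nu_props(3)[OF k] .
  have p: "1 - s^2 \<noteq> 0" using sq_lt_1[OF s] by simp
  have "ch s * (1 - s^2) = 1 + s^2" "sh s * (1 - s^2) = 2 * s" unfolding ch_def sh_def using p by simp_all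
  moreover have "(gap_centre k s - sh s) * 2 = (k^2 - 1) * ch s - 2 * (k + 1) * sh s"
    unfolding gap_centre_def by (simp add: field_simps)
  ultimately show ?thesis unfolding v_def[symmetric] using v by Groebner_Basis.algebra
qed

lemma gap_centre_ge_sh:
  assumes k: "1 < k" "k < 3" and s: "0 \<le> s" "s \<le> nu (k^2)"
  shows "sh s \<le> gap_centre k s" "s < nu (k^2) \<Longrightarrow> sh s < gap_centre k s" "s = nu (k^2) \<Longrightarrow> gap_centre k s = sh s"
proof -
  define v where "v = nu (k^2)"
  have v: "0 < v" "v < 1" unfolding v_def using nu_props[OF k] by auto
  have s1: "s < 1" using s v unfolding v_def by simp
  have "v * s \<le> 1 * s" using v s by (intro mult_right_mono) auto
  then have "v * s < 1" using s1 by simp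
  moreover have "0 < 1 - s^2" using sq_lt_1[OF s(1) s1] by simp
  then have P: "0 < (1 - s^2) * (1 + v^2)" by (simp add: add_pos_nonneg)
  moreover note e = gap_centre_minus_sh[OF k s(1) s1, folded v_def]
  ultimately have "0 \<le> (gap_centre k s - sh s) * ((1 - s^2) * (1 + v^2))"
    unfolding e using s k by (simp add: v_def)
  then have "0 \<le> gap_centre k s - sh s" by (rule nonneg_cancel[OF P])
  then show "sh s \<le> gap_centre k s" by simp
  show "sh s < gap_centre k s" if "s < nu (k^2)"
  proof -
    have "0 < (gap_centre k s - sh s) * ((1 - s^2) * (1 + v^2))"
      unfolding e using that \<open>v * s < 1\<close> k by (simp add: v_def)
    then have "0 < gap_centre k s - sh s" using P by (rule zero_less_mult_pos2)
    then show ?thesis by simp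
  qed
  show "gap_centre k s = sh s" if "s = nu (k^2)"
  proof -
    have "(gap_centre k s - sh s) * ((1 - s^2) * (1 + v^2)) = 0" unfolding e using that by (simp add: v_def)
    then have "gap_centre k s - sh s = 0" using P by (metis less_irrefl mult_eq_0_iff)
    then show ?thesis by simp
  qed
qed

lemma ch_deriv: assumes "0 \<le> s" "s < 1" shows "(ch has_real_derivative sh s * (2 / (1 - s^2))) (at s)"
proof -
  have p: "1 - s^2 \<noteq> 0" using sq_lt_1[OF assms] by simp
  show ?thesis unfolding ch_def[abs_def] sh_def
    by (rule derivative_eq_intros refl p | simp)+ (use p in \<open>simp add: field_simps power2_eq_square\<close>)
qed

lemma sh_deriv: assumes "0 \<le> s" "s < 1" shows "(sh has_real_derivative ch s * (2 / (1 - s^2))) (at s)"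
proof -
  have p: "1 - s^2 \<noteq> 0" using sq_lt_1[OF assms] by simp
  show ?thesis unfolding ch_def sh_def[abs_def]
    by (rule derivative_eq_intros refl p | simp)+ (use p in \<open>simp add: field_simps power2_eq_square\<close>)
qed

text \<open>Suppose that \<open>gap_root k\<close> takes a value below \<open>cayley (nu (k^2))\<close> on \<open>[0, nu (k^2)]\<close>. The minimum is not at
an end, since the end values are \<open>k^2\<close> and \<open>cayley (nu (k^2))\<close>. With \<open>T\<close> the minimum value, \<open>gap k T\<close>
has a local minimum 0 at the minimizer, so its derivative vanishes there. By
\<open>critical_point\<close> then \<open>T = tangency_T z\<close>, and \<open>T < cayley (nu (k^2))\<close> forces \<open>crossing z > 0\<close>, against
\<open>k^2 < kappa_bar\<close>.\<close>

lemma gap_root_ge_cayley_nu: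
  assumes k: "1 + sqrt 2 \<le> k" "k^2 < kappa_bar" and s: "0 \<le> s" "s \<le> nu (k^2)"
  shows "cayley (nu (k^2)) \<le> gap_root k s"
proof (rule ccontr)
  assume neg: "\<not> cayley (nu (k^2)) \<le> gap_root k s"
  define v where "v = nu (k^2)"
  have k3: "k < 3" using cayley_nu_le[OF k] by simp
  have k1: "1 < k" using k(1) real_sqrt_gt_zero[of 2] by linarith
  note h = gap_centre_ge_sh[OF k1 k3, folded v_def]
  have v: "0 < v" "v < 1" unfolding v_def using nu_props[OF k1 k3] by auto
  have ct: "continuous_on {0..v} (gap_root k)"
  proof -
    have "1 - s^2 \<noteq> 0" if "s \<in> {0..v}" for s using sq_lt_1[of s] that v by auto
    then have "continuous_on {0..v} ch" "continuous_on {0..v} sh"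
      unfolding ch_def[abs_def] sh_def[abs_def] by (auto intro!: continuous_intros)
    then show ?thesis unfolding gap_root_def[abs_def] gap_centre_def[abs_def] by (intro continuous_intros) auto
  qed
  obtain a where a: "a \<in> {0..v}" "\<And>y. y \<in> {0..v} \<Longrightarrow> gap_root k a \<le> gap_root k y"
    using continuous_attains_inf[OF _ _ ct] v by (metis atLeastAtMost_iff compact_Icc empty_iff less_imp_le order_refl)
  define T where "T = gap_root k a"
  have Tlt: "T < cayley v" using a(2)[of s] s neg unfolding T_def v_def by auto
  have "a \<noteq> v"
  proof
    assume "a = v"
    then have "gap_root k a = ch v + sh v" using h(3)[of v] v unfolding gap_root_def by simp
    then show False using Tlt ch_plus_sh[of v] v unfolding T_def by simp
  qed
  moreover have "a \<noteq> 0"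
  proof
    assume "a = 0"
    have "ch 0 = 1" "sh 0 = 0" unfolding ch_def sh_def by simp_all
    then have "gap_centre k 0 = (k^2 - 1) / 2" unfolding gap_centre_def by simp
    moreover have "0 \<le> (k^2 - 1) / 2" using k1 by simp
    ultimately have "gap_root k 0 = k^2" unfolding gap_root_def using \<open>ch 0 = 1\<close> \<open>sh 0 = 0\<close>
      by (simp del: real_sqrt_divide)
    then show False using Tlt cayley_nu_le(2)[OF k] \<open>a = 0\<close> unfolding T_def v_def by simp
  qed
  ultimately have a01: "0 < a" "a < v" using a(1) by auto
  then have a1: "0 \<le> a" "a < 1" using v by auto
  have Ha: "sh a < gap_centre k a" using h(2)[of a] a01 by simp
  have Sa: "0 < sh a" using a01 sq_lt_1[OF a1] unfolding sh_def by simp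
  have Ca: "0 < ch a" using sq_lt_1[OF a1] unfolding ch_def by (simp add: add_pos_nonneg)
  have "(sh a)^2 \<le> (gap_centre k a)^2" using Ha Sa by (intro power_mono) auto
  then have "0 \<le> sqrt ((gap_centre k a)^2 - (sh a)^2)" by simp
  then have Ta: "cayley a < T" using Ha ch_plus_sh[OF a1] unfolding T_def gap_root_def by linarith
  have "1 < T" using Ta cayley_ge_1[OF a1] by simp
  define r where "r = (T - 1) / (T + 1)"
  have Tdr: "cayley r = T" unfolding r_def using cayley_inverse[OF \<open>1 < T\<close>] .
  have r1: "r < 1" unfolding r_def using \<open>1 < T\<close> by simp
  have "a < r" using cayley_le_iff[of r a] r1 a1 Tdr Ta by (simp add: not_le[symmetric])
  \<comment> \<open>Within this distance s stays in the interval and cayley s stays below T.\<close>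
  define d where "d = min a (min (v - a) (r - a))"
  have d: "0 < d" unfolding d_def using a01 \<open>a < r\<close> by simp
  define g where "g = (\<lambda>y. gap k T (ch y) (sh y))"
  define q where "q = 2 / (1 - a^2)"
  define D where "D = (- sh a * ((k^2 + 1) * ch a - 2 * k * sh a)
      + (T - ch a) * ((k^2 + 1) * sh a - 2 * k * ch a)) * q"
  have "(g has_real_derivative D) (at a)"
    unfolding g_def gap_def D_def
    by (rule derivative_eq_intros ch_deriv[OF a1, folded q_def] sh_deriv[OF a1, folded q_def] refl)+
      (simp add: algebra_simps)
  moreover have ga: "g a = 0" unfolding g_def T_def using gap_gap_root[OF a1 less_imp_le[OF Ha]] .
  moreover have "g a \<le> g y" if "\<bar>a - y\<bar> < d" for y
  proof -
    have y: "0 \<le> y" "y < v" "y < r" using that unfolding d_def by auto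
    have "cayley y \<le> T" using cayley_le_iff[of y r] y r1 v Tdr by simp
    moreover have "T \<le> gap_root k y" unfolding T_def using a(2) y by simp
    ultimately show ?thesis unfolding ga unfolding g_def
      using gap_nonneg_below[of y k T] h(1)[of y] y v by simp
  qed
  ultimately have "D = 0" using DERIV_local_min[OF _ d] by blast
  then have crit: "(T - ch a) * ((k^2 + 1) * sh a - 2 * k * ch a) = sh a * ((k^2 + 1) * ch a - 2 * k * sh a)"
    using sq_lt_1[OF a1] unfolding D_def q_def by simp
  obtain z where z: "1 < z" "z < 2" "k = z + 2 / z" "T = tangency_T z"
    by (rule critical_point[OF k1 k3 ch_sh[OF a1] Sa Ca ga[unfolded g_def] crit])
  have "0 < crossing z" using tangency_T_vs_nu(1)[OF z(1,2)] Tlt unfolding z(4) v_def z(3)[symmetric] by simp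
  then show False using crossing_neg[OF z(1,2)] k(2) unfolding z(3)[symmetric] by simp
qed

lemma boundary_rate_ge_nu:
  assumes k: "1 + sqrt 2 \<le> k" "k^2 < kappa_bar" and s: "0 \<le> s" "s \<le> nu (k^2)"
  shows "boundary_rate_ge k (nu (k^2)) s"
proof -
  have k3: "k < 3" using cayley_nu_le[OF k] by simp
  have k1: "1 < k" using k(1) real_sqrt_gt_zero[of 2] by linarith
  note v = nu_props(1,2)[OF k1 k3]
  have s1: "s < 1" using s v by simp
  have "cayley s \<le> cayley (nu (k^2))" using cayley_le_iff s s1 v by simp
  then have "0 \<le> gap k (cayley (nu (k^2))) (ch s) (sh s)"
    using gap_nonneg_below[OF s(1) s1 gap_centre_ge_sh(1)[OF k1 k3 s]] gap_root_ge_cayley_nu[OF k s] by simp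
  then show ?thesis using boundary_rate_ge_iff_gap[OF v s(1) s1] by simp
qed

lemma middle_kappa:
  fixes m k :: real
  assumes m: "0 < m" and k: "1 + sqrt 2 \<le> k" "k^2 < kappa_bar" and v: "v = nu (k^2)"
    and L: "L = k^2 * m" and n: "0 < n"
  shows "r_star n m L = v" "r_star_achieved_at n m L (alpha_bar m L (v^2)) (v^2)"
    "inf_sup_R_factor (F2 m L :: (real^'n \<Rightarrow> real) set) \<le> ereal v"
proof -
  have k1: "1 < k" using k(1) real_sqrt_gt_zero[of 2] by linarith
  have k3: "k < 3" and T: "cayley v \<le> k^2" using cayley_nu_le[OF k] unfolding v by auto
  have v01: "0 < v" "v < 1" unfolding v using nu_props[OF k1 k3] by auto
  have vK: "v \<le> (k^2 - 1) / (k^2 + 1)" using le_of_cayley_le[OF v01(2) _ T] k1 by simp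
  note bt = boundary_tuning[OF m k1 nu_ge[OF k(1) k3, folded v] order_refl v01(2) vK nu_equality[OF k1 k3 v]
      boundary_rate_ge_nu[OF k, folded v] L n]
  show "r_star n m L = v" "r_star_achieved_at n m L (alpha_bar m L (v^2)) (v^2)"
    "inf_sup_R_factor (F2 m L :: (real^'n \<Rightarrow> real) set) \<le> ereal v"
    by ((rule bt; assumption))+
qed

section \<open>Large condition numbers and the theorem\<close>

lemma large_kappa:
  fixes m k :: real
  assumes m: "0 < m" and k: "0 < k" "kappa_bar \<le> k^2" and L: "L = k^2 * m" and n: "0 < n"
  shows "r_star n m L = eta m L (beta0 (k^2))" "r_star_achieved_at n m L (alpha_bar m L (beta0 (k^2))) (beta0 (k^2))"
    "inf_sup_R_factor (F2 m L :: (real^'n \<Rightarrow> real) set) \<le> ereal (eta m L (beta0 (k^2)))"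
proof -
  define z where "z = zroot k"
  have k8: "8 \<le> k^2" using k(2) kappa_bar_bounds(1) by simp
  have z: "1 < z" "2 \<le> z^2" "z + 2 / z = k" unfolding z_def using zroot[OF k8 k(1)] by auto
  have cr: "2 \<le> (z^2 + 1) * (z - 1)^2"
    using kappa_bar_le_iff[OF z(1,2)] k(2) unfolding z(3) crossing_def by simp
  have k1: "1 < k" using kappa_root_gt_1[OF z(1)] unfolding z(3) .
  note bt = boundary_tuning[OF m k1 tangency_s_ge[OF z(1), unfolded z(3)] tangency_s_le_rate[OF z(1)] tangency_rate_bounds(2)[OF z(1)]
      tangency_rate_le[OF z(1,2), unfolded z(3)] tangency_rate_equality[OF z(1), unfolded z(3)]
      boundary_rate_ge_tangency[OF z(1) cr, unfolded z(3)] L n]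
  have e: "eta m L (beta0 (k^2)) = tangency_rate z" "beta0 (k^2) = (tangency_s z)^2"
    using eta_beta0[OF z(1,2) m] beta0_eq[OF z(1,2)] unfolding z(3) L by auto
  show "r_star n m L = eta m L (beta0 (k^2))" "r_star_achieved_at n m L (alpha_bar m L (beta0 (k^2))) (beta0 (k^2))"
    "inf_sup_R_factor (F2 m L :: (real^'n \<Rightarrow> real) set) \<le> ereal (eta m L (beta0 (k^2)))"
    unfolding e(1) unfolding e(2) by ((rule bt; assumption))+
qed

theorem theorem4:
  fixes m L :: real
  assumes "0 < m" and "m < L"
  shows
    "(INF (\<alpha>, \<beta>)\<in>GHB_set (F2 m L :: (real^'n \<Rightarrow> real) set).
        SUP f\<in>(F2 m L :: (real^'n \<Rightarrow> real) set). r_GHB \<alpha> \<beta> f)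
      \<le> ereal (r_star CARD('n) m L)
    \<and> (1 < L/m \<and> L/m \<le> kappa0 \<longrightarrow>
        r_star CARD('n) m L = (sqrt L - sqrt m) / (sqrt L + sqrt m) \<and>
        r_star_achieved_at CARD('n) m L
          (4 / (sqrt L + sqrt m)^2) (((sqrt L - sqrt m) / (sqrt L + sqrt m))^2) \<and>
        (L/m < kappa0 \<longrightarrow>
          4 / (sqrt L + sqrt m)^2
            < alpha_bar m L (((sqrt L - sqrt m) / (sqrt L + sqrt m))^2)))
    \<and> (kappa0 \<le> L/m \<and> L/m < kappa_bar \<longrightarrow>
        r_star CARD('n) m L = nu (L/m) \<and>
        r_star_achieved_at CARD('n) m L (alpha_bar m L ((nu (L/m))^2)) ((nu (L/m))^2))
    \<and> (kappa_bar \<le> L/m \<longrightarrow>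
        r_star CARD('n) m L = eta m L (beta0 (L/m)) \<and>
        r_star_achieved_at CARD('n) m L (alpha_bar m L (beta0 (L/m))) (beta0 (L/m)))"
proof -
  define k where "k = sqrt (L / m)"
  have "1 < L / m" using assms by simp
  then have k: "1 < k" "L / m = k\<^sup>2" unfolding k_def using real_sqrt_gt_1_iff[of "L / m"] by auto
  have L: "L = k\<^sup>2 * m" unfolding k(2)[symmetric] using assms by simp
  have n: "0 < CARD('n)" by simp
  have k0: "0 < k" using k by simp
  define w where "w = (k - 1) / (k + 1)"
  define a where "a = 4 / (m * (k + 1)\<^sup>2)"
  have sL: "sqrt L = k * sqrt m" unfolding L using k by (simp add: real_sqrt_mult)
  have "sqrt L - sqrt m = (k - 1) * sqrt m" "sqrt L + sqrt m = (k + 1) * sqrt m"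
    unfolding sL by (simp_all add: algebra_simps)
  then have w': "(sqrt L - sqrt m) / (sqrt L + sqrt m) = w" and a': "4 / (sqrt L + sqrt m)^2 = a"
    unfolding w_def a_def using assms(1) by (simp_all add: power_mult_distrib mult.commute)
  note r1 = small_kappa[OF assms(1) k(1) _ w_def a_def L n]
  note r2 = middle_kappa[OF assms(1) _ _ refl L n]
  note r3 = large_kappa[OF assms(1) k0 _ L n]
  note kap = kappa0_le_iff[OF k0]
  show ?thesis unfolding k(2) w' a'
  proof (intro conjI impI; (elim conjE)?)
    show "inf_sup_R_factor (F2 m L :: (real^'n \<Rightarrow> real) set) \<le> ereal (r_star CARD('n) m L)"
    proof -
      consider "k \<le> 1 + sqrt 2" | "1 + sqrt 2 \<le> k" "k\<^sup>2 < kappa_bar" | "kappa_bar \<le> k\<^sup>2" by linarith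
      then show ?thesis
      proof cases
        case 1 show ?thesis unfolding r1(1)[OF 1] by (rule r1(3)[OF 1])
      next
        case 2 show ?thesis unfolding r2(1)[OF 2] by (rule r2(3)[OF 2])
      next
        case 3 show ?thesis unfolding r3(1)[OF 3] by (rule r3(3)[OF 3])
      qed
    qed
    show "r_star CARD('n) m L = w" "r_star_achieved_at CARD('n) m L a (w\<^sup>2)" if "k\<^sup>2 \<le> kappa0"
      using r1(1,2) that kap by auto
    show "a < alpha_bar m L (w\<^sup>2)" if "k\<^sup>2 < kappa0"
      using r1(4) that kap by (simp add: not_le[symmetric])
    show "r_star CARD('n) m L = nu (k\<^sup>2)" "r_star_achieved_at CARD('n) m L (alpha_bar m L ((nu (k\<^sup>2))\<^sup>2)) ((nu (k\<^sup>2))\<^sup>2)"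
      if "kappa0 \<le> k\<^sup>2" "k\<^sup>2 < kappa_bar"
      using r2(1,2) that kap by auto
    show "r_star CARD('n) m L = eta m L (beta0 (k\<^sup>2))"
      "r_star_achieved_at CARD('n) m L (alpha_bar m L (beta0 (k\<^sup>2))) (beta0 (k\<^sup>2))" if "kappa_bar \<le> k\<^sup>2"
      using r3(1,2) that by auto
  qed
qed

end
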